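(* Consider the Brownian case $\gamma=2$: let $(\mathcal T,d)$ be the $2$-stable tree under the excursion measure $\mathbf N$, with mass measure $\mathbf m$, and set $f(r)=r^2\log 1/r$ for $r\in(0,e^{-1})$. Then there exist constants $k,K\in(0,\infty)$ such that $\mathbf N$-a.e. $$k\ \le\ \liminf_{r\to0}\frac{1}{f(r)}\sup_{\sigma\in\mathcal T}\mathbf m(B(\sigma,r))\ \le\ \limsup_{r\to0}\frac{1}{f(r)}\sup_{\sigma\in\mathcal T}\mathbf m(B(\sigma,r))\ \le\ K .$$
   Context: Let $X=(X_t)_{t\ge 0}$ be the L\'evy process on a probability space $(\Omega,\mathcal F,\mathbf P)$ with $X_0=0$ and $\mathbf E[\exp(-\lambda X_t)] = \exp(t\lambda^2)$ for $t,\lambda\ge 0$ (a Brownian motion with variance $2t$; this is the case $\gamma=2$ of the spectrally positive $\gamma$-stable process with $\mathbf E[\exp(-\lambda X_t)] = \exp(t\lambda^\gamma)$). Set $I_t=\inf_{0\le s\le t}X_s$ and $I^s_t=\inf_{s\le r\le t}X_r$. The height process is the continuous process $H=(H_t)_{t\ge0}$ such that, for each $t$, $H_t=\lim_{\varepsilon\to0}\frac1\varepsilon\int_0^t \mathbf 1_{\{I^s_t<X_s<I^s_t+\varepsilon\}}ds$ in probability. The process $-I$ is a local time at $0$ for the strong Markov process $X-I$. $\mathbf N$ denotes the excursion measure of $X-I$ above $0$ associated with the local time $-I$. If $t$ lies in an excursion interval of $X-I$, then $H_t$ depends only on the corresponding excursion; hence $H$ is defined under $\mathbf N$ as a measurable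 functional of the excursion. Equivalently, if $(a_j,b_j)$, $j\in\mathcal I$, are the excursion intervals of $X-I$ above $0$ (which are also those of $H$ above $0$) and $H^j=H_{(a_j+\cdot)\wedge b_j}$, then $\sum_{j}\delta_{(-I_{a_j},H^j)}$ is, under $\mathbf P$, a Poisson point measure on $[0,\infty)\times C([0,\infty),\mathbb R)$ with intensity $\ell\otimes\mathbf N$ ($\ell$ = Lebesgue measure). Let $\zeta$ be the lifetime of $H$ under $\mathbf N$; one has $0<\zeta<\infty$ $\mathbf N$-a.e. Under $\mathbf N$, for $s,t\in[0,\zeta]$ let $d(s,t)=H_s+H_t-2\min_{s\wedge t\le r\le s\vee t}H_r$, a pseudo-metric; write $s\sim t$ iff $d(s,t)=0$. The $2$-stable tree is the compact metric space $(\mathcal T,d)=([0,\zeta]/\!\sim,\,d)$, with canonical projection $\mathrm p:[0,\zeta]\to\mathcal T$. The mass measure is $\mathbf m(A)=\ell(\mathrm p^{-1}(A))$ for Borel $A\subset\mathcal T$. $B(\sigma,r)$ is the open ball in $\mathcal T$ with center $\sigma$ and radius $r$. *)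

theory Defs
  imports "HOL-Probability.Probability"
begin

section \<open>Levy processes and running infima\<close>

text \<open>Processes are indexed by all of \<^typ>\<open>real\<close>; only times \<open>t \<ge> 0\<close> matter.\<close>

definition cadlag :: "(real \<Rightarrow> real) \<Rightarrow> bool" where
  "cadlag x \<longleftrightarrow>
     (\<forall>t\<ge>0. (x \<longlongrightarrow> x t) (at_right t)) \<and> (\<forall>t>0. \<exists>l. (x \<longlongrightarrow> l) (at_left t))"

locale levy_process = prob_space M for M :: "'a measure" +
  fixes X :: "real \<Rightarrow> 'a \<Rightarrow> real"
  assumes rv: "\<And>t. 0 \<le> t \<Longrightarrow> random_variable borel (X t)"
    and start: "\<And>\<omega>. \<omega> \<in> space M \<Longrightarrow> X 0 \<omega> = 0"
    and paths: "\<And>\<omega>. \<omega> \<in> space M \<Longrightarrow> cadlag (\<lambda>t. X t \<omega>)"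
    and independent_increments:
      "\<And>(t :: nat \<Rightarrow> real) n. 0 \<le> t 0 \<Longrightarrow> mono t \<Longrightarrow>
        indep_vars (\<lambda>_. borel) (\<lambda>i \<omega>. X (t (Suc i)) \<omega> - X (t i) \<omega>) {..<n}"
    and stationary_increments:
      "\<And>s t. 0 \<le> s \<Longrightarrow> 0 \<le> t \<Longrightarrow>
        distr M borel (\<lambda>\<omega>. X (s + t) \<omega> - X s \<omega>) = distr M borel (X t)"

text \<open>Since the Bochner integral of a non-integrable function is 0, the Laplace
  condition includes integrability of \<open>exp (- c X\<^sub>t)\<close>.\<close>

locale stable2_levy_process = levy_process +
  assumes laplace: "\<And>t c. 0 \<le> t \<Longrightarrow> 0 \<le> c \<Longrightarrow> expectation (\<lambda>\<omega>. exp (- c * X t \<omega>)) = exp (t * c\<^sup>2)"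

text \<open>\<open>inf_from x s t\<close> is \<open>I\<^sup>s\<^sub>t\<close>, and \<open>inf_from x 0 t\<close> is \<open>I\<^sub>t\<close>.\<close>

definition inf_from :: "(real \<Rightarrow> real) \<Rightarrow> real \<Rightarrow> real \<Rightarrow> real" where
  "inf_from x s t = (INF r\<in>{s..t}. x r)"

definition height_approx :: "(real \<Rightarrow> real) \<Rightarrow> real \<Rightarrow> real \<Rightarrow> real" where
  "height_approx x \<epsilon> t =
     (1 / \<epsilon>) * (LBINT s:{0..t}. indicat_real {s. inf_from x s t < x s \<and> x s < inf_from x s t + \<epsilon>} s)"

locale height_process = stable2_levy_process M X for M :: "'a measure" and X +
  fixes H :: "real \<Rightarrow> 'a \<Rightarrow> real"
  assumes H_rv: "\<And>t. 0 \<le> t \<Longrightarrow> random_variable borel (H t)"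
    and H_paths: "\<And>\<omega>. \<omega> \<in> space M \<Longrightarrow> continuous_on {0..} (\<lambda>t. H t \<omega>)"
    and H_limit_in_probability:
      "\<And>t \<delta>. 0 \<le> t \<Longrightarrow> 0 < \<delta> \<Longrightarrow>
        ((\<lambda>\<epsilon>. prob {\<omega> \<in> space M. \<delta> < \<bar>height_approx (\<lambda>s. X s \<omega>) \<epsilon> t - H t \<omega>\<bar>}) \<longlongrightarrow> 0) (at_right 0)"


section \<open>Poisson point measures and the excursion measure\<close>

text \<open>A random point measure is a family \<open>\<Theta> \<omega>\<close> of measures. The intensity \<open>\<mu>\<close> is meant
  to be sigma-finite.\<close>

definition poisson_point_measure :: "'a measure \<Rightarrow> ('a \<Rightarrow> 'b measure) \<Rightarrow> 'b measure \<Rightarrow> bool" where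
  "poisson_point_measure M \<Theta> \<mu> \<longleftrightarrow>
     (\<forall>A\<in>sets \<mu>. (\<lambda>\<omega>. emeasure (\<Theta> \<omega>) A) \<in> borel_measurable M) \<and>
     (\<forall>A\<in>sets \<mu>. emeasure \<mu> A < \<infinity> \<longrightarrow>
        (\<forall>k::nat. measure M {\<omega> \<in> space M. emeasure (\<Theta> \<omega>) A = of_nat k} =
           measure \<mu> A ^ k / fact k * exp (- measure \<mu> A))) \<and>
     (\<forall>A\<in>sets \<mu>. emeasure \<mu> A = \<infinity> \<longrightarrow> (AE \<omega> in M. emeasure (\<Theta> \<omega>) A = \<infinity>)) \<and>
     (\<forall>(A :: nat \<Rightarrow> 'b set) n. (\<forall>i. A i \<in> sets \<mu>) \<longrightarrow> disjoint_family A \<longrightarrow>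
        prob_space.indep_vars M (\<lambda>_. borel) (\<lambda>i \<omega>. emeasure (\<Theta> \<omega>) (A i)) {..<n})"

text \<open>\<open>C([0,\<infinity>), \<real>)\<close> with the sigma-algebra generated by the coordinates, which is its Borel
  sigma-algebra for locally uniform convergence. Its elements are extensional functions:
  they take the value \<^const>\<open>undefined\<close> at negative times.\<close>

definition path_space :: "(real \<Rightarrow> real) measure" where
  "path_space = restrict_space (PiM {0..} (\<lambda>_. borel)) {w. continuous_on {0..} w}"

definition excursion_intervals :: "(real \<Rightarrow> real) \<Rightarrow> (real \<times> real) set" where
  "excursion_intervals g =
     {(a, b). 0 \<le> a \<and> a < b \<and> g a = 0 \<and> g b = 0 \<and> (\<forall>t\<in>{a<..<b}. 0 < g t)}"

definition stopped_excursion :: "(real \<Rightarrow> real) \<Rightarrow> real \<times> real \<Rightarrow> real \<Rightarrow> real" where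
  "stopped_excursion h = (\<lambda>(a, b). \<lambda>s\<in>{0..}. h (min (a + s) b))"

text \<open>The point measure is \<open>\<Sum>\<^sub>j \<delta>\<close> at the points \<open>(- I\<close> at \<open>a\<^sub>j, H\<^sup>j)\<close>, written as the image of
  the counting measure on the set of excursion intervals of \<open>X - I\<close>. The second
  argument \<open>N\<close> only contributes its sigma-algebra.\<close>

definition excursion_point_measure ::
    "(real \<Rightarrow> real) \<Rightarrow> (real \<Rightarrow> real) \<Rightarrow> (real \<Rightarrow> real) measure \<Rightarrow> (real \<times> (real \<Rightarrow> real)) measure" where
  "excursion_point_measure x h N =
     distr (count_space (excursion_intervals (\<lambda>t. x t - inf_from x 0 t)))
       (restrict_space lborel {0..} \<Otimes>\<^sub>M N)
       (\<lambda>j. (- inf_from x 0 (fst j), stopped_excursion h j))"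

text \<open>\<open>N\<close> is the law of the height process under the excursion measure of \<open>X - I\<close> above 0
  associated with the local time \<open>- I\<close>; these conditions determine it uniquely.\<close>

locale height_excursion_measure = height_process M X H for M :: "'a measure" and X H +
  fixes N :: "(real \<Rightarrow> real) measure"
  assumes sets_N: "sets N = sets path_space"
    and sigma_finite_N: "sigma_finite_measure N"
    and poisson_excursions:
      "poisson_point_measure M (\<lambda>\<omega>. excursion_point_measure (\<lambda>t. X t \<omega>) (\<lambda>t. H t \<omega>) N)
         (restrict_space lborel {0..} \<Otimes>\<^sub>M N)"


section \<open>The tree coded by a path\<close>

definition lifetime :: "(real \<Rightarrow> real) \<Rightarrow> real" where
  "lifetime w = Sup {t. 0 \<le> t \<and> w t \<noteq> 0}"

definition tree_pdist :: "(real \<Rightarrow> real) \<Rightarrow> real \<Rightarrow> real \<Rightarrow> real" where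
  "tree_pdist w s t = w s + w t - 2 * (INF r\<in>{min s t..max s t}. w r)"

definition tree_rel :: "(real \<Rightarrow> real) \<Rightarrow> (real \<times> real) set" where
  "tree_rel w = {(s, t). s \<in> {0..lifetime w} \<and> t \<in> {0..lifetime w} \<and> tree_pdist w s t = 0}"

definition tree :: "(real \<Rightarrow> real) \<Rightarrow> real set set" where
  "tree w = {0..lifetime w} // tree_rel w"

definition tree_proj :: "(real \<Rightarrow> real) \<Rightarrow> real \<Rightarrow> real set" where
  "tree_proj w s = tree_rel w `` {s}"

text \<open>The choice of representatives is immaterial, see \<open>tree_dist_proj\<close> below. The value 0
  outside the tree is there because \<^locale>\<open>Metric_space\<close> demands symmetry and
  nonnegativity on the whole type.\<close>

definition tree_dist :: "(real \<Rightarrow> real) \<Rightarrow> real set \<Rightarrow> real set \<Rightarrow> real" where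
  "tree_dist w \<sigma> \<tau> =
     (if \<sigma> \<in> tree w \<and> \<tau> \<in> tree w
      then tree_pdist w (SOME s. s \<in> \<sigma>) (SOME t. t \<in> \<tau>) else 0)"

abbreviation tree_topology :: "(real \<Rightarrow> real) \<Rightarrow> real set topology" where
  "tree_topology w \<equiv> Metric_space.mtopology (tree w) (tree_dist w)"

abbreviation tree_ball :: "(real \<Rightarrow> real) \<Rightarrow> real set \<Rightarrow> real \<Rightarrow> real set set" where
  "tree_ball w \<equiv> Metric_space.mball (tree w) (tree_dist w)"

definition mass_measure :: "(real \<Rightarrow> real) \<Rightarrow> real set measure" where
  "mass_measure w =
     distr (restrict_space lborel {0..lifetime w})
       (sigma (tree w) {U. openin (tree_topology w) U}) (tree_proj w)"


subsection \<open>Consistency of the encoding\<close>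

lemma path_space_D:
  assumes "w \<in> space path_space"
  shows "continuous_on {0..} w"
  using assms by (simp add: path_space_def space_restrict_space)

lemma stopped_excursion_in_path_space:
  assumes h: "continuous_on {0..} h" and "0 \<le> a" "a < b"
  shows "stopped_excursion h (a, b) \<in> space path_space"
proof -
  have "continuous_on {0..} (\<lambda>s. h (min (a + s) b))"
    by (rule continuous_on_compose2[OF h]) (use assms in \<open>auto intro!: continuous_intros\<close>)
  then have "continuous_on {0..} (\<lambda>s\<in>{0..}. h (min (a + s) b))"
    by (rule continuous_on_eq) simp
  then show ?thesis
    by (simp add: stopped_excursion_def path_space_def space_restrict_space space_PiM)
qed

context
  fixes w :: "real \<Rightarrow> real"
  assumes w: "continuous_on {0..} w"
begin

lemma bdd_below_path: "0 \<le> a \<Longrightarrow> bdd_below (w ` {a..b})"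
  by (intro bounded_imp_bdd_below compact_imp_bounded compact_continuous_image
      continuous_on_subset[OF w]) auto

lemma path_Inf_le: "0 \<le> a \<Longrightarrow> r \<in> {a..b} \<Longrightarrow> (INF r\<in>{a..b}. w r) \<le> w r"
  by (rule cINF_lower[OF bdd_below_path])

lemma tree_pdist_refl [simp]: "tree_pdist w s s = 0"
  by (simp add: tree_pdist_def)

lemma tree_pdist_commute: "tree_pdist w s t = tree_pdist w t s"
  by (simp add: tree_pdist_def min.commute max.commute)

lemma tree_pdist_nonneg:
  assumes "0 \<le> s" "0 \<le> t"
  shows "0 \<le> tree_pdist w s t"
  using path_Inf_le[of "min s t" s "max s t"] path_Inf_le[of "min s t" t "max s t"] assms
  by (simp add: tree_pdist_def)

lemma tree_pdist_triangle:
  assumes "0 \<le> s" "0 \<le> t" "0 \<le> u"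
  shows "tree_pdist w s u \<le> tree_pdist w s t + tree_pdist w t u"
proof -
  define m where "m = (\<lambda>a b. INF r\<in>{min a b..max a b}. w r)"
  have m1: "m s t \<le> w t" "m t u \<le> w t"
    using assms by (auto simp: m_def intro!: path_Inf_le)
  have "min (m s t) (m t u) \<le> m s u"
    unfolding m_def
  proof (rule cINF_greatest)
    fix r assume "r \<in> {min s u..max s u}"
    then have "r \<in> {min s t..max s t} \<or> r \<in> {min t u..max t u}"
      by (auto simp: min_def max_def split: if_splits)
    then have "(INF r\<in>{min s t..max s t}. w r) \<le> w r \<or> (INF r\<in>{min t u..max t u}. w r) \<le> w r"
      using assms by (meson min.boundedI path_Inf_le)
    then show "min (INF r\<in>{min s t..max s t}. w r) (INF r\<in>{min t u..max t u}. w r) \<le> w r"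
      by linarith
  qed auto
  moreover have "tree_pdist w a b = w a + w b - 2 * m a b" for a b
    by (simp add: tree_pdist_def m_def)
  ultimately show ?thesis
    using m1 by (simp add: min_def split: if_splits)
qed

lemma equiv_tree_rel: "equiv {0..lifetime w} (tree_rel w)"
proof (rule equivI)
  show "trans (tree_rel w)"
  proof (rule transI)
    fix s t u assume st: "(s, t) \<in> tree_rel w" and tu: "(t, u) \<in> tree_rel w"
    then have "0 \<le> s" "0 \<le> t" "0 \<le> u" by (auto simp: tree_rel_def)
    then have "tree_pdist w s u \<le> 0" "0 \<le> tree_pdist w s u"
      using tree_pdist_triangle[of s t u] tree_pdist_nonneg[of s u] st tu
      by (auto simp: tree_rel_def)
    then show "(s, u) \<in> tree_rel w"
      using st tu by (auto simp: tree_rel_def)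
  qed
qed (auto simp: tree_rel_def refl_on_def sym_def tree_pdist_commute)

lemma tree_eq: "tree w = tree_proj w ` {0..lifetime w}"
  by (auto simp: tree_def tree_proj_def quotient_def)

lemma tree_proj_eq_iff:
  "s \<in> {0..lifetime w} \<Longrightarrow> t \<in> {0..lifetime w} \<Longrightarrow>
    tree_proj w s = tree_proj w t \<longleftrightarrow> tree_pdist w s t = 0"
  using eq_equiv_class_iff[OF equiv_tree_rel, of s t]
  by (auto simp: tree_proj_def tree_rel_def)

lemma tree_dist_proj:
  assumes s: "s \<in> {0..lifetime w}" and t: "t \<in> {0..lifetime w}"
  shows "tree_dist w (tree_proj w s) (tree_proj w t) = tree_pdist w s t"
proof -
  have rep: "(SOME a. a \<in> tree_proj w r) \<in> {0..lifetime w} \<and>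
      tree_pdist w r (SOME a. a \<in> tree_proj w r) = 0" if "r \<in> {0..lifetime w}" for r
  proof -
    have "r \<in> tree_proj w r" using that by (simp add: tree_proj_def tree_rel_def)
    then have "(SOME a. a \<in> tree_proj w r) \<in> tree_proj w r" by (rule someI)
    then show ?thesis unfolding tree_proj_def tree_rel_def by blast
  qed
  define s' t' where "s' = (SOME a. a \<in> tree_proj w s)" and "t' = (SOME a. a \<in> tree_proj w t)"
  have *: "0 \<le> s'" "0 \<le> t'" "tree_pdist w s s' = 0" "tree_pdist w t t' = 0" "0 \<le> s" "0 \<le> t"
    using rep[OF s] rep[OF t] s t by (auto simp: s'_def t'_def)
  have "tree_pdist w s' t' = tree_pdist w s t"
    using * tree_pdist_triangle[of s' s t'] tree_pdist_triangle[of s t t']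
      tree_pdist_triangle[of s s' t] tree_pdist_triangle[of s' t' t]
      tree_pdist_commute[of s s'] tree_pdist_commute[of t t'] by linarith
  then show ?thesis
    using s t by (simp add: tree_dist_def s'_def t'_def tree_eq)
qed

lemma Metric_space_tree: "Metric_space (tree w) (tree_dist w)"
proof
  fix \<sigma> \<tau> \<upsilon>
  have out: "tree_dist w \<sigma> \<tau> = 0" if "\<sigma> \<notin> tree w \<or> \<tau> \<notin> tree w" for \<sigma> \<tau>
    using that by (auto simp: tree_dist_def)
  show "0 \<le> tree_dist w \<sigma> \<tau>"
    by (cases "\<sigma> \<in> tree w \<and> \<tau> \<in> tree w")
      (auto simp: out tree_eq tree_dist_proj intro!: tree_pdist_nonneg)
  show "tree_dist w \<sigma> \<tau> = tree_dist w \<tau> \<sigma>"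
    by (simp add: tree_dist_def tree_pdist_commute)
  show "tree_dist w \<sigma> \<tau> = 0 \<longleftrightarrow> \<sigma> = \<tau>" if "\<sigma> \<in> tree w" "\<tau> \<in> tree w"
    using that unfolding tree_eq
    by (elim imageE) (simp only: tree_dist_proj tree_proj_eq_iff)
  show "tree_dist w \<sigma> \<upsilon> \<le> tree_dist w \<sigma> \<tau> + tree_dist w \<tau> \<upsilon>"
    if "\<sigma> \<in> tree w" "\<tau> \<in> tree w" "\<upsilon> \<in> tree w"
    using that by (auto simp: tree_eq tree_dist_proj intro!: tree_pdist_triangle)
qed

lemma tree_pdist_small:
  assumes s: "0 \<le> s" and e: "0 < e"
  obtains d where "0 < d" "\<And>t. 0 \<le> t \<Longrightarrow> \<bar>t - s\<bar> < d \<Longrightarrow> tree_pdist w s t < e"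
proof -
  obtain d where d: "0 < d" "\<And>t. 0 \<le> t \<Longrightarrow> \<bar>t - s\<bar> < d \<Longrightarrow> \<bar>w t - w s\<bar> < e / 4"
    using w s e unfolding continuous_on_iff dist_real_def
    by (metis atLeast_iff zero_less_divide_iff zero_less_numeral)
  have "tree_pdist w s t < e" if t: "0 \<le> t" "\<bar>t - s\<bar> < d" for t
  proof -
    have "w s - e / 4 \<le> (INF r\<in>{min s t..max s t}. w r)"
    proof (rule cINF_greatest)
      fix r assume "r \<in> {min s t..max s t}"
      then have "0 \<le> r" "\<bar>r - s\<bar> < d" using s t by (auto simp: min_def max_def split: if_splits)
      from d(2)[OF this] show "w s - e / 4 \<le> w r" by linarith
    qed auto
    moreover have "w t - w s < e / 4" using d(2)[OF t] by linarith
    moreover have "x + y - 2 * i < e" if "x - e / 4 \<le> i" "y - x < e / 4" for x y i :: real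
      using that e by linarith
    ultimately show ?thesis unfolding tree_pdist_def by blast
  qed
  then show ?thesis using d(1) that by blast
qed

lemma openin_proj_vimage:
  assumes U: "openin (tree_topology w) U"
  shows "openin (top_of_set {0..lifetime w}) (tree_proj w -` U \<inter> {0..lifetime w})"
proof -
  interpret T: Metric_space "tree w" "tree_dist w" by (rule Metric_space_tree)
  show ?thesis
    unfolding openin_euclidean_subtopology_iff
  proof (intro conjI ballI)
    fix s assume s: "s \<in> tree_proj w -` U \<inter> {0..lifetime w}"
    then obtain e where e: "0 < e" "T.mball (tree_proj w s) e \<subseteq> U"
      using U unfolding T.openin_mtopology by blast
    obtain d where d: "0 < d" "\<And>t. 0 \<le> t \<Longrightarrow> \<bar>t - s\<bar> < d \<Longrightarrow> tree_pdist w s t < e"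
      using tree_pdist_small[of s e] s e by auto
    show "\<exists>d>0. \<forall>t\<in>{0..lifetime w}. dist t s < d \<longrightarrow> t \<in> tree_proj w -` U \<inter> {0..lifetime w}"
    proof (intro exI[of _ d] conjI ballI impI d(1))
      fix t assume t: "t \<in> {0..lifetime w}" "dist t s < d"
      then have "tree_proj w t \<in> T.mball (tree_proj w s) e"
        using s d(2)[of t] unfolding T.in_mball
        by (auto simp: tree_eq tree_dist_proj dist_real_def)
      then show "t \<in> tree_proj w -` U \<inter> {0..lifetime w}" using e t by auto
    qed
  qed auto
qed

lemma measurable_tree_proj:
  "tree_proj w \<in> restrict_space lborel {0..lifetime w} \<rightarrow>\<^sub>M
     sigma (tree w) {U. openin (tree_topology w) U}"
proof (rule measurable_measure_of)
  interpret T: Metric_space "tree w" "tree_dist w" by (rule Metric_space_tree)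
  show "{U. openin (tree_topology w) U} \<subseteq> Pow (tree w)"
    using openin_subset by fastforce
  show "tree_proj w \<in> space (restrict_space lborel {0..lifetime w}) \<rightarrow> tree w"
    by (auto simp: space_restrict_space tree_eq)
  fix U assume "U \<in> {U. openin (tree_topology w) U}"
  then obtain V where "open V" "tree_proj w -` U \<inter> {0..lifetime w} = {0..lifetime w} \<inter> V"
    using openin_proj_vimage by (auto simp: openin_open)
  then show "tree_proj w -` U \<inter> space (restrict_space lborel {0..lifetime w})
      \<in> sets (restrict_space lborel {0..lifetime w})"
    by (auto simp: space_restrict_space sets_restrict_space)
qed

lemma emeasure_mass_measure:
  assumes "A \<in> sets (mass_measure w)"
  shows "emeasure (mass_measure w) A = emeasure lborel {s \<in> {0..lifetime w}. tree_proj w s \<in> A}"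
proof -
  have "emeasure (mass_measure w) A =
      emeasure (restrict_space lborel {0..lifetime w}) (tree_proj w -` A \<inter> {0..lifetime w})"
    using assms measurable_tree_proj
    by (simp add: mass_measure_def emeasure_distr space_restrict_space)
  also have "\<dots> = emeasure lborel (tree_proj w -` A \<inter> {0..lifetime w})"
    by (rule emeasure_restrict_space) auto
  finally show ?thesis by (simp add: vimage_def Int_def conj_commute)
qed

lemma tree_ball_in_sets: "tree_ball w \<sigma> r \<in> sets (mass_measure w)"
proof -
  interpret T: Metric_space "tree w" "tree_dist w" by (rule Metric_space_tree)
  have "{U. openin (tree_topology w) U} \<subseteq> Pow (tree w)"
    using openin_subset by fastforce
  then show ?thesis
    by (auto simp: mass_measure_def T.openin_mball intro!: sigma_sets.Basic)
qed

end

end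

theory Submission
  imports Defs "HOL-Complex_Analysis.Complex_Analysis" "HOL-Real_Asymp.Real_Asymp"
begin

text \<open>
  For \<open>\<gamma> = 2\<close> the height process is the reflected process, \<open>H = X - I\<close>, so an excursion of \<open>H\<close> is
  a Brownian excursion and the tree is a Brownian tree. At scale \<open>\<rho> = 2\<^sup>-\<^sup>n\<close> the typical mass of a
  ball is \<open>\<rho>\<^sup>2\<close>. A logarithmic factor comes from the extremes: the probability that a ball has mass
  \<open>c n \<rho>\<^sup>2\<close> is exponentially small in \<open>n\<close>, with a rate proportional to \<open>c\<close>. A mass above a large multiple
  of \<open>n \<rho>\<^sup>2\<close> is therefore beaten by a union bound over a polynomially (in \<open>1 / \<rho>\<close>) fine grid of centres,
  while a small multiple of \<open>n \<rho>\<^sup>2\<close> is reached by one of the exponentially many places where it is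
  attempted independently.

  Both estimates concern the random walk that \<open>X\<close> induces on the grid of mesh \<open>\<delta> = 8\<^sup>-\<^sup>n\<close>, which is so fine
  that \<open>X\<close> moves by less than \<open>\<rho>\<close> inside a cell (\<open>AE_modulus\<close>).

  \<^item> Lower bound. If the path stays within \<open>O(\<rho>)\<close> of its value during a time interval of length
    \<open>n 4\<^sup>-\<^sup>n = n \<rho>\<^sup>2\<close>, the whole interval is projected into one ball of radius \<open>O(\<rho>)\<close>. Such a confinement has
    probability at least of order \<open>e\<^sup>-\<^sup>n\<close> (\<open>confinement\<close>, by an eigenfunction argument with a cosine), and
    \<open>3\<^sup>n\<close> disjoint intervals are available in an arbitrarily short time
    (\<open>no_confined_block\<close>, \<open>AE_flat_block\<close>).

  \<^item> Upper bound. A point \<open>t\<close> is within distance \<open>\<rho> / 2\<close> of \<open>s\<close> in the tree only if the path on the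
    interval between them never goes \<open>\<rho> / 2\<close> below its value at \<open>s\<close> and ends at most \<open>\<rho> / 2\<close> above it.
    Thus the ball is covered by the visits of the walk, started at \<open>s\<close> and followed in both time
    directions, to a strip of width \<open>O(\<rho>)\<close> before it falls below the strip. The number of
    these visits has an exponential tail at scale \<open>\<rho>\<^sup>2 / \<delta> = 2\<^sup>n\<close> (\<open>visits_exp_moment\<close>), so that it is
    \<open>O(n 2\<^sup>n)\<close> at all grid points simultaneously (\<open>AE_visits\<close>). Each visit contributes the mass
    \<open>O(8\<^sup>-\<^sup>n)\<close> of a cell.

  The identity \<open>H = X - I\<close> (\<open>AE_H_reflected\<close>) is derived from the defining limit. Reversing time at \<open>t\<close>
  turns the approximation of \<open>H\<^sub>t\<close> into the time that a reflected walk spends near \<open>0\<close>, divided by \<open>\<epsilon>\<close>, and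
  \<open>X\<^sub>t - I\<^sub>t\<close> into the running maximum of the reversed walk. These two agree asymptotically: applying a \<open>C\<^sup>2\<close>
  function with trapezoidal second derivative to the reflected walk gives a discrete Tanaka formula,
  whose martingale part is small in \<open>L\<^sup>2\<close> (\<open>occupation_vs_maximum\<close>).

  The conclusion is carried over to the excursion measure through a property \<open>good_path\<close> of a path, stated
  with countable quantifiers only so that it is measurable. Almost surely all excursions of \<open>H\<close>
  under \<open>P\<close> are good. If the bad paths had positive \<open>N\<close>-measure, their product with the infinite local
  time axis would have infinite intensity, and the Poisson point measure would charge it
  (\<open>AE_good_path\<close>). A good path satisfies the asserted bounds by a deterministic argument
  (\<open>ball_mass_limits\<close>).
\<close>

section \<open>The Gaussian law and its one-sided Laplace transform\<close>

definition gauss :: "real \<Rightarrow> real measure" where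
  "gauss \<delta> = density lborel (\<lambda>x. ennreal (normal_density 0 (sqrt (2 * \<delta>)) x))"

lemma sets_gauss [simp, measurable_cong]: "sets (gauss \<delta>) = sets borel"
  by (simp add: gauss_def)

lemma space_gauss [simp]: "space (gauss \<delta>) = UNIV"
  by (simp add: gauss_def)

lemma prob_space_gauss: "0 < \<delta> \<Longrightarrow> prob_space (gauss \<delta>)"
  unfolding gauss_def by (rule prob_space_normal_density) simp

lemma integral_gauss:
  fixes f :: "real \<Rightarrow> real"
  assumes [measurable]: "f \<in> borel_measurable borel"
  shows "(\<integral>x. f x \<partial>gauss \<delta>) = (\<integral>x. normal_density 0 (sqrt (2 * \<delta>)) x * f x \<partial>lborel)"
  unfolding gauss_def by (subst integral_density) auto

lemma integrable_gauss:
  fixes f :: "real \<Rightarrow> real"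
  assumes [measurable]: "f \<in> borel_measurable borel"
  shows "integrable (gauss \<delta>) f \<longleftrightarrow> integrable lborel (\<lambda>x. normal_density 0 (sqrt (2 * \<delta>)) x * f x)"
  unfolding gauss_def by (subst integrable_density) auto

lemma gauss_moments:
  assumes "0 < \<delta>"
  shows "integrable (gauss \<delta>) (\<lambda>x. x ^ k)"
    and "(\<integral>x. x \<partial>gauss \<delta>) = 0"
    and "(\<integral>x. x\<^sup>2 \<partial>gauss \<delta>) = 2 * \<delta>"
    and "(\<integral>x. x ^ 4 \<partial>gauss \<delta>) = 12 * \<delta>\<^sup>2"
proof -
  let ?s = "sqrt (2 * \<delta>)"
  have s: "0 < ?s" using assms by simp
  have s2: "?s ^ 2 = 2 * \<delta>" using assms by simp
  have s4: "?s ^ 4 = 4 * \<delta>\<^sup>2"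
  proof -
    have "?s ^ 4 = (?s ^ 2) ^ 2" by (simp flip: power_mult)
    then show ?thesis unfolding s2 by (simp add: power2_eq_square)
  qed
  show "integrable (gauss \<delta>) (\<lambda>x. x ^ k)"
    using integrable_normal_moment[OF s, of 0 k] by (simp add: integrable_gauss)
  show "(\<integral>x. x \<partial>gauss \<delta>) = 0"
    using integral_normal_moment_odd[OF s, of 0 0] by (simp add: integral_gauss)
  show "(\<integral>x. x\<^sup>2 \<partial>gauss \<delta>) = 2 * \<delta>"
    using integral_normal_moment_even[OF s, of 0 1] s2 by (simp add: integral_gauss power2_eq_square)
  show "(\<integral>x. x ^ 4 \<partial>gauss \<delta>) = 12 * \<delta>\<^sup>2"
  proof -
    have "(\<integral>x. x ^ 4 \<partial>gauss \<delta>) = fact 4 / ((2 / (?s)\<^sup>2) ^ 2 * fact 2)"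
      using integral_normal_moment_even[OF s, of 0 2] by (simp add: integral_gauss)
    also have "\<dots> = 12 * \<delta>\<^sup>2"
      unfolding s2 using assms by (simp add: field_simps power2_eq_square fact_numeral)
    finally show ?thesis .
  qed
qed

lemma gauss_exp:
  assumes "0 < \<delta>"
  shows "integrable (gauss \<delta>) (\<lambda>x. exp (c * x))"
    and "(\<integral>x. exp (c * x) \<partial>gauss \<delta>) = exp (c\<^sup>2 * \<delta>)"
proof -
  let ?s = "sqrt (2 * \<delta>)"
  have s: "0 < ?s" using assms by simp
  have s2: "?s ^ 2 = 2 * \<delta>" using assms by simp
  have eq: "normal_density 0 ?s x * exp (c * x) = exp (c\<^sup>2 * \<delta>) * normal_density (2 * c * \<delta>) ?s x" for x
  proof -
    have "- (x\<^sup>2) / (2 * (2 * \<delta>)) + c * x = c\<^sup>2 * \<delta> + - (x - 2 * c * \<delta>)\<^sup>2 / (2 * (2 * \<delta>))"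
      using assms by (simp add: field_simps power2_eq_square)
    then have "exp (- (x\<^sup>2) / (2 * (2 * \<delta>))) * exp (c * x)
        = exp (c\<^sup>2 * \<delta>) * exp (- (x - 2 * c * \<delta>)\<^sup>2 / (2 * (2 * \<delta>)))"
      by (simp flip: exp_add)
    then show ?thesis unfolding normal_density_def s2 by (simp add: field_simps)
  qed
  show "integrable (gauss \<delta>) (\<lambda>x. exp (c * x))"
    by (simp add: integrable_gauss eq integrable_normal_density[OF s])
  show "(\<integral>x. exp (c * x) \<partial>gauss \<delta>) = exp (c\<^sup>2 * \<delta>)"
    by (simp add: integral_gauss eq integral_normal_density[OF s])
qed

lemma distr_std_normal_gauss:
  assumes "0 < \<delta>"
  shows "distr std_normal_distribution borel (\<lambda>x. sqrt (2 * \<delta>) * x) = gauss \<delta>"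
proof -
  interpret real_distribution std_normal_distribution by (rule real_dist_normal_dist)
  have "distributed std_normal_distribution lborel (\<lambda>x. x) (\<lambda>x. ennreal (normal_density 0 1 x))"
    unfolding distributed_def by (auto simp: distr_id2)
  from normal_density_affine[OF this, of "sqrt (2 * \<delta>)" 0] assms
  have "distributed std_normal_distribution lborel (\<lambda>x. sqrt (2 * \<delta>) * x) (\<lambda>x. ennreal (normal_density 0 (sqrt (2 * \<delta>)) x))"
    by simp
  then have "distr std_normal_distribution lborel (\<lambda>x. sqrt (2 * \<delta>) * x) = gauss \<delta>"
    unfolding distributed_def gauss_def by simp
  moreover have "distr std_normal_distribution lborel (\<lambda>x. sqrt (2 * \<delta>) * x) = distr std_normal_distribution borel (\<lambda>x. sqrt (2 * \<delta>) * x)"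
    by (rule distr_cong) auto
  ultimately show ?thesis by simp
qed

lemma char_gauss:
  assumes "0 < \<delta>"
  shows "char (gauss \<delta>) \<theta> = complex_of_real (exp (- \<delta> * \<theta>\<^sup>2))"
proof -
  have "char (gauss \<delta>) \<theta> = char std_normal_distribution (sqrt (2 * \<delta>) * \<theta>)"
    unfolding char_def distr_std_normal_gauss[OF assms, symmetric]
    by (subst integral_distr) (auto simp: mult_ac)
  also have "\<dots> = complex_of_real (exp (- \<delta> * \<theta>\<^sup>2))"
    using assms by (simp add: char_std_normal_distribution power_mult_distrib)
  finally show ?thesis .
qed

lemma gauss_cos_shift:
  assumes "0 < \<delta>"
  shows "(\<integral>x. cos (\<theta> * (y + x)) \<partial>gauss \<delta>) = cos (\<theta> * y) * exp (- \<delta> * \<theta>\<^sup>2)"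
proof -
  interpret prob_space "gauss \<delta>" by (rule prob_space_gauss[OF assms])
  have i: "integrable (gauss \<delta>) (\<lambda>x. cos (\<theta> * x))" "integrable (gauss \<delta>) (\<lambda>x. sin (\<theta> * x))"
    by (rule integrable_const_bound[where B=1]; simp)+
  have ii: "integrable (gauss \<delta>) (\<lambda>x. iexp (\<theta> * x))"
    by (rule integrable_const_bound[where B=1]; simp)
  have c: "char (gauss \<delta>) \<theta> = exp (- \<delta> * \<theta>\<^sup>2)" using char_gauss[OF assms] by simp
  have "(\<integral>x. cos (\<theta> * x) \<partial>gauss \<delta>) = exp (- \<delta> * \<theta>\<^sup>2)"
  proof -
    have "(\<integral>x. Re (iexp (\<theta> * x)) \<partial>gauss \<delta>) = Re (char (gauss \<delta>) \<theta>)"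
      unfolding char_def by (rule integral_Re) (use ii in auto)
    then show ?thesis unfolding c by (simp add: Re_exp)
  qed
  moreover have "(\<integral>x. sin (\<theta> * x) \<partial>gauss \<delta>) = 0"
  proof -
    have "(\<integral>x. Im (iexp (\<theta> * x)) \<partial>gauss \<delta>) = Im (char (gauss \<delta>) \<theta>)"
      unfolding char_def by (rule integral_Im) (use ii in auto)
    then show ?thesis unfolding c by (simp add: Im_exp)
  qed
  moreover have "(\<integral>x. cos (\<theta> * (y + x)) \<partial>gauss \<delta>)
     = cos (\<theta> * y) * (\<integral>x. cos (\<theta> * x) \<partial>gauss \<delta>) - sin (\<theta> * y) * (\<integral>x. sin (\<theta> * x) \<partial>gauss \<delta>)"
    using i by (simp add: distrib_left cos_add)
  ultimately show ?thesis by simp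
qed

lemma gauss_uminus:
  assumes "0 < \<delta>"
  shows "distr (gauss \<delta>) borel uminus = gauss \<delta>"
proof (rule Levy_uniqueness)
  interpret prob_space "gauss \<delta>" by (rule prob_space_gauss[OF assms])
  show "real_distribution (gauss \<delta>)" by standard auto
  show "real_distribution (distr (gauss \<delta>) borel uminus)"
    by (rule real_distribution_distr) auto
  show "char (distr (gauss \<delta>) borel uminus) = char (gauss \<delta>)"
  proof
    fix \<theta>
    have "char (distr (gauss \<delta>) borel uminus) \<theta> = char (gauss \<delta>) (- \<theta>)"
      unfolding char_def by (subst integral_distr) auto
    then show "char (distr (gauss \<delta>) borel uminus) \<theta> = char (gauss \<delta>) \<theta>"
      by (simp add: char_gauss[OF assms])
  qed
qed

text \<open>Differentiation under the integral sign. For \<open>Re z = a > 0\<close> the difference quotients are dominated by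
  exponentials with the rates \<open>a - 2\<eta>\<close> and \<open>a + 2\<eta>\<close>, \<open>\<eta> = a / 4\<close>; both rates are positive, so the
  dominating function is integrable.\<close>

lemma holomorphic_laplace:
  assumes D: "prob_space D" and [measurable_cong, simp]: "sets D = sets borel"
    and int: "\<And>c. 0 \<le> c \<Longrightarrow> integrable D (\<lambda>x::real. exp (- c * x))"
  shows "(\<lambda>z. \<integral>x. exp (- z * complex_of_real x) \<partial>D) holomorphic_on {z. 0 < Re z}"
proof -
  interpret prob_space D by (rule D)
  let ?f = "\<lambda>z. \<integral>x. exp (- z * complex_of_real x) \<partial>D"
  have intc: "integrable D (\<lambda>x. exp (- z * complex_of_real x))" if "0 \<le> Re z" for z
    by (rule Bochner_Integration.integrable_bound[OF int[OF that]]) (auto simp: norm_exp_eq_Re)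
  have "?f field_differentiable at z" if z: "0 < Re z" for z
  proof -
    define a where "a = Re z"
    define \<eta> where "\<eta> = a / 4"
    have a: "0 < a" and \<eta>: "0 < \<eta>" using z by (auto simp: a_def \<eta>_def)
    let ?d = "\<integral>x. - complex_of_real x * exp (- z * complex_of_real x) \<partial>D"
    have "(\<lambda>h. (?f (z + h) - ?f z) / h) \<midarrow>0\<rightarrow> ?d"
    proof (subst LIMSEQ_SEQ_conv[symmetric], intro allI impI)
      fix S :: "nat \<Rightarrow> complex" assume S: "(\<forall>n. S n \<noteq> 0) \<and> S \<longlonglongrightarrow> 0"
      then have "\<forall>\<^sub>F n in sequentially. norm (S n) < \<eta>"
        using \<eta> by (auto simp: tendsto_iff)
      then obtain N where N: "\<And>n. n \<ge> N \<Longrightarrow> norm (S n) < \<eta>" unfolding eventually_sequentially by blast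
      define T where "T = (\<lambda>n. S (n + N))"
      have T: "T n \<noteq> 0" "norm (T n) < \<eta>" for n using S N by (auto simp: T_def)
      have T0: "T \<longlonglongrightarrow> 0" unfolding T_def using S by (intro LIMSEQ_ignore_initial_segment) auto
      have "(\<lambda>n. \<integral>x. (exp (- (z + T n) * complex_of_real x) - exp (- z * complex_of_real x)) / T n \<partial>D) \<longlonglongrightarrow> ?d"
      proof (rule integral_dominated_convergence[where w = "\<lambda>x. (1 / \<eta>) * (exp (- (a - 2 * \<eta>) * x) + exp (- (a + 2 * \<eta>) * x))"])
        show "integrable D (\<lambda>x. (1 / \<eta>) * (exp (- (a - 2 * \<eta>) * x) + exp (- (a + 2 * \<eta>) * x)))"
          using int[of "a - 2 * \<eta>"] int[of "a + 2 * \<eta>"] a by (intro integrable_mult_right Bochner_Integration.integrable_add) (auto simp: \<eta>_def)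
        show "AE x in D. (\<lambda>n. (exp (- (z + T n) * complex_of_real x) - exp (- z * complex_of_real x)) / T n)
          \<longlonglongrightarrow> - complex_of_real x * exp (- z * complex_of_real x)"
        proof (rule AE_I2)
          fix x
          have "((\<lambda>w. exp (- w * complex_of_real x)) has_field_derivative - complex_of_real x * exp (- z * complex_of_real x)) (at z)"
            by (auto intro!: derivative_eq_intros)
          then have "(\<lambda>h. (exp (- (z + h) * complex_of_real x) - exp (- z * complex_of_real x)) / h) \<midarrow>0\<rightarrow> - complex_of_real x * exp (- z * complex_of_real x)"
            unfolding DERIV_def .
          then show "(\<lambda>n. (exp (- (z + T n) * complex_of_real x) - exp (- z * complex_of_real x)) / T n)
            \<longlonglongrightarrow> - complex_of_real x * exp (- z * complex_of_real x)"
            using T T0 unfolding LIMSEQ_SEQ_conv[symmetric] by blast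
        qed
        show "AE x in D. norm ((exp (- (z + T n) * complex_of_real x) - exp (- z * complex_of_real x)) / T n)
           \<le> (1 / \<eta>) * (exp (- (a - 2 * \<eta>) * x) + exp (- (a + 2 * \<eta>) * x))" for n
        proof (rule AE_I2)
          fix x :: real
          have e: "exp (- (z + T n) * complex_of_real x) - exp (- z * complex_of_real x)
             = exp (- z * complex_of_real x) * (exp (- T n * complex_of_real x) - 1)"
            by (simp add: distrib_right exp_add[symmetric] algebra_simps)
          have n1: "norm (exp (- z * complex_of_real x)) = exp (- a * x)"
            by (simp add: norm_exp_eq_Re a_def)
          have Tx: "norm (T n) * \<bar>x\<bar> \<le> \<eta> * \<bar>x\<bar>"
            using T(2)[of n] by (intro mult_right_mono) auto
          have "norm (exp (- T n * complex_of_real x) - 1) \<le> exp \<bar>Re (- T n * complex_of_real x)\<bar> * norm (- T n * complex_of_real x)"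
            using Taylor_exp[of "- T n * complex_of_real x" 0] by simp
          also have "\<dots> \<le> exp (\<eta> * \<bar>x\<bar>) * (norm (T n) * \<bar>x\<bar>)"
          proof (rule mult_mono)
            show "exp \<bar>Re (- T n * complex_of_real x)\<bar> \<le> exp (\<eta> * \<bar>x\<bar>)"
              using abs_Re_le_cmod[of "- T n * complex_of_real x"] Tx by (simp add: norm_mult)
          qed (auto simp: norm_mult)
          finally have "norm ((exp (- T n * complex_of_real x) - 1) / T n) \<le> exp (\<eta> * \<bar>x\<bar>) * \<bar>x\<bar>"
            using T(1)[of n] by (simp add: norm_divide field_simps)
          also have "\<dots> \<le> exp (\<eta> * \<bar>x\<bar>) * ((1 / \<eta>) * exp (\<eta> * \<bar>x\<bar>))"
          proof (rule mult_left_mono)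
            have "\<eta> * \<bar>x\<bar> \<le> exp (\<eta> * \<bar>x\<bar>)"
              using exp_ge_add_one_self[of "\<eta> * \<bar>x\<bar>"] by linarith
            then show "\<bar>x\<bar> \<le> (1 / \<eta>) * exp (\<eta> * \<bar>x\<bar>)" using \<eta> by (simp add: field_simps)
          qed simp
          also have "\<dots> = (1 / \<eta>) * exp (2 * \<eta> * \<bar>x\<bar>)"
            by (simp add: exp_add[symmetric])
          also have "\<dots> \<le> (1 / \<eta>) * (exp (2 * \<eta> * x) + exp (- (2 * \<eta> * x)))"
            using \<eta> by (intro mult_left_mono) (auto simp: abs_if)
          finally have b: "norm ((exp (- T n * complex_of_real x) - 1) / T n) \<le> (1 / \<eta>) * (exp (2 * \<eta> * x) + exp (- (2 * \<eta> * x)))" .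
          have "norm ((exp (- (z + T n) * complex_of_real x) - exp (- z * complex_of_real x)) / T n)
             = exp (- a * x) * norm ((exp (- T n * complex_of_real x) - 1) / T n)"
            unfolding e times_divide_eq_right[symmetric] norm_mult n1 ..
          also have "\<dots> \<le> exp (- a * x) * ((1 / \<eta>) * (exp (2 * \<eta> * x) + exp (- (2 * \<eta> * x))))"
            by (intro mult_left_mono b) auto
          also have "\<dots> = (1 / \<eta>) * (exp (- (a - 2 * \<eta>) * x) + exp (- (a + 2 * \<eta>) * x))"
            by (simp add: distrib_left exp_add[symmetric] algebra_simps)
          finally show "norm ((exp (- (z + T n) * complex_of_real x) - exp (- z * complex_of_real x)) / T n)
             \<le> (1 / \<eta>) * (exp (- (a - 2 * \<eta>) * x) + exp (- (a + 2 * \<eta>) * x))" .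
        qed
      qed auto
      moreover have "(\<integral>x. (exp (- (z + T n) * complex_of_real x) - exp (- z * complex_of_real x)) / T n \<partial>D) = (?f (z + T n) - ?f z) / T n" for n
      proof -
        have "norm (T n) < a" using T(2)[of n] a by (simp add: \<eta>_def)
        then have "0 \<le> Re (z + T n)" using abs_Re_le_cmod[of "T n"] by (simp add: a_def)
        then show ?thesis using intc[of "z + T n"] intc[of z] z by simp
      qed
      ultimately have "(\<lambda>n. (?f (z + T n) - ?f z) / T n) \<longlonglongrightarrow> ?d" by (simp only:)
      then have "(\<lambda>n. (?f (z + S (n + N)) - ?f z) / S (n + N)) \<longlonglongrightarrow> ?d" unfolding T_def .
      then show "(\<lambda>n. (?f (z + S n) - ?f z) / S n) \<longlonglongrightarrow> ?d" by (rule LIMSEQ_offset)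
    qed
    then show ?thesis unfolding field_differentiable_def DERIV_def by blast
  qed
  then show ?thesis by (auto simp: holomorphic_on_def intro: field_differentiable_at_within)
qed

text \<open>The Laplace transform is known on the half-line \<open>c \<ge> 0\<close> only. Analytic continuation extends the formula
  to the open right half-plane, and dominated convergence extends it to the imaginary axis, where the
  transform is the characteristic function.\<close>

lemma laplace_imp_gauss:
  assumes D: "prob_space D" and sets_D [measurable_cong, simp]: "sets D = sets borel"
    and t: "0 < t"
    and L: "\<And>c. 0 \<le> c \<Longrightarrow> (\<integral>x. exp (- c * x) \<partial>D) = exp (t * c\<^sup>2)"
  shows "D = gauss t"
proof (rule Levy_uniqueness)
  interpret prob_space D by (rule D)
  have space_D [simp]: "space D = UNIV" using sets_eq_imp_space_eq[OF sets_D] by simp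
  show "real_distribution D" by standard auto
  interpret G: prob_space "gauss t" by (rule prob_space_gauss[OF t])
  show "real_distribution (gauss t)" by standard auto
  have int: "integrable D (\<lambda>x::real. exp (- c * x))" if "0 \<le> c" for c
    using not_integrable_integral_eq[of D "\<lambda>x. exp (- c * x)"] L[OF that] by fastforce
  let ?f = "\<lambda>z. \<integral>x. exp (- z * complex_of_real x) \<partial>D"
  let ?U = "{complex_of_real c | c. 0 < c}"
  have eq: "?f z = exp (of_real t * z\<^sup>2)" if z: "0 < Re z" for z
  proof -
    have "?f z - exp (of_real t * z\<^sup>2) = 0"
    proof (rule analytic_continuation[where f = "\<lambda>z. ?f z - exp (of_real t * z\<^sup>2)" and w = z and S = "{z. 0 < Re z}" and U = ?U and \<xi> = 1])
      show "(\<lambda>z. ?f z - exp (of_real t * z\<^sup>2)) holomorphic_on {z. 0 < Re z}"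
        by (intro holomorphic_intros holomorphic_laplace D int) auto
      show "open {z. 0 < Re z}" by (rule open_halfspace_Re_gt)
      show "connected {z. 0 < Re z}" by (intro convex_connected convex_halfspace_Re_gt)
      show "1 islimpt ?U"
        unfolding islimpt_approachable
      proof (intro allI impI)
        fix e :: real assume "0 < e"
        then show "\<exists>x'\<in>?U. x' \<noteq> 1 \<and> dist x' 1 < e"
          by (intro bexI[of _ "complex_of_real (1 + e / 2)"]) (auto simp: dist_norm intro!: exI[of _ "1 + e / 2"])
      qed
      show "?f w - exp (of_real t * w\<^sup>2) = 0" if "w \<in> ?U" for w
      proof -
      obtain c where c: "w = complex_of_real c" "0 < c" using \<open>w \<in> ?U\<close> by blast
      have "?f w = (\<integral>x. complex_of_real (exp (- c * x)) \<partial>D)"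
        unfolding c by (simp flip: exp_of_real)
      also have "\<dots> = of_real (exp (t * c\<^sup>2))"
        using L[of c] c by (subst integral_complex_of_real) auto
      finally show ?thesis unfolding c by (simp flip: exp_of_real)
      qed
    qed (use z in auto)
    then show ?thesis by simp
  qed
  show "char D = char (gauss t)"
  proof
    fix \<theta>
    let ?z = "\<lambda>n. Complex (1 / real (Suc n)) (- \<theta>)"
    have z: "?z \<longlonglongrightarrow> Complex 0 (- \<theta>)"
      using LIMSEQ_inverse_real_of_nat by (intro tendsto_Complex) (auto simp: inverse_eq_divide)
    have "(\<lambda>n. ?f (?z n)) \<longlonglongrightarrow> ?f (Complex 0 (- \<theta>))"
    proof (rule integral_dominated_convergence[where w = "\<lambda>x. 1 + exp (- 1 * x)"])
      show "integrable D (\<lambda>x. 1 + exp (- 1 * x))" using int[of 1] by auto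
      show "AE x in D. (\<lambda>n. exp (- ?z n * complex_of_real x)) \<longlonglongrightarrow> exp (- Complex 0 (- \<theta>) * complex_of_real x)"
        by (intro AE_I2 tendsto_intros z)
      show "AE x in D. norm (exp (- ?z n * complex_of_real x)) \<le> 1 + exp (- 1 * x)" for n
      proof (rule AE_I2)
        fix x :: real
        have "norm (exp (- ?z n * complex_of_real x)) = exp (- (x / real (Suc n)))"
          by (simp add: norm_exp_eq_Re)
        also have "\<dots> \<le> 1 + exp (- 1 * x)"
        proof (cases "0 \<le> x")
          case True
          then have "exp (- (x / real (Suc n))) \<le> 1" by simp
          then show ?thesis by (simp add: add_increasing2)
        next
          case False
          then have "- (x / real (Suc n)) \<le> - x" by (simp add: field_simps mult_le_0_iff)
          then have "exp (- (x / real (Suc n))) \<le> exp (- x)" by (simp only: exp_le_cancel_iff)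
          then show ?thesis by (simp only: mult_minus_left mult_1)
        qed
        finally show "norm (exp (- ?z n * complex_of_real x)) \<le> 1 + exp (- 1 * x)" .
      qed
    qed auto
    moreover have "?f (?z n) = exp (of_real t * (?z n)\<^sup>2)" for n
      by (rule eq) simp
    moreover have "(\<lambda>n. exp (of_real t * (?z n)\<^sup>2)) \<longlonglongrightarrow> exp (of_real t * (Complex 0 (- \<theta>))\<^sup>2)"
      by (intro tendsto_intros z)
    ultimately have "?f (Complex 0 (- \<theta>)) = exp (of_real t * (Complex 0 (- \<theta>))\<^sup>2)"
      using LIMSEQ_unique by auto
    moreover have "Complex 0 (- \<theta>) = - (\<i> * of_real \<theta>)" by (simp add: complex_eq_iff)
    ultimately have "char D \<theta> = exp (of_real t * (- (\<i> * of_real \<theta>))\<^sup>2)"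
      unfolding char_def by (simp add: mult_ac)
    also have "\<dots> = complex_of_real (exp (- t * \<theta>\<^sup>2))"
      by (simp add: power_mult_distrib flip: exp_of_real)
    finally show "char D \<theta> = char (gauss t) \<theta>" by (simp add: char_gauss[OF t])
  qed
qed

section \<open>Random walks with Gaussian steps\<close>

lemma pred_le_intros:
  fixes j :: nat
  assumes "\<And>i. i \<le> j \<Longrightarrow> Measurable.pred N (P i)"
  shows "Measurable.pred N (\<lambda>\<omega>. \<exists>i\<le>j. P i \<omega>)" "Measurable.pred N (\<lambda>\<omega>. \<forall>i\<le>j. P i \<omega>)"
proof -
  have "Measurable.pred N (\<lambda>\<omega>. \<exists>i\<in>{..j}. P i \<omega>)"
    by (rule pred_intros_finite(4)) (use assms in auto)
  moreover have "Measurable.pred N (\<lambda>\<omega>. \<forall>i\<in>{..j}. P i \<omega>)"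
    by (rule pred_intros_finite(3)) (use assms in auto)
  ultimately
  show "Measurable.pred N (\<lambda>\<omega>. \<exists>i\<le>j. P i \<omega>)" "Measurable.pred N (\<lambda>\<omega>. \<forall>i\<le>j. P i \<omega>)"
    by (simp_all only: Bex_def Ball_def atMost_iff)
qed

locale gaussian_walk = prob_space M for M :: "'a measure" +
  fixes \<xi> :: "nat \<Rightarrow> 'a \<Rightarrow> real" and n :: nat and \<delta> :: real
  assumes delta_pos: "0 < \<delta>"
    and indep: "indep_vars (\<lambda>_. borel) \<xi> {..<n}"
    and law: "\<And>i. i < n \<Longrightarrow> distr M borel (\<xi> i) = gauss \<delta>"
begin

text \<open>The sigma-algebra of the first \<open>k\<close> steps is a vimage algebra rather than a coarser version of \<open>M\<close>, because
  then the steps generate it by construction and the independence of the next step is immediate.\<close>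

definition past :: "nat \<Rightarrow> 'a measure" where
  "past k = vimage_algebra (space M) (\<lambda>\<omega>. \<lambda>i\<in>{..<k}. \<xi> i \<omega>) (PiM {..<k} (\<lambda>_. borel))"

definition S :: "nat \<Rightarrow> 'a \<Rightarrow> real" where
  "S k \<omega> = (\<Sum>i<k. \<xi> i \<omega>)"

lemma S_0 [simp]: "S 0 \<omega> = 0" by (simp add: S_def)
lemma S_Suc: "S (Suc k) \<omega> = S k \<omega> + \<xi> k \<omega>" by (simp add: S_def)

sublocale gauss: prob_space "gauss \<delta>" by (rule prob_space_gauss[OF delta_pos])

lemma xi_rv: "i < n \<Longrightarrow> \<xi> i \<in> borel_measurable M"
  using indep by (simp add: indep_vars_def)

lemma space_past [simp]: "space (past k) = space M"
  by (simp add: past_def)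

lemma xi_past [measurable]:
  assumes "i < k" shows "\<xi> i \<in> borel_measurable (past k)"
proof -
  have "(\<lambda>\<omega>. \<lambda>i\<in>{..<k}. \<xi> i \<omega>) \<in> past k \<rightarrow>\<^sub>M PiM {..<k} (\<lambda>_. borel)"
    unfolding past_def by (rule measurable_vimage_algebra1) (auto simp: space_PiM)
  then have "(\<lambda>\<omega>. (\<lambda>i\<in>{..<k}. \<xi> i \<omega>) i) \<in> borel_measurable (past k)"
    by (rule measurable_compose) (use assms in \<open>auto intro: measurable_component_singleton\<close>)
  then show ?thesis using assms by simp
qed

lemma S_past [measurable]: "j \<le> k \<Longrightarrow> S j \<in> borel_measurable (past k)"
  unfolding S_def by (intro borel_measurable_sum xi_past) auto

lemma sets_past_le:
  assumes "space N = space M" "\<And>i. i < k \<Longrightarrow> \<xi> i \<in> borel_measurable N"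
  shows "sets (past k) \<subseteq> sets N"
  unfolding past_def
proof (rule sets_image_in_sets)
  show "(\<lambda>\<omega>. \<lambda>i\<in>{..<k}. \<xi> i \<omega>) \<in> N \<rightarrow>\<^sub>M PiM {..<k} (\<lambda>_. borel)"
    by (rule measurable_restrict) (use assms in auto)
qed (use assms in auto)

lemma measurable_past:
  assumes "k \<le> n" "U \<in> past k \<rightarrow>\<^sub>M N" shows "U \<in> M \<rightarrow>\<^sub>M N"
proof (rule measurableI)
  show "U x \<in> space N" if "x \<in> space M" for x using measurable_space[OF assms(2)] that by simp
  have "sets (past k) \<subseteq> sets M" by (rule sets_past_le) (use assms xi_rv in auto)
  then show "U -` A \<inter> space M \<in> sets M" if "A \<in> sets N" for A
    using measurable_sets[OF assms(2) that] by auto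
qed

lemma S_rv: "k \<le> n \<Longrightarrow> S k \<in> borel_measurable M"
  by (rule measurable_past[OF _ S_past]) auto

lemma distr_past:
  assumes k: "k < n"
  shows "distr M (past k \<Otimes>\<^sub>M borel) (\<lambda>\<omega>. (\<omega>, \<xi> k \<omega>)) = distr M (past k) (\<lambda>\<omega>. \<omega>) \<Otimes>\<^sub>M gauss \<delta>"
proof (rule pair_measure_eqI[symmetric])
  let ?P = "PiM {..<k} (\<lambda>_. borel :: real measure)" and ?Q = "PiM {k} (\<lambda>_. borel :: real measure)"
  let ?X = "\<lambda>\<omega>. \<lambda>i\<in>{..<k}. \<xi> i \<omega>" and ?Y = "\<lambda>\<omega>. \<lambda>i\<in>{k}. \<xi> i \<omega>"
  have iv: "indep_var ?P ?X ?Q ?Y"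
    by (rule indep_var_restrict[OF indep]) (use k in auto)
  have id: "(\<lambda>\<omega>. \<omega>) \<in> M \<rightarrow>\<^sub>M past k"
    by (rule measurable_past[of k]) (use k in auto)
  have m: "(\<lambda>\<omega>. (\<omega>, \<xi> k \<omega>)) \<in> M \<rightarrow>\<^sub>M past k \<Otimes>\<^sub>M borel"
    by (rule measurable_Pair[OF id xi_rv[OF k]])
  interpret P: prob_space "distr M (past k) (\<lambda>\<omega>. \<omega>)" by (rule prob_space_distr[OF id])
  show "sigma_finite_measure (distr M (past k) (\<lambda>\<omega>. \<omega>))" "sigma_finite_measure (gauss \<delta>)"
    by unfold_locales
  show "sets (distr M (past k) (\<lambda>\<omega>. \<omega>) \<Otimes>\<^sub>M gauss \<delta>) = sets (distr M (past k \<Otimes>\<^sub>M borel) (\<lambda>\<omega>. (\<omega>, \<xi> k \<omega>)))"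
    by (simp cong: sets_pair_measure_cong)
  fix A B assume A': "A \<in> sets (distr M (past k) (\<lambda>\<omega>. \<omega>))" and B': "B \<in> sets (gauss \<delta>)"
  have X: "?X \<in> space M \<rightarrow> space ?P" by (auto simp: space_PiM)
  obtain A0 where A: "A = ?X -` A0 \<inter> space M" and A0: "A0 \<in> sets ?P"
    using A' unfolding sets_distr past_def sets_vimage_algebra2[OF X] by blast
  define B0 where "B0 = {f \<in> space ?Q. f k \<in> B}"
  have B: "B \<in> sets borel" using B' by simp
  have B0: "B0 \<in> sets ?Q" unfolding B0_def using B by measurable
  have YB: "?Y -` B0 \<inter> space M = \<xi> k -` B \<inter> space M" by (auto simp: B0_def space_PiM)
  have sA: "A \<subseteq> space M" using A by auto
  have "emeasure (distr M (past k \<Otimes>\<^sub>M borel) (\<lambda>\<omega>. (\<omega>, \<xi> k \<omega>))) (A \<times> B) = emeasure M ((\<lambda>\<omega>. (\<omega>, \<xi> k \<omega>)) -` (A \<times> B) \<inter> space M)"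
    using B A' by (subst emeasure_distr[OF m]) auto
  also have "(\<lambda>\<omega>. (\<omega>, \<xi> k \<omega>)) -` (A \<times> B) \<inter> space M = (\<lambda>\<omega>. (?X \<omega>, ?Y \<omega>)) -` (A0 \<times> B0) \<inter> space M"
    using A YB by auto
  also have "emeasure M \<dots> = ennreal (prob (?X -` A0 \<inter> space M) * prob (?Y -` B0 \<inter> space M))"
    unfolding emeasure_eq_measure using indep_varD[OF iv A0 B0] by simp
  also have "prob (?X -` A0 \<inter> space M) = measure (distr M (past k) (\<lambda>\<omega>. \<omega>)) A"
    using A sA A' by (subst measure_distr[OF id]) (auto intro: arg_cong[where f = prob])
  also have "prob (?Y -` B0 \<inter> space M) = measure (gauss \<delta>) B"
    unfolding YB law[OF k, symmetric] using B by (subst measure_distr[OF xi_rv[OF k]]) auto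
  finally show "emeasure (distr M (past k) (\<lambda>\<omega>. \<omega>)) A * emeasure (gauss \<delta>) B = emeasure (distr M (past k \<Otimes>\<^sub>M borel) (\<lambda>\<omega>. (\<omega>, \<xi> k \<omega>))) (A \<times> B)"
    by (simp add: P.emeasure_eq_measure gauss.emeasure_eq_measure ennreal_mult)
qed

text \<open>The Markov property in the only form used below: a step is integrated out against its law, given the
  past. Nonnegative integrals spare all integrability conditions.\<close>

lemma nn_integral_step:
  assumes k: "k < n" and h: "(\<lambda>(\<omega>, x). h \<omega> x) \<in> borel_measurable (past k \<Otimes>\<^sub>M borel)"
  shows "(\<integral>\<^sup>+\<omega>. h \<omega> (\<xi> k \<omega>) \<partial>M) = (\<integral>\<^sup>+\<omega>. \<integral>\<^sup>+x. h \<omega> x \<partial>gauss \<delta> \<partial>M)"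
proof -
  have id: "(\<lambda>\<omega>. \<omega>) \<in> M \<rightarrow>\<^sub>M past k"
    by (rule measurable_past[of k]) (use k in auto)
  have m: "(\<lambda>\<omega>. (\<omega>, \<xi> k \<omega>)) \<in> M \<rightarrow>\<^sub>M past k \<Otimes>\<^sub>M borel"
    by (rule measurable_Pair[OF id xi_rv[OF k]])
  have h': "(\<lambda>(\<omega>, x). h \<omega> x) \<in> borel_measurable (distr M (past k) (\<lambda>\<omega>. \<omega>) \<Otimes>\<^sub>M gauss \<delta>)"
    using h by (simp cong: measurable_cong_sets add: sets_pair_measure_cong[OF sets_distr sets_gauss])
  have "(\<integral>\<^sup>+\<omega>. h \<omega> (\<xi> k \<omega>) \<partial>M) = (\<integral>\<^sup>+p. (case p of (\<omega>, x) \<Rightarrow> h \<omega> x) \<partial>distr M (past k \<Otimes>\<^sub>M borel) (\<lambda>\<omega>. (\<omega>, \<xi> k \<omega>)))"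
    using h by (subst nn_integral_distr[OF m]) auto
  also have "\<dots> = (\<integral>\<^sup>+\<omega>. \<integral>\<^sup>+x. h \<omega> x \<partial>gauss \<delta> \<partial>distr M (past k) (\<lambda>\<omega>. \<omega>))"
    unfolding distr_past[OF k] by (subst gauss.nn_integral_fst[OF h', symmetric]) simp
  also have "\<dots> = (\<integral>\<^sup>+\<omega>. \<integral>\<^sup>+x. h \<omega> x \<partial>gauss \<delta> \<partial>M)"
  proof (rule nn_integral_distr[OF id])
    have "(\<lambda>\<omega>. \<integral>\<^sup>+x. (case (\<omega>, x) of (\<omega>, x) \<Rightarrow> h \<omega> x) \<partial>gauss \<delta>) \<in> borel_measurable (past k)"
      by (rule gauss.borel_measurable_nn_integral_fst) (use h in \<open>simp cong: measurable_cong_sets add: sets_pair_measure_cong[OF refl sets_gauss]\<close>)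
    then show "(\<lambda>\<omega>. \<integral>\<^sup>+x. h \<omega> x \<partial>gauss \<delta>) \<in> borel_measurable (distr M (past k) (\<lambda>\<omega>. \<omega>))" by simp
  qed
  finally show ?thesis .
qed

lemma uminus_walk: "gaussian_walk M (\<lambda>i \<omega>. - \<xi> i \<omega>) n \<delta>"
proof
  show "0 < \<delta>" by (rule delta_pos)
  show "indep_vars (\<lambda>_. borel) (\<lambda>i \<omega>. - \<xi> i \<omega>) {..<n}"
    by (rule indep_vars_compose2[OF indep]) auto
  show "distr M borel (\<lambda>\<omega>. - \<xi> i \<omega>) = gauss \<delta>" if "i < n" for i
  proof -
    have "distr M borel (\<lambda>\<omega>. - \<xi> i \<omega>) = distr (distr M borel (\<xi> i)) borel uminus"
      by (subst distr_distr) (use xi_rv[OF that] in \<open>auto simp: comp_def\<close>)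
    then show ?thesis by (simp add: law[OF that] gauss_uminus[OF delta_pos])
  qed
qed

text \<open>Exponential Markov inequality for the walk that is frozen when it first reaches \<open>a\<close>: one step
  multiplies the expectation of \<open>exp (c S)\<close> by at most \<open>exp (c\<^sup>2 \<delta>)\<close>, also for the frozen walk.\<close>

lemma maximal_exp:
  assumes k: "k \<le> n" and c: "0 \<le> c"
  shows "prob {\<omega> \<in> space M. \<exists>j\<le>k. a \<le> S j \<omega>} \<le> exp (- c * a + real k * (c\<^sup>2 * \<delta>))"
proof -
  define A where "A = (\<lambda>k \<omega>. \<exists>j\<le>k. a \<le> S j \<omega>)"
  define \<Phi> where "\<Phi> = (\<lambda>k \<omega>. if A k \<omega> then exp (c * a) else exp (c * S k \<omega>))"
  have A_past [measurable]: "Measurable.pred (past k) (A j)" if "j \<le> k" for j k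
    unfolding A_def
  proof (rule pred_le_intros)
    fix i assume "i \<le> j"
    then have [measurable]: "S i \<in> borel_measurable (past k)" using that by simp
    show "Measurable.pred (past k) (\<lambda>\<omega>. a \<le> S i \<omega>)" by measurable
  qed
  have le: "k \<le> n \<Longrightarrow> (\<integral>\<^sup>+\<omega>. \<Phi> k \<omega> \<partial>M) \<le> exp (real k * (c\<^sup>2 * \<delta>))" for k
  proof (induction k)
    case 0
    have "\<Phi> 0 \<omega> \<le> 1" for \<omega> using c by (auto simp: \<Phi>_def A_def mult_nonneg_nonpos)
    then have "(\<integral>\<^sup>+\<omega>. \<Phi> 0 \<omega> \<partial>M) \<le> (\<integral>\<^sup>+\<omega>. 1 \<partial>M)" by (intro nn_integral_mono) (auto simp: ennreal_le_1)
    then show ?case by (simp add: emeasure_space_1)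
  next
    case (Suc k)
    then have k: "k < n" by simp
    let ?h = "\<lambda>\<omega> x. ennreal (if A k \<omega> then exp (c * a) else exp (c * (S k \<omega> + x)))"
    have [measurable]: "S k \<in> borel_measurable (past k)" "Measurable.pred (past k) (A k)" by auto
    have hm: "(\<lambda>(\<omega>, x). ?h \<omega> x) \<in> borel_measurable (past k \<Otimes>\<^sub>M borel)" by measurable
    have "\<Phi> (Suc k) \<omega> \<le> (if A k \<omega> then exp (c * a) else exp (c * (S k \<omega> + \<xi> k \<omega>)))" for \<omega>
      using c by (auto simp: \<Phi>_def A_def S_Suc le_Suc_eq intro!: mult_left_mono)
    then have "(\<integral>\<^sup>+\<omega>. \<Phi> (Suc k) \<omega> \<partial>M) \<le> (\<integral>\<^sup>+\<omega>. ?h \<omega> (\<xi> k \<omega>) \<partial>M)"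
      by (intro nn_integral_mono ennreal_leI)
    also have "\<dots> = (\<integral>\<^sup>+\<omega>. \<integral>\<^sup>+x. ?h \<omega> x \<partial>gauss \<delta> \<partial>M)" by (rule nn_integral_step[OF k hm])
    also have "\<dots> \<le> (\<integral>\<^sup>+\<omega>. ennreal (exp (c\<^sup>2 * \<delta>)) * \<Phi> k \<omega> \<partial>M)"
    proof (rule nn_integral_mono)
      fix \<omega>
      show "(\<integral>\<^sup>+x. ?h \<omega> x \<partial>gauss \<delta>) \<le> ennreal (exp (c\<^sup>2 * \<delta>)) * \<Phi> k \<omega>"
      proof (cases "A k \<omega>")
        case True
        have "exp (c * a) \<le> exp (c\<^sup>2 * \<delta>) * exp (c * a)" using delta_pos by simp
        then show ?thesis using True gauss.emeasure_space_1
          by (simp add: \<Phi>_def flip: ennreal_mult')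
      next
        case False
        have "(\<integral>\<^sup>+x. ?h \<omega> x \<partial>gauss \<delta>) = (\<integral>\<^sup>+x. ennreal (exp (c * S k \<omega>) * exp (c * x)) \<partial>gauss \<delta>)"
          using False by (simp add: distrib_left exp_add)
        also have "\<dots> = ennreal (exp (c * S k \<omega>) * exp (c\<^sup>2 * \<delta>))"
          using gauss_exp[OF delta_pos, of c] by (subst nn_integral_eq_integral) auto
        finally show ?thesis using False by (simp add: \<Phi>_def mult.commute flip: ennreal_mult')
      qed
    qed
    also have "\<dots> = ennreal (exp (c\<^sup>2 * \<delta>)) * (\<integral>\<^sup>+\<omega>. \<Phi> k \<omega> \<partial>M)"
    proof (rule nn_integral_cmult)
      have "\<Phi> k \<in> borel_measurable (past k)" unfolding \<Phi>_def by measurable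
      then have [measurable]: "\<Phi> k \<in> borel_measurable M"
        by (rule measurable_past[rotated]) (rule less_imp_le[OF k])
      then show "(\<lambda>\<omega>. ennreal (\<Phi> k \<omega>)) \<in> borel_measurable M" by measurable
    qed
    also have "\<dots> \<le> ennreal (exp (c\<^sup>2 * \<delta>)) * ennreal (exp (real k * (c\<^sup>2 * \<delta>)))"
      using Suc by (intro mult_left_mono) auto
    also have "\<dots> = ennreal (exp (real (Suc k) * (c\<^sup>2 * \<delta>)))"
      by (simp add: exp_add distrib_right flip: ennreal_mult')
    finally show ?case .
  qed
  have [measurable]: "Measurable.pred M (A k)"
    by (rule measurable_past[OF k A_past]) simp
  have "ennreal (exp (c * a)) * emeasure M {\<omega> \<in> space M. A k \<omega>} = (\<integral>\<^sup>+\<omega>. ennreal (exp (c * a)) * indicator {\<omega> \<in> space M. A k \<omega>} \<omega> \<partial>M)"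
    by (subst nn_integral_cmult_indicator) auto
  also have "\<dots> \<le> (\<integral>\<^sup>+\<omega>. \<Phi> k \<omega> \<partial>M)"
    by (intro nn_integral_mono) (auto simp: \<Phi>_def split: split_indicator)
  also have "\<dots> \<le> exp (real k * (c\<^sup>2 * \<delta>))" by (rule le[OF k])
  finally have "exp (c * a) * prob {\<omega> \<in> space M. A k \<omega>} \<le> exp (real k * (c\<^sup>2 * \<delta>))"
    by (simp add: emeasure_eq_measure flip: ennreal_mult')
  then have "prob {\<omega> \<in> space M. A k \<omega>} \<le> exp (real k * (c\<^sup>2 * \<delta>)) / exp (c * a)"
    by (simp add: field_simps)
  then show ?thesis by (simp add: A_def exp_diff[symmetric])
qed

lemma maximal:
  assumes k: "k \<le> n" "0 < k" and a: "0 \<le> a"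
  shows "prob {\<omega> \<in> space M. \<exists>j\<le>k. a \<le> \<bar>S j \<omega>\<bar>} \<le> 2 * exp (- (a\<^sup>2 / (4 * (real k * \<delta>))))"
proof -
  interpret neg: gaussian_walk M "\<lambda>i \<omega>. - \<xi> i \<omega>" n \<delta> by (rule uminus_walk)
  have neg_S: "neg.S j \<omega> = - S j \<omega>" for j \<omega> by (simp add: neg.S_def S_def sum_negf)
  \<comment> \<open>The minimizer of the exponent \<open>- c a + k c\<^sup>2 \<delta>\<close>.\<close>
  define c where "c = a / (2 * (real k * \<delta>))"
  have c: "0 \<le> c" using a k delta_pos by (simp add: c_def)
  have e: "- c * a + real k * (c\<^sup>2 * \<delta>) = - (a\<^sup>2 / (4 * (real k * \<delta>)))"
    using k delta_pos by (simp add: c_def field_simps power2_eq_square)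
  have [measurable]: "S j \<in> borel_measurable M" if "j \<le> k" for j using S_rv that k by auto
  have "prob {\<omega> \<in> space M. \<exists>j\<le>k. a \<le> \<bar>S j \<omega>\<bar>}
     \<le> prob ({\<omega> \<in> space M. \<exists>j\<le>k. a \<le> S j \<omega>} \<union> {\<omega> \<in> space M. \<exists>j\<le>k. a \<le> neg.S j \<omega>})"
  proof (rule finite_measure_mono)
    show "{\<omega> \<in> space M. \<exists>j\<le>k. a \<le> \<bar>S j \<omega>\<bar>} \<subseteq> {\<omega> \<in> space M. \<exists>j\<le>k. a \<le> S j \<omega>} \<union> {\<omega> \<in> space M. \<exists>j\<le>k. a \<le> neg.S j \<omega>}"
      by (auto simp: neg_S abs_if split: if_splits)
  qed (simp add: neg_S, measurable)
  also have "\<dots> \<le> prob {\<omega> \<in> space M. \<exists>j\<le>k. a \<le> S j \<omega>} + prob {\<omega> \<in> space M. \<exists>j\<le>k. a \<le> neg.S j \<omega>}"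
    by (rule measure_Un_le) (simp_all add: neg_S)
  also have "\<dots> \<le> 2 * exp (- (a\<^sup>2 / (4 * (real k * \<delta>))))"
    using maximal_exp[OF k(1) c, of a] neg.maximal_exp[OF k(1) c, of a] unfolding e by simp
  finally show ?thesis .
qed

end

section \<open>Confinement and visits to a strip\<close>

lemma (in gaussian_walk) gauss_prob_UNIV [simp]: "gauss.prob UNIV = 1"
  using gauss.prob_space by simp

lemma (in gaussian_walk) past_mono:
  assumes "j \<le> k" "U \<in> past j \<rightarrow>\<^sub>M N"
  shows "U \<in> past k \<rightarrow>\<^sub>M N"
proof (rule measurableI)
  show "U x \<in> space N" if "x \<in> space (past k)" for x using measurable_space[OF assms(2)] that by simp
  have "sets (past j) \<subseteq> sets (past k)"
    by (rule sets_past_le) (use assms(1) in \<open>auto intro: xi_past\<close>)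
  then show "U -` A \<inter> space (past k) \<in> sets (past k)" if "A \<in> sets N" for A
    using measurable_sets[OF assms(2) that] by auto
qed

text \<open>With \<open>\<theta> = \<pi> / (2\<rho>)\<close>, the function \<open>x \<mapsto> cos (\<theta> x)\<close> is an eigenfunction of the step kernel for the
  eigenvalue \<open>exp (- \<delta> \<theta>\<^sup>2)\<close>, positive on \<open>\<bar>x\<bar> < \<rho>\<close> and nonpositive on \<open>\<rho> \<le> \<bar>x\<bar> < 3\<rho>\<close>. So killing the walk
  when it leaves \<open>(- \<rho>, \<rho>)\<close> decreases the expectation of the eigenfunction by no more than the
  probability of a step longer than \<open>2\<rho>\<close>. As the cosine is at most \<open>1\<close>, its expectation is a lower bound for
  the survival probability. The event \<open>E\<close> of the past makes the bound usable for successive blocks.\<close>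

lemma (in gaussian_walk) confinement:
  fixes L :: nat
  assumes E: "Measurable.pred (past s) E" and sL: "s + L \<le> n" and \<rho>: "0 < \<rho>"
  defines "p \<equiv> exp (- \<delta> * (pi / (2 * \<rho>))\<^sup>2) ^ L - real L * (2 * exp (- (\<rho>\<^sup>2 / \<delta>)))"
  shows "p * prob {\<omega> \<in> space M. E \<omega>} \<le> prob {\<omega> \<in> space M. E \<omega> \<and> (\<forall>m\<le>L. \<bar>S (s + m) \<omega> - S s \<omega>\<bar> < \<rho>)}"
proof -
  define \<theta> where "\<theta> = pi / (2 * \<rho>)"
  define \<kappa> where "\<kappa> = exp (- \<delta> * \<theta>\<^sup>2)"
  define e where "e = 2 * exp (- (\<rho>\<^sup>2 / \<delta>))"
  have \<theta>: "0 < \<theta>" "\<theta> * \<rho> = pi / 2" using \<rho> by (auto simp: \<theta>_def)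
  have \<kappa>: "0 \<le> \<kappa>" "\<kappa> \<le> 1" using delta_pos by (auto simp: \<kappa>_def)
  have e: "0 \<le> e" by (simp add: e_def)
  define A where "A = (\<lambda>m \<omega>. E \<omega> \<and> (\<forall>i\<le>m. \<bar>S (s + i) \<omega> - S s \<omega>\<bar> < \<rho>))"
  define G where "G = (\<lambda>m \<omega>. if A m \<omega> then cos (\<theta> * (S (s + m) \<omega> - S s \<omega>)) else 0)"
  have cos_pos: "0 \<le> cos (\<theta> * x)" if "\<bar>x\<bar> < \<rho>" for x
  proof -
    have "\<theta> * \<bar>x\<bar> \<le> \<theta> * \<rho>" using that \<theta> by (intro mult_left_mono) auto
    then have "\<bar>\<theta> * x\<bar> \<le> pi / 2" using \<theta> by (simp add: abs_mult)
    then show ?thesis by (intro cos_ge_zero) auto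
  qed
  have cos_neg: "cos (\<theta> * x) \<le> 0" if "\<rho> \<le> \<bar>x\<bar>" "\<bar>x\<bar> < 3 * \<rho>" for x
  proof -
    have "\<theta> * \<rho> \<le> \<theta> * \<bar>x\<bar>" "\<theta> * \<bar>x\<bar> \<le> \<theta> * (3 * \<rho>)" using that \<theta> by (auto intro!: mult_left_mono)
    moreover have "\<theta> * (3 * \<rho>) = 3 * (\<theta> * \<rho>)" by simp
    ultimately have "pi / 2 \<le> \<theta> * \<bar>x\<bar>" "\<theta> * \<bar>x\<bar> \<le> 3 * pi / 2" unfolding \<theta>(2) by auto
    then have "0 \<le> cos (\<theta> * \<bar>x\<bar> - pi)" by (intro cos_ge_zero) auto
    then have "cos (\<theta> * \<bar>x\<bar>) \<le> 0" by (simp add: cos_diff)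
    then show ?thesis by (simp add: abs_if split: if_splits)
  qed
  have A_past: "Measurable.pred (past (s + m)) (A m)" for m
  proof -
    have [measurable]: "Measurable.pred (past (s + m)) E" by (rule past_mono[OF _ E]) simp
    have [measurable]: "Measurable.pred (past (s + m)) (\<lambda>\<omega>. \<forall>i\<le>m. \<bar>S (s + i) \<omega> - S s \<omega>\<bar> < \<rho>)"
    proof (rule pred_le_intros)
      fix i assume "i \<le> m"
      then have [measurable]: "S (s + i) \<in> borel_measurable (past (s + m))" "S s \<in> borel_measurable (past (s + m))" by (auto intro: S_past)
      show "Measurable.pred (past (s + m)) (\<lambda>\<omega>. \<bar>S (s + i) \<omega> - S s \<omega>\<bar> < \<rho>)" by measurable
    qed
    show ?thesis unfolding A_def by measurable
  qed
  have S_m [measurable]: "S (s + m) \<in> borel_measurable (past (s + m))" "S s \<in> borel_measurable (past (s + m))" for m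
    by (auto intro: S_past)
  have G_past: "G m \<in> borel_measurable (past (s + m))" for m
    unfolding G_def using A_past[of m] by measurable
  have G_rv: "G m \<in> borel_measurable M" if "m \<le> L" for m
    by (rule measurable_past[OF _ G_past]) (use that sL in auto)
  have E_rv [measurable]: "Measurable.pred M E" by (rule measurable_past[OF _ E]) (use sL in auto)
  have G_nonneg: "0 \<le> G m \<omega>" for m \<omega> by (auto simp: G_def A_def intro!: cos_pos)
  have G_le: "G m \<omega> \<le> 1" for m \<omega> by (auto simp: G_def)
  have G_int: "integrable M (G m)" if "m \<le> L" for m
    by (rule integrable_const_bound[where B=1]) (use G_nonneg G_le G_rv[OF that] in auto)
  define P where "P = prob {\<omega> \<in> space M. E \<omega>}"
  have step: "\<kappa> * expectation (G m) \<le> expectation (G (Suc m)) + e * P" if m: "m < L" for m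
  proof -
    have k: "s + m < n" using m sL by simp
    let ?h = "\<lambda>\<omega> y. ennreal ((if A m \<omega> \<and> \<bar>S (s + m) \<omega> - S s \<omega> + y\<bar> < \<rho> then cos (\<theta> * (S (s + m) \<omega> - S s \<omega> + y)) else 0) + (if E \<omega> then e else 0))"
    have [measurable]: "Measurable.pred (past (s + m)) E" by (rule past_mono[OF _ E]) simp
    note [measurable] = A_past[of m]
    have hm: "(\<lambda>(\<omega>, y). ?h \<omega> y) \<in> borel_measurable (past (s + m) \<Otimes>\<^sub>M borel)" by measurable
    have ie: "integrable M (\<lambda>\<omega>. if E \<omega> then e else 0)"
      by (rule integrable_const_bound[where B = e]) (use e in auto)
    have iG: "integrable M (G (Suc m))" using G_int[of "Suc m"] m by simp
    have i1: "integrable M (\<lambda>\<omega>. G (Suc m) \<omega> + (if E \<omega> then e else 0))"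
      by (rule Bochner_Integration.integrable_add[OF iG ie])
    have i2: "integrable M (\<lambda>\<omega>. \<kappa> * G m \<omega>)" using G_int[of m] m by simp
    have "ennreal (\<kappa> * expectation (G m)) = (\<integral>\<^sup>+\<omega>. ennreal (\<kappa> * G m \<omega>) \<partial>M)"
      using i2 \<kappa> G_nonneg by (subst nn_integral_eq_integral) auto
    also have "\<dots> \<le> (\<integral>\<^sup>+\<omega>. \<integral>\<^sup>+y. ?h \<omega> y \<partial>gauss \<delta> \<partial>M)"
    proof (rule nn_integral_mono)
      fix \<omega>
      show "ennreal (\<kappa> * G m \<omega>) \<le> (\<integral>\<^sup>+y. ?h \<omega> y \<partial>gauss \<delta>)"
      proof (cases "A m \<omega>")
        case True
        define x where "x = S (s + m) \<omega> - S s \<omega>"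
        have x: "\<bar>x\<bar> < \<rho>" and "E \<omega>" using True by (auto simp: A_def x_def)
        define g where "g = (\<lambda>y. if \<bar>x + y\<bar> < \<rho> then cos (\<theta> * (x + y)) else 0)"
        have g: "0 \<le> g y" "g y \<le> 1" for y by (auto simp: g_def intro!: cos_pos)
        have gm [measurable]: "g \<in> borel_measurable borel" unfolding g_def by measurable
        have gi: "integrable (gauss \<delta>) g"
          by (rule gauss.integrable_const_bound[where B=1]) (use g in auto)
        \<comment> \<open>The rate that optimizes the Chernoff bound for \<open>\<bar>y\<bar> \<ge> 2\<rho>\<close>.\<close>
        define c where "c = \<rho> / \<delta>"
        let ?b = "\<lambda>y. exp (- 2 * c * \<rho>) * (exp (c * y) + exp (- c * y))"
        have bi: "integrable (gauss \<delta>) ?b"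
          by (intro integrable_mult_right Bochner_Integration.integrable_add gauss_exp(1)[OF delta_pos])
        have b: "cos (\<theta> * (x + y)) \<le> g y + ?b y" for y
        proof (cases "\<bar>y\<bar> < 2 * \<rho>")
          case True
          then have "cos (\<theta> * (x + y)) \<le> g y" using cos_neg[of "x + y"] x by (auto simp: g_def)
          then show ?thesis by (rule add_increasing2[rotated]) simp
        next
          case False
          have "1 \<le> exp (- 2 * c * \<rho>) * exp (c * \<bar>y\<bar>)"
            using False \<rho> delta_pos by (simp add: exp_add[symmetric] c_def field_simps)
          also have "\<dots> \<le> ?b y" by (rule mult_left_mono) (auto simp: abs_if)
          finally show ?thesis using g(1)[of y] cos_le_one[of "\<theta> * (x + y)"] by linarith
        qed
        have "\<kappa> * cos (\<theta> * x) = (\<integral>y. cos (\<theta> * (x + y)) \<partial>gauss \<delta>)"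
          unfolding gauss_cos_shift[OF delta_pos] \<kappa>_def by simp
        also have "\<dots> \<le> (\<integral>y. g y + ?b y \<partial>gauss \<delta>)"
        proof (rule integral_mono)
          show "integrable (gauss \<delta>) (\<lambda>y. cos (\<theta> * (x + y)))"
            by (rule gauss.integrable_const_bound[where B=1]) auto
          show "integrable (gauss \<delta>) (\<lambda>y. g y + ?b y)" using gi bi by (rule Bochner_Integration.integrable_add)
        qed (use b in auto)
        also have "\<dots> = (\<integral>y. g y \<partial>gauss \<delta>) + (\<integral>y. ?b y \<partial>gauss \<delta>)"
          using gi bi by (rule Bochner_Integration.integral_add)
        also have "(\<integral>y. ?b y \<partial>gauss \<delta>) = exp (- 2 * c * \<rho>) * ((\<integral>y. exp (c * y) \<partial>gauss \<delta>) + (\<integral>y. exp (- c * y) \<partial>gauss \<delta>))"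
          using gauss_exp(1)[OF delta_pos, of c] gauss_exp(1)[OF delta_pos, of "- c"] by simp
        also have "\<dots> = exp (- 2 * c * \<rho>) * (2 * exp (c\<^sup>2 * \<delta>))"
          using gauss_exp(2)[OF delta_pos, of c] gauss_exp(2)[OF delta_pos, of "- c"] by simp
        also have "\<dots> = e"
        proof -
          have "- 2 * c * \<rho> + c\<^sup>2 * \<delta> = - (\<rho>\<^sup>2 / \<delta>)" using delta_pos by (simp add: c_def field_simps power2_eq_square)
          then show ?thesis unfolding e_def by (metis exp_add mult.left_commute)
        qed
        finally have le: "\<kappa> * G m \<omega> \<le> (\<integral>y. g y + e \<partial>gauss \<delta>)"
          using True gi gauss.prob_space by (simp add: G_def x_def)
        have "(\<integral>\<^sup>+y. ?h \<omega> y \<partial>gauss \<delta>) = (\<integral>\<^sup>+y. ennreal (g y + e) \<partial>gauss \<delta>)"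
          using True \<open>E \<omega>\<close> unfolding g_def x_def by simp
        also have "\<dots> = ennreal (\<integral>y. g y + e \<partial>gauss \<delta>)"
          using g e gi by (intro nn_integral_eq_integral) auto
        finally show ?thesis using le by (simp add: ennreal_leI)
      qed (simp add: G_def)
    qed
    also have "\<dots> = (\<integral>\<^sup>+\<omega>. ?h \<omega> (\<xi> (s + m) \<omega>) \<partial>M)" by (rule nn_integral_step[OF k hm, symmetric])
    also have "\<dots> \<le> (\<integral>\<^sup>+\<omega>. ennreal (G (Suc m) \<omega> + (if E \<omega> then e else 0)) \<partial>M)"
    proof (intro nn_integral_mono ennreal_leI add_right_mono)
      fix \<omega>
      have eq: "S (s + Suc m) \<omega> - S s \<omega> = S (s + m) \<omega> - S s \<omega> + \<xi> (s + m) \<omega>" by (simp add: S_Suc)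
      have AS: "A (Suc m) \<omega> \<longleftrightarrow> A m \<omega> \<and> \<bar>S (s + m) \<omega> - S s \<omega> + \<xi> (s + m) \<omega>\<bar> < \<rho>"
        unfolding A_def eq[symmetric] by (auto simp: le_Suc_eq)
      show "(if A m \<omega> \<and> \<bar>S (s + m) \<omega> - S s \<omega> + \<xi> (s + m) \<omega>\<bar> < \<rho> then cos (\<theta> * (S (s + m) \<omega> - S s \<omega> + \<xi> (s + m) \<omega>)) else 0) \<le> G (Suc m) \<omega>"
        unfolding G_def AS eq by simp
    qed
    also have "\<dots> = ennreal (expectation (\<lambda>\<omega>. G (Suc m) \<omega> + (if E \<omega> then e else 0)))"
      using i1 e G_nonneg by (intro nn_integral_eq_integral) auto
    also have "expectation (\<lambda>\<omega>. G (Suc m) \<omega> + (if E \<omega> then e else 0)) = expectation (G (Suc m)) + expectation (\<lambda>\<omega>. if E \<omega> then e else 0)"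
      by (rule Bochner_Integration.integral_add[OF iG ie])
    also have "expectation (\<lambda>\<omega>. if E \<omega> then e else 0) = e * P"
    proof -
      have "expectation (\<lambda>\<omega>. if E \<omega> then e else 0) = expectation (\<lambda>\<omega>. e * indicator {\<omega> \<in> space M. E \<omega>} \<omega>)"
        by (rule Bochner_Integration.integral_cong) (auto simp: indicator_def)
      then show ?thesis by (simp add: P_def)
    qed
    finally show ?thesis
      using e G_nonneg by (subst (asm) ennreal_le_iff) (auto simp: P_def intro!: add_nonneg_nonneg Bochner_Integration.integral_nonneg)
  qed
  have ind: "m \<le> L \<Longrightarrow> (\<kappa> ^ m - real m * e) * P \<le> expectation (G m)" for m
  proof (induction m)
    case 0
    have "G 0 = (\<lambda>\<omega>. if E \<omega> then 1 else 0 :: real)" using \<rho> by (auto simp: G_def A_def fun_eq_iff)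
    moreover have "expectation (\<lambda>\<omega>. if E \<omega> then 1 else 0 :: real) = expectation (indicator {\<omega> \<in> space M. E \<omega>})"
      by (rule Bochner_Integration.integral_cong) (auto simp: indicator_def)
    ultimately show ?case by (simp add: P_def)
  next
    case (Suc m)
    have P0: "0 \<le> P" by (simp add: P_def)
    have "\<kappa> * (real m * e) \<le> real m * e" using \<kappa> e by (intro mult_left_le_one_le) auto
    then have "(\<kappa> ^ Suc m - real (Suc m) * e) * P \<le> (\<kappa> * (\<kappa> ^ m - real m * e) - e) * P"
      using P0 by (intro mult_right_mono) (auto simp: algebra_simps)
    also have "\<dots> = \<kappa> * ((\<kappa> ^ m - real m * e) * P) - e * P" by (simp add: algebra_simps)
    also have "\<dots> \<le> \<kappa> * expectation (G m) - e * P" using Suc \<kappa> by (intro diff_right_mono mult_left_mono) auto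
    also have "\<dots> \<le> expectation (G (Suc m))" using step[of m] Suc by simp
    finally show ?case .
  qed
  have A_rv: "Measurable.pred M (A L)" by (rule measurable_past[OF sL A_past])
  have "p * P \<le> expectation (G L)"
    using ind[of L] unfolding p_def \<kappa>_def \<theta>_def e_def by simp
  also have "\<dots> \<le> expectation (indicator {\<omega> \<in> space M. A L \<omega>})"
    using A_rv by (intro integral_mono G_int integrable_const_bound[where B=1]) (auto simp: G_def indicator_def)
  also have "\<dots> = prob {\<omega> \<in> space M. A L \<omega>}" using A_rv by simp
  finally show ?thesis unfolding A_def P_def .
qed

lemma (in gaussian_walk) no_confined_block:
  fixes L J :: nat
  assumes JL: "J * L \<le> n" and \<rho>: "0 < \<rho>"
  defines "p \<equiv> exp (- \<delta> * (pi / (2 * \<rho>))\<^sup>2) ^ L - real L * (2 * exp (- (\<rho>\<^sup>2 / \<delta>)))"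
  shows "prob {\<omega> \<in> space M. \<forall>j<J. \<exists>m\<le>L. \<rho> \<le> \<bar>S (j * L + m) \<omega> - S (j * L) \<omega>\<bar>} \<le> (1 - p) ^ J"
  using JL
proof (induction J)
  case 0
  show ?case by simp
next
  case (Suc J)
  define E where "E = (\<lambda>\<omega>. \<forall>j<J. \<exists>m\<le>L. \<rho> \<le> \<bar>S (j * L + m) \<omega> - S (j * L) \<omega>\<bar>)"
  define B where "B = (\<lambda>\<omega>. \<forall>m\<le>L. \<bar>S (J * L + m) \<omega> - S (J * L) \<omega>\<bar> < \<rho>)"
  have JL: "J * L + L \<le> n" using Suc.prems by (simp add: add.commute)
  have "Measurable.pred (past (J * L)) (\<lambda>\<omega>. \<forall>j\<in>{..<J}. \<exists>m\<le>L. \<rho> \<le> \<bar>S (j * L + m) \<omega> - S (j * L) \<omega>\<bar>)"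
  proof (intro pred_intros_finite(3) pred_le_intros)
    fix j m assume "j \<in> {..<J}" "m \<le> L"
    then have "j * L + L \<le> J * L" using mult_le_mono1[of "Suc j" J L] by simp
    then have [measurable]: "S (j * L + m) \<in> borel_measurable (past (J * L))" "S (j * L) \<in> borel_measurable (past (J * L))"
      using \<open>m \<le> L\<close> \<open>j \<in> {..<J}\<close> by (auto intro!: S_past)
    show "Measurable.pred (past (J * L)) (\<lambda>\<omega>. \<rho> \<le> \<bar>S (j * L + m) \<omega> - S (j * L) \<omega>\<bar>)" by measurable
  qed simp
  then have E: "Measurable.pred (past (J * L)) E" unfolding E_def by (simp only: Ball_def lessThan_iff)
  have [measurable]: "Measurable.pred M E" by (rule measurable_past[OF _ E]) (use JL in auto)
  have [measurable]: "Measurable.pred M B" unfolding B_def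
  proof (rule pred_le_intros)
    fix m assume "m \<le> L"
    then have [measurable]: "S (J * L + m) \<in> borel_measurable M" "S (J * L) \<in> borel_measurable M"
      using JL by (auto intro!: S_rv)
    show "Measurable.pred M (\<lambda>\<omega>. \<bar>S (J * L + m) \<omega> - S (J * L) \<omega>\<bar> < \<rho>)" by measurable
  qed
  have c: "p * prob {\<omega> \<in> space M. E \<omega>} \<le> prob {\<omega> \<in> space M. E \<omega> \<and> B \<omega>}"
    unfolding p_def B_def by (rule confinement[OF E JL \<rho>])
  have "{\<omega> \<in> space M. \<forall>j<Suc J. \<exists>m\<le>L. \<rho> \<le> \<bar>S (j * L + m) \<omega> - S (j * L) \<omega>\<bar>} = {\<omega> \<in> space M. E \<omega>} - {\<omega> \<in> space M. E \<omega> \<and> B \<omega>}"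
    unfolding E_def B_def less_Suc_eq by (auto simp: not_less) (meson not_le)
  then have "prob {\<omega> \<in> space M. \<forall>j<Suc J. \<exists>m\<le>L. \<rho> \<le> \<bar>S (j * L + m) \<omega> - S (j * L) \<omega>\<bar>}
      = prob {\<omega> \<in> space M. E \<omega>} - prob {\<omega> \<in> space M. E \<omega> \<and> B \<omega>}"
    by (simp, subst finite_measure_Diff) auto
  also have "\<dots> \<le> (1 - p) * prob {\<omega> \<in> space M. E \<omega>}" using c by (simp add: algebra_simps)
  also have "\<dots> \<le> (1 - p) * (1 - p) ^ J"
  proof (rule mult_left_mono)
    show "prob {\<omega> \<in> space M. E \<omega>} \<le> (1 - p) ^ J" unfolding E_def using Suc by simp
    have "exp (- \<delta> * (pi / (2 * \<rho>))\<^sup>2) ^ L \<le> 1" using delta_pos by (intro power_le_one) auto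
    moreover have "0 \<le> real L * (2 * exp (- (\<rho>\<^sup>2 / \<delta>)))" by simp
    ultimately show "0 \<le> 1 - p" unfolding p_def by linarith
  qed
  finally show ?case by simp
qed

text \<open>With \<open>z = sqrt \<delta> / \<rho>\<close> this says that a step below \<open>- \<rho>\<close>, weighted by an exponential, is negligible against
  the variance of a step; \<open>48\<close> makes the crude estimate \<open>exp y \<ge> y\<^sup>2 / 2\<close> sufficient.\<close>

lemma exp_overshoot_bound:
  fixes z :: real
  assumes z: "0 < z" "z \<le> 1 / 48"
  shows "exp (- (1 / z) + (1 + z)\<^sup>2) \<le> z\<^sup>2 / 2"
proof -
  have "1 + 1 / (2 * z) + (1 / (2 * z))\<^sup>2 / 2 \<le> exp (1 / (2 * z))"
    using z by (intro exp_lower_Taylor_quadratic) auto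
  then have a: "(1 / (2 * z))\<^sup>2 / 2 \<le> exp (1 / (2 * z))" 
    using z by (smt (verit) divide_nonneg_nonneg)
  have "((1 / (2 * z))\<^sup>2 / 2)\<^sup>2 \<le> (exp (1 / (2 * z)))\<^sup>2" by (rule power_mono[OF a]) auto
  also have "(exp (1 / (2 * z)))\<^sup>2 = exp (1 / z)" by (simp flip: exp_double)
  finally have b: "1 / (64 * z ^ 4) \<le> exp (1 / z)" by (simp add: power_divide power_mult_distrib flip: power_mult)
  then have b: "exp (- (1 / z)) \<le> 64 * z ^ 4" using z by (simp add: exp_minus field_simps)
  have "(1 + z)\<^sup>2 \<le> (1 + 1 / 48)\<^sup>2" using z by (intro power_mono) auto
  also have "\<dots> \<le> 2" by (simp add: power2_eq_square)
  finally have "exp ((1 + z)\<^sup>2) \<le> exp 2" by simp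
  also have "exp (2::real) = (exp 1)\<^sup>2" by (simp flip: exp_double)
  also have "\<dots> \<le> 3\<^sup>2" by (intro power_mono exp_le) auto
  finally have c: "exp ((1 + z)\<^sup>2) \<le> 9" by simp
  have "exp (- (1 / z) + (1 + z)\<^sup>2) = exp (- (1 / z)) * exp ((1 + z)\<^sup>2)" by (rule exp_add)
  also have "\<dots> \<le> (64 * z ^ 4) * 9" using b c z by (intro mult_mono) auto
  also have "\<dots> = 576 * z\<^sup>2 * z\<^sup>2" by (simp add: power2_eq_square power4_eq_xxxx)
  also have "\<dots> \<le> (1 / 2) * z\<^sup>2"
  proof (rule mult_right_mono)
    have "z\<^sup>2 \<le> (1 / 48)\<^sup>2" using z by (intro power_mono) auto
    then show "576 * z\<^sup>2 \<le> 1 / 2" by (simp add: power2_eq_square)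
  qed simp
  finally show ?thesis by simp
qed

definition (in gaussian_walk) visits :: "real \<Rightarrow> nat \<Rightarrow> 'a \<Rightarrow> nat set" where
  "visits \<rho> k \<omega> = {j. j < k \<and> (\<forall>i\<le>j. - 2 * \<rho> < S i \<omega>) \<and> S j \<omega> < 3 * \<rho>}"

text \<open>The potential \<open>\<phi> x = 1 + e\<^sup>3 - exp (- x / \<rho>)\<close> is concave, at least \<open>1\<close> above \<open>- 2\<rho>\<close> and at most \<open>1 + e\<^sup>3\<close>.
  By concavity the step kernel decreases it, in the strip below \<open>3\<rho>\<close> by a factor \<open>exp (- \<eta>)\<close> at least.
  Hence \<open>exp (\<eta> \<cdot> visits) \<cdot> \<phi>(S)\<close>, with \<open>\<phi>\<close> replaced by \<open>1\<close> once the walk has fallen below \<open>- 2\<rho>\<close>, is a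
  supermartingale that starts at \<open>\<phi> 0 = e\<^sup>3\<close>.\<close>

lemma (in gaussian_walk) visits_exp_moment:
  assumes \<rho>: "0 < \<rho>" and small: "sqrt \<delta> / \<rho> \<le> 1 / 48" and k: "k \<le> n"
  defines "\<eta> \<equiv> exp (- 3) * (\<delta> / \<rho>\<^sup>2) / (2 * (1 + exp 3))"
  shows "(\<integral>\<^sup>+\<omega>. ennreal (exp (\<eta> * real (card (visits \<rho> k \<omega>)))) \<partial>M) \<le> ennreal (exp 3)"
proof -
  define C where "C = 1 + exp (3::real)"
  define z where "z = sqrt \<delta> / \<rho>"
  have z: "0 < z" "z \<le> 1 / 48" using \<rho> small delta_pos by (auto simp: z_def)
  have z2: "z\<^sup>2 = \<delta> / \<rho>\<^sup>2" using delta_pos by (simp add: z_def power_divide)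
  have C: "0 < C" by (simp add: C_def add_pos_pos)
  have \<eta>: "\<eta> = exp (- 3) * z\<^sup>2 / (2 * C)" "0 \<le> \<eta>"
    using delta_pos C by (auto simp: \<eta>_def z2 C_def)
  define A where "A = (\<lambda>j \<omega>. \<forall>i\<le>j. - 2 * \<rho> < S i \<omega>)"
  define cnt where "cnt = (\<lambda>k \<omega>. \<Sum>j<k. if A j \<omega> \<and> S j \<omega> < 3 * \<rho> then 1 else 0 :: real)"
  define \<phi> where "\<phi> = (\<lambda>x. C - exp (- (x / \<rho>)))"
  define Z where "Z = (\<lambda>k \<omega>. exp (\<eta> * cnt k \<omega>) * (if A k \<omega> then \<phi> (S k \<omega>) else 1))"
  have card: "real (card (visits \<rho> k \<omega>)) = cnt k \<omega>" for k \<omega>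
  proof -
    have "visits \<rho> k \<omega> = {j \<in> {..<k}. A j \<omega> \<and> S j \<omega> < 3 * \<rho>}" by (auto simp: visits_def A_def)
    moreover have "real (card {j \<in> {..<k}. A j \<omega> \<and> S j \<omega> < 3 * \<rho>}) = (\<Sum>j\<in>{j \<in> {..<k}. A j \<omega> \<and> S j \<omega> < 3 * \<rho>}. 1)" by simp
    ultimately show ?thesis unfolding cnt_def by (simp only: sum.inter_filter[OF finite_lessThan])
  qed
  have A_past: "j \<le> k \<Longrightarrow> Measurable.pred (past k) (A j)" for j k
    unfolding A_def
  proof (rule pred_le_intros)
    fix i assume "j \<le> k" "i \<le> j"
    then have [measurable]: "S i \<in> borel_measurable (past k)" by simp
    show "Measurable.pred (past k) (\<lambda>\<omega>. - 2 * \<rho> < S i \<omega>)" by measurable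
  qed
  have cnt_past: "j \<le> Suc k \<Longrightarrow> cnt j \<in> borel_measurable (past k)" for j k
    unfolding cnt_def
  proof (intro borel_measurable_sum)
    fix i assume "j \<le> Suc k" "i \<in> {..<j}"
    then have [measurable]: "S i \<in> borel_measurable (past k)" "Measurable.pred (past k) (A i)" by (auto intro: A_past)
    show "(\<lambda>\<omega>. if A i \<omega> \<and> S i \<omega> < 3 * \<rho> then 1 else 0 :: real) \<in> borel_measurable (past k)" by measurable
  qed
  have \<phi>_ge: "1 \<le> \<phi> x" if "- 2 * \<rho> < x" for x
  proof -
    have "- (x / \<rho>) \<le> 3" using that \<rho> by (simp add: field_simps)
    then show ?thesis by (simp add: \<phi>_def C_def)
  qed
  have \<phi>_le: "\<phi> x \<le> C" for x by (simp add: \<phi>_def)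
  have inner: "(\<integral>\<^sup>+y. ennreal (max 1 (\<phi> (x + y))) \<partial>gauss \<delta>) \<le> ennreal (\<phi> x * (if x < 3 * \<rho> then exp (- \<eta>) else 1))"
    if x: "- 2 * \<rho> < x" for x
  proof -
    \<comment> \<open>When the walk falls below \<open>- 2\<rho>\<close> the value \<open>1\<close> may exceed \<open>\<phi>\<close>, but only after a step below \<open>- \<rho>\<close>.
      The second exponential, of rate \<open>b\<close>, dominates this excess.\<close>
    define a b where "a = - (1 / \<rho>)" and "b = - (1 / \<rho> + 1 / sqrt \<delta>)"
    define E where "E = exp (- (x / \<rho>))"
    let ?u = "\<lambda>y. C - E * exp (a * y) + E * exp (- (1 / z)) * exp (b * y)"
    have le: "max 1 (\<phi> (x + y)) \<le> ?u y" for y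
    proof -
      have e1: "E * exp (a * y) = exp (- ((x + y) / \<rho>))"
        unfolding E_def a_def by (simp add: add_divide_distrib flip: exp_add)
      have "E * exp (- (1 / z)) * exp (b * y) = exp (- ((x + y) / \<rho>) + - ((y + \<rho>) / sqrt \<delta>))"
        unfolding E_def b_def z_def using \<rho> delta_pos by (simp add: field_simps flip: exp_add)
      then have e2: "E * exp (- (1 / z)) * exp (b * y) = exp (- ((x + y) / \<rho>)) * exp (- ((y + \<rho>) / sqrt \<delta>))"
        by (simp only: exp_add)
      have u: "?u y = \<phi> (x + y) + exp (- ((x + y) / \<rho>)) * exp (- ((y + \<rho>) / sqrt \<delta>))"
        unfolding e1 e2 \<phi>_def ..
      show ?thesis
      proof (cases "1 \<le> \<phi> (x + y)")
        case True
        then show ?thesis unfolding u by simp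
      next
        case False
        then have "exp 3 < exp (- ((x + y) / \<rho>))" by (simp add: \<phi>_def C_def)
        then have "3 < - ((x + y) / \<rho>)" by simp
        then have "y < - \<rho>" using x \<rho> by (simp add: field_simps)
        then have "1 \<le> exp (- ((y + \<rho>) / sqrt \<delta>))" using delta_pos by (simp add: field_simps)
        then have "exp (- ((x + y) / \<rho>)) * 1 \<le> exp (- ((x + y) / \<rho>)) * exp (- ((y + \<rho>) / sqrt \<delta>))"
          by (intro mult_left_mono) auto
        then have "C \<le> ?u y" unfolding u by (simp add: \<phi>_def)
        then show ?thesis using False \<phi>_le[of "x + y"] by (auto simp: C_def max_def)
      qed
    qed
    have ui: "integrable (gauss \<delta>) ?u"
      by (intro Bochner_Integration.integrable_add Bochner_Integration.integrable_diff integrable_mult_right gauss_exp(1)[OF delta_pos]) auto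
    have "0 \<le> ?u y" for y using le[of y] by linarith
    then have "(\<integral>\<^sup>+y. ennreal (max 1 (\<phi> (x + y))) \<partial>gauss \<delta>) \<le> ennreal (\<integral>y. ?u y \<partial>gauss \<delta>)"
      using le by (subst nn_integral_eq_integral[OF ui, symmetric]) (auto intro!: nn_integral_mono ennreal_leI)
    also have "(\<integral>y. ?u y \<partial>gauss \<delta>) = C - E * exp (a\<^sup>2 * \<delta>) + E * exp (- (1 / z)) * exp (b\<^sup>2 * \<delta>)"
      using gauss_exp[OF delta_pos, of a] gauss_exp[OF delta_pos, of b]
      by (simp add: gauss.prob_space)
    also have "\<dots> \<le> \<phi> x * (if x < 3 * \<rho> then exp (- \<eta>) else 1)"
    proof -
      have a2: "a\<^sup>2 * \<delta> = z\<^sup>2" unfolding z2 a_def by (simp add: power_divide)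
      have "b * sqrt \<delta> = - (1 + z)" unfolding b_def z_def using \<rho> delta_pos by (simp add: field_simps)
      then have "(b * sqrt \<delta>)\<^sup>2 = (1 + z)\<^sup>2" by (simp only: power2_minus)
      then have b2: "b\<^sup>2 * \<delta> = (1 + z)\<^sup>2" using delta_pos by (simp add: power_mult_distrib)
      have "exp (- (1 / z)) * exp (b\<^sup>2 * \<delta>) \<le> z\<^sup>2 / 2"
        unfolding b2 exp_add[symmetric] by (rule exp_overshoot_bound[OF z])
      then have "E * (exp (- (1 / z)) * exp (b\<^sup>2 * \<delta>)) \<le> E * (z\<^sup>2 / 2)" by (intro mult_left_mono) (auto simp: E_def)
      moreover have "E * (1 + z\<^sup>2) \<le> E * exp (a\<^sup>2 * \<delta>)" unfolding a2
        by (intro mult_left_mono exp_ge_add_one_self) (auto simp: E_def)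
      ultimately have "C - E * exp (a\<^sup>2 * \<delta>) + E * exp (- (1 / z)) * exp (b\<^sup>2 * \<delta>) \<le> \<phi> x - E * (z\<^sup>2 / 2)"
        by (simp add: \<phi>_def E_def[symmetric] algebra_simps)
      also have "\<dots> \<le> \<phi> x * (if x < 3 * \<rho> then exp (- \<eta>) else 1)"
      proof (cases "x < 3 * \<rho>")
        case True
        have "exp (- 3) \<le> E" using True \<rho> by (simp add: E_def field_simps)
        then have "exp (- 3) * (z\<^sup>2 / 2) \<le> E * (z\<^sup>2 / 2)" by (intro mult_right_mono) auto
        moreover have "\<phi> x * \<eta> \<le> C * \<eta>" using \<phi>_le \<eta>(2) by (intro mult_right_mono) auto
        moreover have "C * \<eta> = exp (- 3) * (z\<^sup>2 / 2)" unfolding \<eta>(1) using C by simp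
        ultimately have "\<phi> x - E * (z\<^sup>2 / 2) \<le> \<phi> x * (1 - \<eta>)" by (simp add: algebra_simps)
        also have "\<dots> \<le> \<phi> x * exp (- \<eta>)"
          using \<phi>_ge[OF x] exp_ge_add_one_self[of "- \<eta>"] by (intro mult_left_mono) auto
        finally show ?thesis using True by simp
      qed (simp add: E_def)
      finally show ?thesis .
    qed
    finally show ?thesis by (simp add: ennreal_leI)
  qed
  have le: "k \<le> n \<Longrightarrow> (\<integral>\<^sup>+\<omega>. ennreal (Z k \<omega>) \<partial>M) \<le> exp 3" for k
  proof (induction k)
    case 0
    have "Z 0 \<omega> = exp 3" for \<omega> using \<rho> by (simp add: Z_def cnt_def A_def \<phi>_def C_def)
    then show ?case by (simp add: emeasure_space_1)
  next
    case (Suc k)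
    then have k: "k < n" by simp
    let ?h = "\<lambda>\<omega> y. ennreal (exp (\<eta> * cnt (Suc k) \<omega>)) * (if A k \<omega> then ennreal (max 1 (\<phi> (S k \<omega> + y))) else 1)"
    have [measurable]: "S k \<in> borel_measurable (past k)" "Measurable.pred (past k) (A k)" "cnt (Suc k) \<in> borel_measurable (past k)"
      by (auto intro: A_past cnt_past)
    have hm: "(\<lambda>(\<omega>, y). ?h \<omega> y) \<in> borel_measurable (past k \<Otimes>\<^sub>M borel)" unfolding \<phi>_def by measurable
    have "(\<integral>\<^sup>+\<omega>. ennreal (Z (Suc k) \<omega>) \<partial>M) \<le> (\<integral>\<^sup>+\<omega>. ?h \<omega> (\<xi> k \<omega>) \<partial>M)"
    proof (intro nn_integral_mono)
      fix \<omega>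
      have AS: "A (Suc k) \<omega> \<longrightarrow> A k \<omega>" by (auto simp: A_def)
      show "ennreal (Z (Suc k) \<omega>) \<le> ?h \<omega> (\<xi> k \<omega>)"
        using AS unfolding Z_def S_Suc
        by (auto simp: ennreal_mult' intro!: mult_left_mono ennreal_leI simp flip: ennreal_1)
    qed
    also have "\<dots> = (\<integral>\<^sup>+\<omega>. \<integral>\<^sup>+y. ?h \<omega> y \<partial>gauss \<delta> \<partial>M)" by (rule nn_integral_step[OF k hm])
    also have "\<dots> \<le> (\<integral>\<^sup>+\<omega>. ennreal (Z k \<omega>) \<partial>M)"
    proof (rule nn_integral_mono)
      fix \<omega>
      show "(\<integral>\<^sup>+y. ?h \<omega> y \<partial>gauss \<delta>) \<le> ennreal (Z k \<omega>)"
      proof (cases "A k \<omega>")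
        case False
        then show ?thesis using gauss.emeasure_space_1 by (simp add: Z_def cnt_def)
      next
        case True
        then have x: "- 2 * \<rho> < S k \<omega>" by (auto simp: A_def)
        have m: "(\<lambda>y. ennreal (max 1 (\<phi> (S k \<omega> + y)))) \<in> borel_measurable (gauss \<delta>)" unfolding \<phi>_def by measurable
        have "(\<integral>\<^sup>+y. ?h \<omega> y \<partial>gauss \<delta>) = ennreal (exp (\<eta> * cnt (Suc k) \<omega>)) * (\<integral>\<^sup>+y. ennreal (max 1 (\<phi> (S k \<omega> + y))) \<partial>gauss \<delta>)"
          using True m by (simp add: nn_integral_cmult)
        also have "\<dots> \<le> ennreal (exp (\<eta> * cnt (Suc k) \<omega>)) * ennreal (\<phi> (S k \<omega>) * (if S k \<omega> < 3 * \<rho> then exp (- \<eta>) else 1))"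
          by (intro mult_left_mono inner x) auto
        also have "\<dots> = ennreal (exp (\<eta> * cnt (Suc k) \<omega>) * (\<phi> (S k \<omega>) * (if S k \<omega> < 3 * \<rho> then exp (- \<eta>) else 1)))"
          by (simp add: ennreal_mult')
        also have "exp (\<eta> * cnt (Suc k) \<omega>) * (\<phi> (S k \<omega>) * (if S k \<omega> < 3 * \<rho> then exp (- \<eta>) else 1)) = Z k \<omega>"
          using True by (simp add: Z_def cnt_def distrib_left exp_add exp_minus)
        finally show ?thesis by simp
      qed
    qed
    finally show ?case using Suc by simp
  qed
  have "exp (\<eta> * cnt k \<omega>) \<le> Z k \<omega>" for \<omega>
    using \<phi>_ge[of "S k \<omega>"] by (auto simp: Z_def A_def)
  then have "(\<integral>\<^sup>+\<omega>. ennreal (exp (\<eta> * cnt k \<omega>)) \<partial>M) \<le> (\<integral>\<^sup>+\<omega>. ennreal (Z k \<omega>) \<partial>M)"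
    by (intro nn_integral_mono ennreal_leI)
  also have "\<dots> \<le> exp 3" by (rule le[OF k])
  finally show ?thesis unfolding card .
qed

lemma (in gaussian_walk) visits_tail:
  assumes \<rho>: "0 < \<rho>" and small: "sqrt \<delta> / \<rho> \<le> 1 / 48" and k: "k \<le> n"
  defines "\<eta> \<equiv> exp (- 3) * (\<delta> / \<rho>\<^sup>2) / (2 * (1 + exp 3))"
  shows "{\<omega> \<in> space M. a \<le> real (card (visits \<rho> k \<omega>))} \<in> events"
    and "prob {\<omega> \<in> space M. a \<le> real (card (visits \<rho> k \<omega>))} \<le> exp (3 - \<eta> * a)"
proof -
  have \<eta>: "0 < \<eta>" using \<rho> delta_pos by (auto simp: \<eta>_def intro!: divide_pos_pos mult_pos_pos add_pos_pos)
  let ?f = "\<lambda>\<omega>. real (card (visits \<rho> k \<omega>))"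
  have A: "Measurable.pred M (\<lambda>\<omega>. (\<forall>i\<le>j. - 2 * \<rho> < S i \<omega>) \<and> S j \<omega> < 3 * \<rho>)" if "j < k" for j
  proof -
    have [measurable]: "S i \<in> borel_measurable M" if "i \<le> j" for i using that \<open>j < k\<close> k by (intro S_rv) auto
    have [measurable]: "Measurable.pred M (\<lambda>\<omega>. \<forall>i\<le>j. - 2 * \<rho> < S i \<omega>)"
      by (rule pred_le_intros) measurable
    show ?thesis by measurable
  qed
  have eq: "?f \<omega> = (\<Sum>j<k. if (\<forall>i\<le>j. - 2 * \<rho> < S i \<omega>) \<and> S j \<omega> < 3 * \<rho> then 1 else 0)" for \<omega>
  proof -
    have "visits \<rho> k \<omega> = {j \<in> {..<k}. (\<forall>i\<le>j. - 2 * \<rho> < S i \<omega>) \<and> S j \<omega> < 3 * \<rho>}" by (auto simp: visits_def)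
    then have "?f \<omega> = (\<Sum>j\<in>{j \<in> {..<k}. (\<forall>i\<le>j. - 2 * \<rho> < S i \<omega>) \<and> S j \<omega> < 3 * \<rho>}. 1)" by simp
    then show ?thesis by (simp only: sum.inter_filter[OF finite_lessThan])
  qed
  have m [measurable]: "?f \<in> borel_measurable M"
    unfolding eq
  proof (rule borel_measurable_sum)
    fix j assume "j \<in> {..<k}"
    then have *: "Measurable.pred M (\<lambda>\<omega>. (\<forall>i\<le>j. - 2 * \<rho> < S i \<omega>) \<and> S j \<omega> < 3 * \<rho>)" by (intro A) auto
    show "(\<lambda>\<omega>. if (\<forall>i\<le>j. - 2 * \<rho> < S i \<omega>) \<and> S j \<omega> < 3 * \<rho> then 1 else 0 :: real) \<in> borel_measurable M"
      by (rule measurable_If[OF borel_measurable_const borel_measurable_const *[unfolded pred_def]])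
  qed
  show ev: "{\<omega> \<in> space M. a \<le> ?f \<omega>} \<in> events" by measurable
  have "ennreal (exp (\<eta> * a)) * emeasure M {\<omega> \<in> space M. a \<le> ?f \<omega>} = (\<integral>\<^sup>+\<omega>. ennreal (exp (\<eta> * a)) * indicator {\<omega> \<in> space M. a \<le> ?f \<omega>} \<omega> \<partial>M)"
    by (subst nn_integral_cmult_indicator) auto
  also have "\<dots> \<le> (\<integral>\<^sup>+\<omega>. ennreal (exp (\<eta> * ?f \<omega>)) \<partial>M)"
    using \<eta> by (intro nn_integral_mono) (auto split: split_indicator intro!: ennreal_leI)
  also have "\<dots> \<le> ennreal (exp 3)"
    unfolding \<eta>_def by (rule visits_exp_moment[OF \<rho> small k])
  finally have "exp (\<eta> * a) * prob {\<omega> \<in> space M. a \<le> ?f \<omega>} \<le> exp 3"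
    by (simp add: emeasure_eq_measure flip: ennreal_mult')
  then show "prob {\<omega> \<in> space M. a \<le> ?f \<omega>} \<le> exp (3 - \<eta> * a)"
    by (simp add: exp_diff field_simps)
qed

section \<open>A twice differentiable function with trapezoidal second derivative\<close>

lemma DERIV_quadratic_bound:
  fixes f :: "real \<Rightarrow> real"
  assumes "\<And>h::real. \<bar>h\<bar> \<le> 1 \<Longrightarrow> \<bar>f (x + h) - f x - h * D\<bar> \<le> C * h\<^sup>2"
  shows "(f has_real_derivative D) (at x)"
  unfolding DERIV_def
proof (rule LIM_I)
  fix r :: real assume r: "0 < r"
  have C: "0 \<le> C" using assms[of 1] by simp
  show "\<exists>s>0. \<forall>h::real. h \<noteq> 0 \<and> norm (h - 0) < s \<longrightarrow> norm ((f (x + h) - f x) / h - D) < r"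
  proof (intro exI[of _ "min 1 (r / (C + 1))"] conjI allI impI)
    show "0 < min 1 (r / (C + 1))" using r C by simp
    fix h :: real assume h: "h \<noteq> 0 \<and> norm (h - 0) < min 1 (r / (C + 1))"
    then have h1: "\<bar>h\<bar> \<le> 1" "h \<noteq> 0" and h2: "\<bar>h\<bar> * (C + 1) < r" using C by (auto simp: field_simps)
    have "\<bar>(f (x + h) - f x) / h - D\<bar> = \<bar>f (x + h) - f x - h * D\<bar> / \<bar>h\<bar>"
      using h1 by (simp add: field_simps flip: abs_divide)
    also have "\<dots> \<le> C * h\<^sup>2 / \<bar>h\<bar>" using assms[OF h1(1)] by (intro divide_right_mono) auto
    also have "\<dots> = \<bar>h\<bar> * C" using h1 by (simp add: power2_eq_square abs_if)
    also have "\<dots> \<le> \<bar>h\<bar> * (C + 1)" by (intro mult_left_mono) auto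
    finally show "norm ((f (x + h) - f x) / h - D) < r" using h2 by simp
  qed
qed

text \<open>Half of its second derivative is half of the positive part; four translates of it make up the
  function \<open>F\<close> below, for which explicit Taylor bounds are needed.\<close>

definition cub :: "real \<Rightarrow> real" where "cub x = (max 0 x) ^ 3 / 6"

lemma cub_taylor: "\<bar>cub (x + y) - cub x - y * (max 0 x)\<^sup>2 / 2 - y\<^sup>2 * max 0 x / 2\<bar> \<le> \<bar>y\<bar> ^ 3 / 6"
proof -
  consider "0 \<le> x" "0 \<le> x + y" | "x < 0" "0 \<le> x + y" | "0 \<le> x" "x + y < 0" | "x < 0" "x + y < 0" by linarith
  then show ?thesis
  proof cases
    case 1
    then have "cub (x + y) - cub x - y * (max 0 x)\<^sup>2 / 2 - y\<^sup>2 * max 0 x / 2 = y ^ 3 / 6"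
      by (simp add: cub_def max_def power2_eq_square power3_eq_cube field_simps)
    then show ?thesis by (simp only:) (simp add: power_abs)
  next
    case 2
    then have "0 \<le> (x + y) ^ 3" "(x + y) ^ 3 \<le> y ^ 3" by (auto intro!: power_mono)
    then show ?thesis using 2 by (simp add: cub_def max_def)
  next
    case 3
    have eq: "cub (x + y) - cub x - y * (max 0 x)\<^sup>2 / 2 - y\<^sup>2 * max 0 x / 2 = (y ^ 3 - (x + y) ^ 3) / 6"
      using 3 by (simp add: cub_def max_def power2_eq_square power3_eq_cube field_simps)
    have odd: "(- u) ^ 3 = - (u ^ 3)" for u :: real by (simp add: power3_eq_cube)
    have "(- (x + y)) ^ 3 \<le> (- y) ^ 3" by (rule power_mono) (use 3 in auto)
    moreover have "0 \<le> (- (x + y)) ^ 3" by (rule zero_le_power) (use 3 in auto)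
    ultimately have "y ^ 3 \<le> (x + y) ^ 3" "(x + y) ^ 3 \<le> 0" unfolding odd by simp_all
    moreover have "\<bar>y\<bar> ^ 3 = - (y ^ 3)" using 3 by (simp add: abs_if power3_eq_cube)
    ultimately show ?thesis unfolding eq by simp
  next
    case 4
    then show ?thesis by (simp add: cub_def max_def)
  qed
qed

lemma DERIV_pos_sq: "((\<lambda>x. (max 0 x)\<^sup>2) has_real_derivative 2 * max 0 x) (at x)" for x :: real
proof (rule DERIV_quadratic_bound[where C = 1])
  fix h :: real
  show "\<bar>(max 0 (x + h))\<^sup>2 - (max 0 x)\<^sup>2 - h * (2 * max 0 x)\<bar> \<le> 1 * h\<^sup>2"
  proof -
    consider "0 \<le> x" "0 \<le> x + h" | "x < 0" "0 \<le> x + h" | "0 \<le> x" "x + h < 0" | "x < 0" "x + h < 0" by linarith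
    then show ?thesis
    proof cases
      case 1
      then show ?thesis by (simp add: max_def power2_eq_square algebra_simps)
    next
      case 2
      then have "(x + h)\<^sup>2 \<le> h\<^sup>2" by (intro power_mono) auto
      then show ?thesis using 2 by (simp add: max_def)
    next
      case 3
      have "(- (x + h))\<^sup>2 \<le> (- h)\<^sup>2" using 3 by (intro power_mono) auto
      then have "(x + h)\<^sup>2 \<le> h\<^sup>2" by (simp only: power2_minus)
      moreover have "(max 0 (x + h))\<^sup>2 - (max 0 x)\<^sup>2 - h * (2 * max 0 x) = h\<^sup>2 - (x + h)\<^sup>2"
        using 3 by (simp add: max_def power2_eq_square algebra_simps)
      ultimately show ?thesis by simp
    next
      case 4
      then show ?thesis by (simp add: max_def)
    qed
  qed
qed

lemma DERIV_cub: "(cub has_real_derivative (max 0 x)\<^sup>2 / 2) (at x)"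
proof (rule DERIV_quadratic_bound[where C = "max 0 x / 2 + 1 / 6"])
  fix h :: real assume h: "\<bar>h\<bar> \<le> 1"
  have "\<bar>h\<bar> ^ 3 / 6 \<le> h\<^sup>2 * (1 / 6)" using h mult_right_mono[of "\<bar>h\<bar>" 1 "h * h"] by (simp add: power3_eq_cube power2_eq_square mult.assoc)
  moreover have "0 \<le> h\<^sup>2 * max 0 x / 2" by simp
  ultimately have "\<bar>cub (x + h) - cub x - h * (max 0 x)\<^sup>2 / 2\<bar> \<le> h\<^sup>2 * max 0 x / 2 + h\<^sup>2 * (1 / 6)"
    using cub_taylor[of x h] by linarith
  then show "\<bar>cub (x + h) - cub x - h * ((max 0 x)\<^sup>2 / 2)\<bar> \<le> (max 0 x / 2 + 1 / 6) * h\<^sup>2"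
    by (simp add: algebra_simps)
qed

text \<open>The corners of the trapezoid \<open>\<psi>\<close>: it rises from \<open>0\<close> at \<open>a\<close> to \<open>1\<close> at \<open>b\<close>, falls from \<open>1\<close> at \<open>c\<close> to \<open>0\<close> at
  \<open>d\<close>, and both slopes have width \<open>w\<close>. The function \<open>F\<close> is the second antiderivative of \<open>\<psi>\<close> that
  vanishes to the right of \<open>d\<close>; to the left of \<open>a\<close> it is linear with slope \<open>- D\<close>, where \<open>D\<close> is
  the integral of \<open>\<psi>\<close>.\<close>

locale trapezoid =
  fixes a b c d w :: real
  assumes w: "0 < w" "b = a + w" "d = c + w" "b \<le> c"
begin

definition F :: "real \<Rightarrow> real" where
  "F x = (cub (d - x) - cub (c - x) - cub (b - x) + cub (a - x)) / w"

definition \<psi> :: "real \<Rightarrow> real" where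
  "\<psi> x = (max 0 (d - x) - max 0 (c - x) - max 0 (b - x) + max 0 (a - x)) / w"

definition "D = d - b"

lemma D_pos: "0 < D" using w unfolding D_def by linarith

lemma psi_bounds: "0 \<le> \<psi> x" "\<psi> x \<le> 1"
proof -
  have "0 \<le> max 0 (d - x) - max 0 (c - x) - max 0 (b - x) + max 0 (a - x)"
    "max 0 (d - x) - max 0 (c - x) - max 0 (b - x) + max 0 (a - x) \<le> w"
    using w by linarith+
  then show "0 \<le> \<psi> x" "\<psi> x \<le> 1" using w(1) by (simp_all add: \<psi>_def)
qed

lemma psi_eq_1: "\<psi> x = 1" if "b \<le> x" "x \<le> c"
proof -
  have "max 0 (d - x) - max 0 (c - x) - max 0 (b - x) + max 0 (a - x) = w" using w that by linarith
  then show ?thesis using w(1) by (simp add: \<psi>_def)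
qed

lemma psi_eq_0: "\<psi> x = 0" if "x \<le> a \<or> d \<le> x"
proof -
  have "max 0 (d - x) - max 0 (c - x) - max 0 (b - x) + max 0 (a - x) = 0" using w that by linarith
  then show ?thesis by (simp add: \<psi>_def)
qed

lemma F_DERIV:
  "\<exists>s. (F has_real_derivative s) (at x) \<and> - D \<le> s \<and> s \<le> 0"
proof -
  define g where "g = (\<lambda>t. (max 0 (t + w))\<^sup>2 - (max 0 t)\<^sup>2)"
  have g: "0 \<le> g t - g s \<and> g t - g s \<le> 2 * w * (t - s)" if "s \<le> t" for s t
  proof
    have dg: "(g has_real_derivative 2 * max 0 (u + w) - 2 * max 0 u) (at u)" for u
    proof -
      have "((\<lambda>t. (max 0 (t + w))\<^sup>2) has_real_derivative 2 * max 0 (u + w) * 1) (at u)"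
        by (rule DERIV_chain2[OF DERIV_pos_sq]) (auto intro!: derivative_eq_intros)
      from DERIV_diff[OF this DERIV_pos_sq[of u]] show ?thesis unfolding g_def by simp
    qed
    have "g s \<le> g t"
      by (rule DERIV_nonneg_imp_nondecreasing[OF that]) (use dg w in \<open>force simp: max_def\<close>)
    then show "0 \<le> g t - g s" by simp
    have "(\<lambda>u. 2 * w * u - g u) s \<le> (\<lambda>u. 2 * w * u - g u) t"
    proof (rule DERIV_nonneg_imp_nondecreasing[OF that])
      fix u
      have "((\<lambda>u. 2 * w * u - g u) has_real_derivative 2 * w - (2 * max 0 (u + w) - 2 * max 0 u)) (at u)"
        by (auto intro!: derivative_eq_intros dg)
      moreover have "0 \<le> 2 * w - (2 * max 0 (u + w) - 2 * max 0 u)" using w by (auto simp: max_def)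
      ultimately show "\<exists>y. ((\<lambda>u. 2 * w * u - g u) has_real_derivative y) (at u) \<and> 0 \<le> y" by blast
    qed
    then show "g t - g s \<le> 2 * w * (t - s)" by (simp add: algebra_simps)
  qed
  let ?s = "- ((g (c - x) - g (a - x)) / (2 * w))"
  have dc: "((\<lambda>x. cub (t - x)) has_real_derivative - ((max 0 (t - x))\<^sup>2 / 2)) (at x)" for t
  proof -
    have "((\<lambda>x. cub (t - x)) has_real_derivative (max 0 (t - x))\<^sup>2 / 2 * (- 1)) (at x)"
      by (rule DERIV_chain2[where f = cub and g = "\<lambda>x. t - x"], rule DERIV_cub) (auto intro!: derivative_eq_intros)
    then show ?thesis by simp
  qed
  have "(F has_real_derivative ((- ((max 0 (d - x))\<^sup>2 / 2)) - (- ((max 0 (c - x))\<^sup>2 / 2)) - (- ((max 0 (b - x))\<^sup>2 / 2)) + (- ((max 0 (a - x))\<^sup>2 / 2))) / w) (at x)"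
    unfolding F_def
    by (intro DERIV_cdivide DERIV_add DERIV_diff dc)
  moreover have "((- ((max 0 (d - x))\<^sup>2 / 2)) - (- ((max 0 (c - x))\<^sup>2 / 2)) - (- ((max 0 (b - x))\<^sup>2 / 2)) + (- ((max 0 (a - x))\<^sup>2 / 2))) / w = ?s"
    using w by (simp add: g_def field_simps)
  moreover have "- D \<le> ?s" "?s \<le> 0"
  proof -
    have ac: "a - x \<le> c - x" using w by linarith
    have D: "D = (c - x) - (a - x)" using w unfolding D_def by linarith
    show "- D \<le> ?s" "?s \<le> 0" using g[OF ac] w(1) unfolding D by (simp_all add: field_simps)
  qed
  ultimately show ?thesis by metis
qed

lemma F_antimono: "x \<le> y \<Longrightarrow> F y \<le> F x"
  by (rule DERIV_nonpos_imp_nonincreasing) (use F_DERIV in blast)+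

lemma F_lipschitz: "\<bar>F x - F y\<bar> \<le> D * \<bar>x - y\<bar>"
proof -
  have *: "F x - F y \<le> D * (y - x)" if "x \<le> y" for x y
  proof -
    have "(\<lambda>u. F u + D * u) x \<le> (\<lambda>u. F u + D * u) y"
    proof (rule DERIV_nonneg_imp_nondecreasing[OF that])
      fix u
      obtain s where s: "(F has_real_derivative s) (at u)" "- D \<le> s" using F_DERIV by blast
      have "((\<lambda>u. F u + D * u) has_real_derivative s + D) (at u)"
        by (auto intro!: derivative_eq_intros s)
      then show "\<exists>y. ((\<lambda>u. F u + D * u) has_real_derivative y) (at u) \<and> 0 \<le> y" using s(2) by fastforce
    qed
    then show ?thesis by (simp add: algebra_simps)
  qed
  show ?thesis using *[of x y] *[of y x] F_antimono[of x y] F_antimono[of y x] by (cases "x \<le> y") auto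
qed

lemma F_eq_0: "d \<le> x \<Longrightarrow> F x = 0"
proof -
  assume "d \<le> x"
  then have "max 0 (d - x) = 0" "max 0 (c - x) = 0" "max 0 (b - x) = 0" "max 0 (a - x) = 0" using w by linarith+
  then show ?thesis unfolding F_def cub_def by simp
qed

lemma F_nonneg: "0 \<le> F x"
  using F_antimono[of x "max x d"] F_eq_0[of "max x d"] by simp

lemma F_le: "x \<le> d \<Longrightarrow> F x \<le> D * (d - x)"
  using F_lipschitz[of x d] F_eq_0[of d] by (simp add: abs_if split: if_splits)

lemma F_linear: "x \<le> a \<Longrightarrow> F x = F a + D * (a - x)"
proof -
  assume x: "x \<le> a"
  have max: "max 0 (d - x) = d - x" "max 0 (c - x) = c - x" "max 0 (b - x) = b - x" "max 0 (a - x) = a - x"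
    "max 0 (d - a) = d - a" "max 0 (c - a) = c - a" "max 0 (b - a) = b - a" "max 0 (a - a) = 0"
    using x w by auto
  show ?thesis
    unfolding F_def cub_def max D_def using w(1) unfolding w(2,3)
    by (simp add: field_simps power3_eq_cube)
qed

lemma F_measurable [measurable]: "F \<in> borel_measurable borel" "\<psi> \<in> borel_measurable borel"
  unfolding F_def \<psi>_def cub_def by measurable

lemma F_taylor:
  "\<exists>p. \<forall>y. \<bar>F (x - y) - F x - y * p - y\<^sup>2 / 2 * \<psi> x\<bar> \<le> (2 / (3 * w)) * \<bar>y\<bar> ^ 3"
proof (intro exI allI)
  fix y
  let ?q = "\<lambda>t. cub (t - x + y) - cub (t - x) - y * (max 0 (t - x))\<^sup>2 / 2 - y\<^sup>2 * max 0 (t - x) / 2"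
  let ?p = "((max 0 (d - x))\<^sup>2 / 2 - (max 0 (c - x))\<^sup>2 / 2 - (max 0 (b - x))\<^sup>2 / 2 + (max 0 (a - x))\<^sup>2 / 2) / w"
  have sh: "t - (x - y) = t - x + y" for t by simp
  have eq: "F (x - y) - F x - y * ?p - y\<^sup>2 / 2 * \<psi> x = (?q d - ?q c - ?q b + ?q a) / w"
    unfolding F_def \<psi>_def sh using w(1) by (simp add: field_simps)
  have le: "\<bar>?q d - ?q c - ?q b + ?q a\<bar> \<le> 4 * (\<bar>y\<bar> ^ 3 / 6)"
  proof -
    have gen: "\<bar>p - q - r + s\<bar> \<le> 4 * e" if "\<bar>p\<bar> \<le> e" "\<bar>q\<bar> \<le> e" "\<bar>r\<bar> \<le> e" "\<bar>s\<bar> \<le> e" for p q r s e :: real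
      using that by linarith
    show ?thesis by (rule gen; rule cub_taylor)
  qed
  have "\<bar>?q d - ?q c - ?q b + ?q a\<bar> / \<bar>w\<bar> \<le> 4 * (\<bar>y\<bar> ^ 3 / 6) / \<bar>w\<bar>"
    by (rule divide_right_mono[OF le]) simp
  also have "4 * (\<bar>y\<bar> ^ 3 / 6) / \<bar>w\<bar> = (2 / (3 * w)) * \<bar>y\<bar> ^ 3" using w(1) by simp
  finally show "\<bar>F (x - y) - F x - y * ?p - y\<^sup>2 / 2 * \<psi> x\<bar> \<le> (2 / (3 * w)) * \<bar>y\<bar> ^ 3"
    unfolding eq abs_divide .
qed

end

lemma gauss_abs_cube:
  assumes "0 < \<delta>"
  shows "integrable (gauss \<delta>) (\<lambda>y. \<bar>y\<bar> ^ 3)" "(\<integral>y. \<bar>y\<bar> ^ 3 \<partial>gauss \<delta>) \<le> 7 * (\<delta> * sqrt \<delta>)"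
proof -
  have i: "integrable (gauss \<delta>) (\<lambda>y. sqrt \<delta> / 2 * y\<^sup>2 + 1 / (2 * sqrt \<delta>) * y ^ 4)"
    by (intro Bochner_Integration.integrable_add integrable_mult_right gauss_moments(1)[OF assms])
  have b: "\<bar>y\<bar> ^ 3 \<le> sqrt \<delta> / 2 * y\<^sup>2 + 1 / (2 * sqrt \<delta>) * y ^ 4" for y
  proof -
    have "0 \<le> y\<^sup>2 * (\<bar>y\<bar> - sqrt \<delta>)\<^sup>2" by simp
    also have "y\<^sup>2 * (\<bar>y\<bar> - sqrt \<delta>)\<^sup>2 = y ^ 4 + sqrt \<delta> * sqrt \<delta> * y\<^sup>2 - 2 * sqrt \<delta> * \<bar>y\<bar> ^ 3"
      by (cases "0 \<le> y") (simp_all add: power2_eq_square power3_eq_cube power4_eq_xxxx algebra_simps)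
    finally have "2 * sqrt \<delta> * \<bar>y\<bar> ^ 3 \<le> y ^ 4 + sqrt \<delta> * sqrt \<delta> * y\<^sup>2" by linarith
    then have "\<bar>y\<bar> ^ 3 \<le> (y ^ 4 + sqrt \<delta> * sqrt \<delta> * y\<^sup>2) / (2 * sqrt \<delta>)"
      using assms by (subst le_divide_eq) (auto simp: mult_ac)
    also have "\<dots> = sqrt \<delta> / 2 * y\<^sup>2 + 1 / (2 * sqrt \<delta>) * y ^ 4"
    proof -
      have *: "(p + s * s * q) / (2 * s) = s / 2 * q + 1 / (2 * s) * p" if "s \<noteq> 0" for s p q :: real
        using that by (simp add: field_simps)
      show ?thesis by (rule *) (use assms in simp)
    qed
    finally show ?thesis .
  qed
  have b2: "\<bar>y\<bar> ^ 3 \<le> \<bar>sqrt \<delta> / 2 * y\<^sup>2 + 1 / (2 * sqrt \<delta>) * y ^ 4\<bar>" for y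
    using b[of y] by linarith
  show i3: "integrable (gauss \<delta>) (\<lambda>y. \<bar>y\<bar> ^ 3)"
    by (rule Bochner_Integration.integrable_bound[OF i]) (use b2 in auto)
  have "(\<integral>y. \<bar>y\<bar> ^ 3 \<partial>gauss \<delta>) \<le> (\<integral>y. sqrt \<delta> / 2 * y\<^sup>2 + 1 / (2 * sqrt \<delta>) * y ^ 4 \<partial>gauss \<delta>)"
    by (rule integral_mono[OF i3 i]) (use b in auto)
  also have "\<dots> = sqrt \<delta> / 2 * (2 * \<delta>) + 1 / (2 * sqrt \<delta>) * (12 * \<delta>\<^sup>2)"
    using gauss_moments[OF assms] by simp
  also have "\<dots> = 7 * (\<delta> * sqrt \<delta>)"
  proof -
    have "\<delta>\<^sup>2 / sqrt \<delta> = \<delta> * sqrt \<delta>" using assms real_div_sqrt[of \<delta>] by (simp add: power2_eq_square flip: times_divide_eq_right)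
    then show ?thesis by simp
  qed
  finally show "(\<integral>y. \<bar>y\<bar> ^ 3 \<partial>gauss \<delta>) \<le> 7 * (\<delta> * sqrt \<delta>)" .
qed

context trapezoid
begin

text \<open>The last bound is of higher order in \<open>\<delta>\<close>: to the right of \<open>d + g\<close> the function \<open>F\<close> vanishes, and only a
  step longer than \<open>g\<close> can be seen by it.\<close>

lemma F_increment_moments:
  assumes "0 < \<delta>"
  shows "integrable (gauss \<delta>) (\<lambda>y. (F (x - y) - F x)\<^sup>2)" "integrable (gauss \<delta>) (\<lambda>y. F (x - y))"
    "(\<integral>y. (F (x - y) - F x)\<^sup>2 \<partial>gauss \<delta>) \<le> D\<^sup>2 * (2 * \<delta>)"
    "0 < g \<Longrightarrow> d + g \<le> x \<Longrightarrow> (\<integral>y. (F (x - y) - F x)\<^sup>2 \<partial>gauss \<delta>) \<le> D\<^sup>2 * (12 * \<delta>\<^sup>2 / g\<^sup>2)"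
proof -
  interpret prob_space "gauss \<delta>" by (rule prob_space_gauss[OF assms])
  have b: "(F (x - y) - F x)\<^sup>2 \<le> D\<^sup>2 * y\<^sup>2" for y
  proof -
    have "\<bar>F (x - y) - F x\<bar> \<le> \<bar>D * y\<bar>" using F_lipschitz[of "x - y" x] D_pos by (simp add: abs_mult)
    then have "(F (x - y) - F x)\<^sup>2 \<le> (D * y)\<^sup>2" by (rule abs_le_square_iff[THEN iffD1])
    then show ?thesis by (simp add: power_mult_distrib)
  qed
  have i2: "integrable (gauss \<delta>) (\<lambda>y. D\<^sup>2 * y\<^sup>2)" by (intro integrable_mult_right gauss_moments(1)[OF assms])
  show i: "integrable (gauss \<delta>) (\<lambda>y. (F (x - y) - F x)\<^sup>2)"
    by (rule Bochner_Integration.integrable_bound[OF i2]) (use b in auto)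
  have "integrable (gauss \<delta>) (\<lambda>y. F (x - y) - F x)"
    by (rule square_integrable_imp_integrable[OF _ i]) auto
  then have "integrable (gauss \<delta>) (\<lambda>y. (F (x - y) - F x) + F x)" by (intro Bochner_Integration.integrable_add) auto
  then show "integrable (gauss \<delta>) (\<lambda>y. F (x - y))" by simp
  have "(\<integral>y. (F (x - y) - F x)\<^sup>2 \<partial>gauss \<delta>) \<le> (\<integral>y. D\<^sup>2 * y\<^sup>2 \<partial>gauss \<delta>)"
    by (rule integral_mono[OF i i2]) (use b in auto)
  then show "(\<integral>y. (F (x - y) - F x)\<^sup>2 \<partial>gauss \<delta>) \<le> D\<^sup>2 * (2 * \<delta>)" using gauss_moments[OF assms] by simp
  assume g: "0 < g" "d + g \<le> x"
  have i4: "integrable (gauss \<delta>) (\<lambda>y. D\<^sup>2 / g\<^sup>2 * y ^ 4)" by (intro integrable_mult_right gauss_moments(1)[OF assms])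
  have b4: "(F (x - y) - F x)\<^sup>2 \<le> D\<^sup>2 / g\<^sup>2 * y ^ 4" for y
  proof (cases "y \<le> g")
    case True
    then show ?thesis using F_eq_0[of x] F_eq_0[of "x - y"] g by simp
  next
    case False
    then have "1 \<le> (y / g)\<^sup>2" using g by simp
    then have "(D\<^sup>2 * y\<^sup>2) * 1 \<le> (D\<^sup>2 * y\<^sup>2) * (y / g)\<^sup>2" by (intro mult_left_mono) auto
    also have "\<dots> = D\<^sup>2 / g\<^sup>2 * y ^ 4" using g by (simp add: power_divide power2_eq_square power4_eq_xxxx)
    finally show ?thesis using b[of y] by linarith
  qed
  have "(\<integral>y. (F (x - y) - F x)\<^sup>2 \<partial>gauss \<delta>) \<le> (\<integral>y. D\<^sup>2 / g\<^sup>2 * y ^ 4 \<partial>gauss \<delta>)"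
    by (rule integral_mono[OF i i4]) (use b4 in auto)
  then show "(\<integral>y. (F (x - y) - F x)\<^sup>2 \<partial>gauss \<delta>) \<le> D\<^sup>2 * (12 * \<delta>\<^sup>2 / g\<^sup>2)" using gauss_moments[OF assms] by simp
qed

text \<open>Taylor expansion to second order; the linear term integrates to zero and half the variance of a step
  is \<open>\<delta>\<close>. The error is of third order because \<open>\<psi>\<close> is Lipschitz with constant \<open>1 / w\<close>.\<close>

lemma F_mean:
  assumes "0 < \<delta>"
  shows "\<bar>(\<integral>y. F (x - y) \<partial>gauss \<delta>) - F x - \<delta> * \<psi> x\<bar> \<le> 5 * (\<delta> * sqrt \<delta>) / w"
proof -
  interpret prob_space "gauss \<delta>" by (rule prob_space_gauss[OF assms])
  have P1: "prob UNIV = 1" using prob_space by simp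
  obtain p where p: "\<And>y. \<bar>F (x - y) - F x - y * p - y\<^sup>2 / 2 * \<psi> x\<bar> \<le> (2 / (3 * w)) * \<bar>y\<bar> ^ 3"
    using F_taylor by blast
  have iy: "integrable (gauss \<delta>) (\<lambda>y. y)" using gauss_moments(1)[OF assms, of 1] by simp
  note m = gauss_moments[OF assms]
  have i1: "integrable (gauss \<delta>) (\<lambda>y. F (x - y) - F x - y * p)"
    using F_increment_moments(2)[OF assms, of x] iy by auto
  have i2: "integrable (gauss \<delta>) (\<lambda>y. y\<^sup>2 / 2 * \<psi> x)" using m(1)[of 2] by auto
  have i: "integrable (gauss \<delta>) (\<lambda>y. F (x - y) - F x - y * p - y\<^sup>2 / 2 * \<psi> x)"
    by (rule Bochner_Integration.integrable_diff[OF i1 i2])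
  have "(\<integral>y. F (x - y) - F x - y * p - y\<^sup>2 / 2 * \<psi> x \<partial>gauss \<delta>) = (\<integral>y. F (x - y) \<partial>gauss \<delta>) - F x - \<delta> * \<psi> x"
    using F_increment_moments(2)[OF assms, of x] iy i1 i2 m by (simp add: P1)
  moreover have "\<bar>\<integral>y. F (x - y) - F x - y * p - y\<^sup>2 / 2 * \<psi> x \<partial>gauss \<delta>\<bar> \<le> (\<integral>y. \<bar>F (x - y) - F x - y * p - y\<^sup>2 / 2 * \<psi> x\<bar> \<partial>gauss \<delta>)"
    by (rule integral_abs_bound)
  moreover have "\<dots> \<le> (\<integral>y. (2 / (3 * w)) * \<bar>y\<bar> ^ 3 \<partial>gauss \<delta>)"
  proof (rule integral_mono)
    show "integrable (gauss \<delta>) (\<lambda>y. 2 / (3 * w) * \<bar>y\<bar> ^ 3)" by (intro integrable_mult_right gauss_abs_cube[OF assms])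
    show "integrable (gauss \<delta>) (\<lambda>y. \<bar>F (x - y) - F x - y * p - y\<^sup>2 / 2 * \<psi> x\<bar>)" using i by (rule integrable_abs)
  qed (rule p)
  moreover have "\<dots> \<le> (2 / (3 * w)) * (7 * (\<delta> * sqrt \<delta>))"
    unfolding integral_mult_right_zero by (intro mult_left_mono gauss_abs_cube[OF assms]) (use w in auto)
  moreover have "\<dots> \<le> 5 * (\<delta> * sqrt \<delta>) / w" using w assms by (simp add: field_simps)
  ultimately show ?thesis by linarith
qed

end

section \<open>Occupation near zero of the walk reflected at its maximum\<close>

context gaussian_walk
begin

definition Smax :: "nat \<Rightarrow> 'a \<Rightarrow> real" where
  "Smax k \<omega> = Max ((\<lambda>j. S j \<omega>) ` {..k})"

definition R :: "nat \<Rightarrow> 'a \<Rightarrow> real" where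
  "R k \<omega> = Smax k \<omega> - S k \<omega>"

lemma Smax_0 [simp]: "Smax 0 \<omega> = 0" by (simp add: Smax_def)

lemma Smax_Suc_max: "Smax (Suc k) \<omega> = max (Smax k \<omega>) (S (Suc k) \<omega>)"
  by (simp add: Smax_def atMost_Suc max.commute)

lemma R_0 [simp]: "R 0 \<omega> = 0" by (simp add: R_def)

lemma R_nonneg: "0 \<le> R k \<omega>"
  by (simp add: R_def Smax_def)

lemma R_Suc: "R (Suc k) \<omega> = max 0 (R k \<omega> - \<xi> k \<omega>)"
  by (auto simp: R_def Smax_Suc_max S_Suc max_def)

lemma Smax_Suc: "Smax (Suc k) \<omega> = Smax k \<omega> + max 0 (\<xi> k \<omega> - R k \<omega>)"
  by (auto simp: R_def Smax_Suc_max S_Suc max_def)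

lemma Smax_nonneg: "0 \<le> Smax k \<omega>"
  by (induction k) (auto simp: Smax_Suc)

lemma Smax_past [measurable]: "j \<le> k \<Longrightarrow> Smax j \<in> borel_measurable (past k)"
proof (induction j)
  case 0
  have "Smax 0 = (\<lambda>_. 0)" by auto
  then show ?case by simp
next
  case (Suc j)
  then have [measurable]: "Smax j \<in> borel_measurable (past k)" "S (Suc j) \<in> borel_measurable (past k)" by auto
  have "Smax (Suc j) = (\<lambda>\<omega>. max (Smax j \<omega>) (S (Suc j) \<omega>))" by (auto simp: Smax_Suc_max)
  then show ?case by simp
qed

lemma R_past [measurable]: "j \<le> k \<Longrightarrow> R j \<in> borel_measurable (past k)"
proof -
  assume "j \<le> k"
  then have [measurable]: "Smax j \<in> borel_measurable (past k)" "S j \<in> borel_measurable (past k)" by auto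
  show ?thesis unfolding R_def by measurable
qed

lemma Smax_rv: "k \<le> n \<Longrightarrow> Smax k \<in> borel_measurable M"
  by (rule measurable_past[OF _ Smax_past]) auto

lemma R_rv: "k \<le> n \<Longrightarrow> R k \<in> borel_measurable M"
  by (rule measurable_past[OF _ R_past]) auto

lemma nn_integral_gauss_sq_shift: "(\<integral>\<^sup>+y. ennreal ((r - y)\<^sup>2) \<partial>gauss \<delta>) = ennreal (r\<^sup>2 + 2 * \<delta>)"
proof -
  have iy: "integrable (gauss \<delta>) (\<lambda>y. y)" "integrable (gauss \<delta>) (\<lambda>y. y\<^sup>2)"
    using gauss_moments(1)[OF delta_pos, of 1] gauss_moments(1)[OF delta_pos, of 2] by auto
  have eq: "(r - y)\<^sup>2 = r\<^sup>2 - 2 * r * y + y\<^sup>2" for y by (simp add: power2_diff)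
  have i: "integrable (gauss \<delta>) (\<lambda>y. (r - y)\<^sup>2)" unfolding eq using iy by auto
  have "(\<integral>y. (r - y)\<^sup>2 \<partial>gauss \<delta>) = r\<^sup>2 + 2 * \<delta>"
    unfolding eq using iy gauss_moments[OF delta_pos] by simp
  then show ?thesis using nn_integral_eq_integral[OF i] by simp
qed

text \<open>Reflection only moves the walk towards \<open>0\<close>, so each step adds at most its variance.\<close>

lemma R_second_moment: "k \<le> n \<Longrightarrow> (\<integral>\<^sup>+\<omega>. ennreal ((R k \<omega>)\<^sup>2) \<partial>M) \<le> ennreal (2 * (real k * \<delta>))"
proof (induction k)
  case (Suc k)
  then have k: "k < n" by simp
  have Rk [measurable]: "R k \<in> borel_measurable (past k)" by simp
  have RM [measurable]: "R k \<in> borel_measurable M" using k by (intro R_rv) simp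
  have hm: "(\<lambda>(\<omega>, y). ennreal ((R k \<omega> - y)\<^sup>2)) \<in> borel_measurable (past k \<Otimes>\<^sub>M borel)" by measurable
  have "(\<integral>\<^sup>+\<omega>. ennreal ((R (Suc k) \<omega>)\<^sup>2) \<partial>M) \<le> (\<integral>\<^sup>+\<omega>. ennreal ((R k \<omega> - \<xi> k \<omega>)\<^sup>2) \<partial>M)"
    by (intro nn_integral_mono ennreal_leI) (auto simp: R_Suc max_def)
  also have "\<dots> = (\<integral>\<^sup>+\<omega>. \<integral>\<^sup>+y. ennreal ((R k \<omega> - y)\<^sup>2) \<partial>gauss \<delta> \<partial>M)" by (rule nn_integral_step[OF k hm])
  also have "\<dots> = (\<integral>\<^sup>+\<omega>. ennreal ((R k \<omega>)\<^sup>2) + ennreal (2 * \<delta>) \<partial>M)"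
    unfolding nn_integral_gauss_sq_shift using delta_pos by simp
  also have "\<dots> = (\<integral>\<^sup>+\<omega>. ennreal ((R k \<omega>)\<^sup>2) \<partial>M) + ennreal (2 * \<delta>)"
    by (subst nn_integral_add) (auto simp: emeasure_space_1)
  also have "\<dots> \<le> ennreal (2 * (real k * \<delta>)) + ennreal (2 * \<delta>)" using Suc by (intro add_right_mono) auto
  also have "\<dots> = ennreal (2 * (real (Suc k) * \<delta>))"
    using delta_pos by (simp add: distrib_right distrib_left add.commute flip: ennreal_plus)
  finally show ?case .
qed simp

lemma S_second_moment: "k \<le> n \<Longrightarrow> (\<integral>\<^sup>+\<omega>. ennreal ((S k \<omega>)\<^sup>2) \<partial>M) \<le> ennreal (2 * (real k * \<delta>))"
proof (induction k)
  case (Suc k)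
  then have k: "k < n" by simp
  have [measurable]: "S k \<in> borel_measurable (past k)" by simp
  have [measurable]: "S k \<in> borel_measurable M" using k by (intro S_rv) simp
  have hm: "(\<lambda>(\<omega>, y). ennreal ((- S k \<omega> - y)\<^sup>2)) \<in> borel_measurable (past k \<Otimes>\<^sub>M borel)" by measurable
  have eq: "(S (Suc k) \<omega>)\<^sup>2 = (- S k \<omega> - \<xi> k \<omega>)\<^sup>2" for \<omega> by (simp add: S_Suc power2_eq_square algebra_simps)
  have "(\<integral>\<^sup>+\<omega>. ennreal ((S (Suc k) \<omega>)\<^sup>2) \<partial>M) = (\<integral>\<^sup>+\<omega>. \<integral>\<^sup>+y. ennreal ((- S k \<omega> - y)\<^sup>2) \<partial>gauss \<delta> \<partial>M)"
    unfolding eq by (rule nn_integral_step[OF k hm])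
  also have "\<dots> = (\<integral>\<^sup>+\<omega>. ennreal ((S k \<omega>)\<^sup>2) + ennreal (2 * \<delta>) \<partial>M)"
    unfolding nn_integral_gauss_sq_shift using delta_pos by simp
  also have "\<dots> = (\<integral>\<^sup>+\<omega>. ennreal ((S k \<omega>)\<^sup>2) \<partial>M) + ennreal (2 * \<delta>)"
    by (subst nn_integral_add) (auto simp: emeasure_space_1)
  also have "\<dots> \<le> ennreal (2 * (real k * \<delta>)) + ennreal (2 * \<delta>)" using Suc by (intro add_right_mono) auto
  also have "\<dots> = ennreal (2 * (real (Suc k) * \<delta>))"
    using delta_pos by (simp add: distrib_right distrib_left add.commute flip: ennreal_plus)
  finally show ?case .
qed simp

lemma Smax_mean: 
  assumes k: "k \<le> n" shows "(\<integral>\<^sup>+\<omega>. ennreal (Smax k \<omega>) \<partial>M) \<le> ennreal (1 + 2 * (real k * \<delta>))"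
proof -
  have [measurable]: "S k \<in> borel_measurable M" "R k \<in> borel_measurable M" using k by (auto intro: S_rv R_rv)
  have b: "Smax k \<omega> \<le> 1 + (1 / 2) * (R k \<omega>)\<^sup>2 + (1 / 2) * (S k \<omega>)\<^sup>2" for \<omega>
  proof -
    have "0 \<le> (R k \<omega> - 1)\<^sup>2" "0 \<le> (S k \<omega> - 1)\<^sup>2" by simp_all
    then have "2 * R k \<omega> \<le> (R k \<omega>)\<^sup>2 + 1" "2 * S k \<omega> \<le> (S k \<omega>)\<^sup>2 + 1" by (simp_all add: power2_diff)
    moreover have "Smax k \<omega> = R k \<omega> + S k \<omega>" by (simp add: R_def)
    ultimately show ?thesis by linarith
  qed
  define h :: real where "h = 1 / 2"
  have h: "0 \<le> h" by (simp add: h_def)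
  have eq: "ennreal (1 + h * u + h * v) = 1 + ennreal h * ennreal u + ennreal h * ennreal v" if "0 \<le> u" "0 \<le> v" for u v
  proof -
    have "ennreal (1 + h * u + h * v) = ennreal 1 + ennreal (h * u) + ennreal (h * v)"
      using that h by (simp only: ennreal_plus[symmetric] add_nonneg_nonneg mult_nonneg_nonneg zero_le_one)
    then show ?thesis using that h by (simp only: ennreal_mult ennreal_1)
  qed
  have "(\<integral>\<^sup>+\<omega>. ennreal (Smax k \<omega>) \<partial>M) \<le> (\<integral>\<^sup>+\<omega>. 1 + ennreal h * ennreal ((R k \<omega>)\<^sup>2) + ennreal h * ennreal ((S k \<omega>)\<^sup>2) \<partial>M)"
  proof (rule nn_integral_mono)
    fix \<omega>
    show "ennreal (Smax k \<omega>) \<le> 1 + ennreal h * ennreal ((R k \<omega>)\<^sup>2) + ennreal h * ennreal ((S k \<omega>)\<^sup>2)"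
      unfolding eq[OF zero_le_power2 zero_le_power2, symmetric] using b[of \<omega>] unfolding h_def by (rule ennreal_leI)
  qed
  also have "\<dots> = 1 + ennreal h * (\<integral>\<^sup>+\<omega>. ennreal ((R k \<omega>)\<^sup>2) \<partial>M) + ennreal h * (\<integral>\<^sup>+\<omega>. ennreal ((S k \<omega>)\<^sup>2) \<partial>M)"
    by (simp add: nn_integral_add nn_integral_cmult emeasure_space_1)
  also have "\<dots> \<le> 1 + ennreal h * ennreal (2 * (real k * \<delta>)) + ennreal h * ennreal (2 * (real k * \<delta>))"
    by (intro add_mono mult_left_mono R_second_moment S_second_moment k) auto
  also have "\<dots> = ennreal (1 + h * (2 * (real k * \<delta>)) + h * (2 * (real k * \<delta>)))"
    by (rule eq[symmetric]) (use delta_pos in auto)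
  also have "1 + h * (2 * (real k * \<delta>)) + h * (2 * (real k * \<delta>)) = 1 + 2 * (real k * \<delta>)"
    by (simp add: h_def)
  finally show ?thesis .
qed

text \<open>A bound on expectations only, needed to control the martingale in \<open>occupation_vs_maximum\<close>. With the
  trapezoid \<open>(- e, 0, 2e, 3e)\<close>, which equals \<open>1\<close> on \<open>[0, 2e]\<close>, the process \<open>F(R) + 3 e Smax\<close> gains in
  one step at least \<open>\<delta>\<close> times the probability of being in \<open>[0, 2e]\<close>, up to the error of \<open>F_mean\<close>; its
  expectation is bounded by \<open>Smax_mean\<close>.\<close>

lemma occupation_near_zero:
  assumes e: "0 < e" and k: "k \<le> n"
  shows "\<delta> * (\<Sum>j<k. prob {\<omega> \<in> space M. R j \<omega> \<le> 2 * e})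
    \<le> 9 * e\<^sup>2 + 3 * e * (1 + 2 * (real k * \<delta>)) + real k * (5 * (\<delta> * sqrt \<delta>) / e)"
proof -
  interpret T: trapezoid "- e" 0 "2 * e" "3 * e" e by unfold_locales (use e in auto)
  have TD: "T.D = 3 * e" by (simp add: T.D_def)
  define err where "err = 5 * (\<delta> * sqrt \<delta>) / e"
  have err: "0 \<le> err" using delta_pos e by (simp add: err_def)
  define H where "H = (\<lambda>k \<omega>. T.F (R k \<omega>) + 3 * e * Smax k \<omega>)"
  define P where "P = (\<lambda>j. prob {\<omega> \<in> space M. R j \<omega> \<le> 2 * e})"
  have H0: "0 \<le> H k \<omega>" for k \<omega> using e T.F_nonneg Smax_nonneg by (auto simp: H_def)
  have ind: "k \<le> n \<Longrightarrow> ennreal (\<delta> * (\<Sum>j<k. P j)) \<le> (\<integral>\<^sup>+\<omega>. ennreal (H k \<omega>) \<partial>M) + ennreal (real k * err)" for k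
  proof (induction k)
    case (Suc k)
    then have k: "k < n" by simp
    have [measurable]: "R k \<in> borel_measurable (past k)" "Smax k \<in> borel_measurable (past k)" by auto
    have [measurable]: "R k \<in> borel_measurable M" "Smax k \<in> borel_measurable M" "R (Suc k) \<in> borel_measurable M" "Smax (Suc k) \<in> borel_measurable M"
      using k by (auto intro!: R_rv Smax_rv)
    have [measurable]: "H k \<in> borel_measurable M" "H (Suc k) \<in> borel_measurable M" unfolding H_def by measurable
    let ?h = "\<lambda>\<omega> y. ennreal (T.F (R k \<omega> - y) + (3 * e * Smax k \<omega> + err))"
    have hm: "(\<lambda>(\<omega>, y). ?h \<omega> y) \<in> borel_measurable (past k \<Otimes>\<^sub>M borel)" by measurable
    have "(\<integral>\<^sup>+\<omega>. ennreal (H k \<omega>) \<partial>M) + ennreal (\<delta> * P k) = (\<integral>\<^sup>+\<omega>. ennreal (H k \<omega>) + ennreal \<delta> * indicator {\<omega> \<in> space M. R k \<omega> \<le> 2 * e} \<omega> \<partial>M)"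
      using delta_pos by (subst nn_integral_add) (auto simp: nn_integral_cmult_indicator emeasure_eq_measure P_def ennreal_mult')
    also have "\<dots> \<le> (\<integral>\<^sup>+\<omega>. \<integral>\<^sup>+y. ?h \<omega> y \<partial>gauss \<delta> \<partial>M)"
    proof (rule nn_integral_mono)
      fix \<omega>
      have i: "integrable (gauss \<delta>) (\<lambda>y. T.F (R k \<omega> - y) + (3 * e * Smax k \<omega> + err))"
        using T.F_increment_moments(2)[OF delta_pos] by auto
      have nn: "0 \<le> T.F (R k \<omega> - y) + (3 * e * Smax k \<omega> + err)" for y
        using T.F_nonneg Smax_nonneg[of k \<omega>] e err by (intro add_nonneg_nonneg mult_nonneg_nonneg) auto
      have "H k \<omega> + \<delta> * indicator {\<omega> \<in> space M. R k \<omega> \<le> 2 * e} \<omega> \<le> H k \<omega> + \<delta> * T.\<psi> (R k \<omega>)"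
        using delta_pos R_nonneg[of k \<omega>] T.psi_eq_1[of "R k \<omega>"] T.psi_bounds[of "R k \<omega>"] by (auto split: split_indicator)
      also have "\<dots> \<le> (\<integral>y. T.F (R k \<omega> - y) \<partial>gauss \<delta>) + (3 * e * Smax k \<omega> + err)"
        using T.F_mean[OF delta_pos, of "R k \<omega>"] by (simp add: H_def err_def)
      also have "\<dots> = (\<integral>y. T.F (R k \<omega> - y) + (3 * e * Smax k \<omega> + err) \<partial>gauss \<delta>)"
        using T.F_increment_moments(2)[OF delta_pos] by simp
      finally have "ennreal (H k \<omega> + \<delta> * indicator {\<omega> \<in> space M. R k \<omega> \<le> 2 * e} \<omega>) \<le> (\<integral>\<^sup>+y. ?h \<omega> y \<partial>gauss \<delta>)"
        using nn_integral_eq_integral[OF i] nn by (simp add: ennreal_leI)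
      moreover have "ennreal (H k \<omega> + \<delta> * indicator {\<omega> \<in> space M. R k \<omega> \<le> 2 * e} \<omega>) = ennreal (H k \<omega>) + ennreal \<delta> * indicator {\<omega> \<in> space M. R k \<omega> \<le> 2 * e} \<omega>"
        using H0 delta_pos by (auto split: split_indicator)
      ultimately show "ennreal (H k \<omega>) + ennreal \<delta> * indicator {\<omega> \<in> space M. R k \<omega> \<le> 2 * e} \<omega> \<le> (\<integral>\<^sup>+y. ?h \<omega> y \<partial>gauss \<delta>)" by simp
    qed
    also have "\<dots> = (\<integral>\<^sup>+\<omega>. ?h \<omega> (\<xi> k \<omega>) \<partial>M)" by (rule nn_integral_step[OF k hm, symmetric])
    also have "\<dots> \<le> (\<integral>\<^sup>+\<omega>. ennreal (H (Suc k) \<omega>) + ennreal err \<partial>M)"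
    proof (rule nn_integral_mono)
      fix \<omega>
      have "T.F (R k \<omega> - \<xi> k \<omega>) \<le> T.F (R (Suc k) \<omega>) + 3 * e * max 0 (\<xi> k \<omega> - R k \<omega>)"
        using T.F_lipschitz[of "R k \<omega> - \<xi> k \<omega>" "R (Suc k) \<omega>"] e unfolding TD R_Suc by (auto simp: max_def split: if_splits)
      then have "T.F (R k \<omega> - \<xi> k \<omega>) + (3 * e * Smax k \<omega> + err) \<le> H (Suc k) \<omega> + err"
        by (simp add: H_def Smax_Suc distrib_left)
      then show "?h \<omega> (\<xi> k \<omega>) \<le> ennreal (H (Suc k) \<omega>) + ennreal err"
        using H0 err by (simp flip: ennreal_plus)
    qed
    also have "\<dots> = (\<integral>\<^sup>+\<omega>. ennreal (H (Suc k) \<omega>) \<partial>M) + ennreal err"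
      by (subst nn_integral_add) (auto simp: emeasure_space_1)
    finally have step: "(\<integral>\<^sup>+\<omega>. ennreal (H k \<omega>) \<partial>M) + ennreal (\<delta> * P k) \<le> (\<integral>\<^sup>+\<omega>. ennreal (H (Suc k) \<omega>) \<partial>M) + ennreal err" .
    have "ennreal (\<delta> * (\<Sum>j<Suc k. P j)) = ennreal (\<delta> * (\<Sum>j<k. P j)) + ennreal (\<delta> * P k)"
      using delta_pos by (subst ennreal_plus[symmetric]) (auto simp: P_def distrib_left intro!: sum_nonneg mult_nonneg_nonneg)
    also have "\<dots> \<le> (\<integral>\<^sup>+\<omega>. ennreal (H k \<omega>) \<partial>M) + ennreal (real k * err) + ennreal (\<delta> * P k)"
      using Suc by (intro add_right_mono) auto
    also have "\<dots> = ((\<integral>\<^sup>+\<omega>. ennreal (H k \<omega>) \<partial>M) + ennreal (\<delta> * P k)) + ennreal (real k * err)" by (simp add: ac_simps)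
    also have "\<dots> \<le> (\<integral>\<^sup>+\<omega>. ennreal (H (Suc k) \<omega>) \<partial>M) + ennreal err + ennreal (real k * err)"
      using step by (intro add_right_mono)
    also have "\<dots> = (\<integral>\<^sup>+\<omega>. ennreal (H (Suc k) \<omega>) \<partial>M) + ennreal (real (Suc k) * err)"
      using err by (simp add: add.assoc distrib_right flip: ennreal_plus)
    finally show ?case .
  qed simp
  have [measurable]: "Smax k \<in> borel_measurable M" using k by (rule Smax_rv)
  have "(\<integral>\<^sup>+\<omega>. ennreal (H k \<omega>) \<partial>M) \<le> (\<integral>\<^sup>+\<omega>. ennreal (9 * e\<^sup>2) + ennreal (3 * e) * ennreal (Smax k \<omega>) \<partial>M)"
  proof (rule nn_integral_mono)
    fix \<omega>
    have "T.F (R k \<omega>) \<le> T.F 0" by (rule T.F_antimono) (rule R_nonneg)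
    also have "T.F 0 \<le> 9 * e\<^sup>2" using T.F_le[of 0] e by (simp add: TD power2_eq_square)
    finally have "H k \<omega> \<le> 9 * e\<^sup>2 + 3 * e * Smax k \<omega>" by (simp add: H_def)
    then show "ennreal (H k \<omega>) \<le> ennreal (9 * e\<^sup>2) + ennreal (3 * e) * ennreal (Smax k \<omega>)"
      using e Smax_nonneg by (simp add: ennreal_mult'[symmetric] ennreal_plus[symmetric] ennreal_leI del: ennreal_plus)
  qed
  also have "\<dots> = ennreal (9 * e\<^sup>2) + ennreal (3 * e) * (\<integral>\<^sup>+\<omega>. ennreal (Smax k \<omega>) \<partial>M)"
    by (simp add: nn_integral_add nn_integral_cmult emeasure_space_1)
  also have "\<dots> \<le> ennreal (9 * e\<^sup>2) + ennreal (3 * e) * ennreal (1 + 2 * (real k * \<delta>))"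
    by (intro add_left_mono mult_left_mono Smax_mean k) auto
  finally have "(\<integral>\<^sup>+\<omega>. ennreal (H k \<omega>) \<partial>M) + ennreal (real k * err) \<le> ennreal (9 * e\<^sup>2) + ennreal (3 * e) * ennreal (1 + 2 * (real k * \<delta>)) + ennreal (real k * err)"
    by (rule add_right_mono)
  also have "\<dots> = ennreal (9 * e\<^sup>2 + 3 * e * (1 + 2 * (real k * \<delta>)) + real k * err)"
    using e delta_pos err by (simp add: ennreal_mult'[symmetric] ennreal_plus[symmetric] del: ennreal_plus)
  finally have "ennreal (\<delta> * (\<Sum>j<k. P j)) \<le> ennreal (9 * e\<^sup>2 + 3 * e * (1 + 2 * (real k * \<delta>)) + real k * err)"
    using ind[OF k] by (rule order_trans[rotated])
  then show ?thesis
    using e delta_pos err by (subst (asm) ennreal_le_iff) (auto simp: P_def err_def intro!: add_nonneg_nonneg mult_nonneg_nonneg)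
qed

text \<open>The discrete Tanaka formula. Since \<open>F\<close> is linear with slope \<open>- D\<close> on the negative axis, the reflection
  at \<open>0\<close> changes \<open>F\<close> exactly by \<open>D\<close> times the increase of the maximum, so that \<open>D Smax\<close> minus the smoothed
  occupation time is a martingale \<open>A\<close> plus small terms. The increments of \<open>A\<close> are of size \<open>\<delta>\<close> in mean square
  while the walk is below \<open>2 e\<close> and negligible above. As the time below \<open>2 e\<close> is of order \<open>e\<close>, Chebyshev's
  inequality gives a deviation of smaller order than \<open>D\<close>.\<close>

lemma occupation_vs_maximum:
  assumes T: "trapezoid a b c d w" and a: "0 \<le> a" and g: "0 < g" and e: "d + g \<le> 2 * e" and k: "k \<le> n" and x: "0 < x"
  defines "Z \<equiv> \<lambda>\<omega>. \<bar>trapezoid.D b d * Smax k \<omega> - \<delta> * (\<Sum>j<k. trapezoid.\<psi> a b c d w (R j \<omega>))\<bar>"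
  defines "B \<equiv> (\<Sum>j<k. (trapezoid.D b d)\<^sup>2 * (2 * \<delta> * prob {\<omega> \<in> space M. R j \<omega> \<le> 2 * e} + 12 * \<delta>\<^sup>2 / g\<^sup>2))"
  shows "{\<omega> \<in> space M. x + trapezoid.D b d * d + real k * (5 * (\<delta> * sqrt \<delta>) / w) \<le> Z \<omega>} \<in> events"
    and "prob {\<omega> \<in> space M. x + trapezoid.D b d * d + real k * (5 * (\<delta> * sqrt \<delta>) / w) \<le> Z \<omega>} \<le> B / x\<^sup>2"
proof -
  interpret T: trapezoid a b c d w by (rule T)
  define \<mu> where "\<mu> = (\<lambda>r. \<integral>y. T.F (r - y) \<partial>gauss \<delta>)"
  define A where "A = (\<lambda>k \<omega>. \<Sum>j<k. T.F (R j \<omega> - \<xi> j \<omega>) - \<mu> (R j \<omega>))"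
  define err where "err = 5 * (\<delta> * sqrt \<delta>) / w"
  define P where "P = (\<lambda>j. prob {\<omega> \<in> space M. R j \<omega> \<le> 2 * e})"
  define V where "V = (\<lambda>r. T.D\<^sup>2 * (2 * \<delta> * indicator {..2 * e} r + 12 * \<delta>\<^sup>2 / g\<^sup>2))"
  have [measurable]: "\<mu> \<in> borel_measurable borel" unfolding \<mu>_def
    by (rule gauss.borel_measurable_lebesgue_integral) measurable
  have A_past: "A j \<in> borel_measurable (past j)" for j
    unfolding A_def
  proof (rule borel_measurable_sum)
    fix i assume "i \<in> {..<j}"
    then have [measurable]: "R i \<in> borel_measurable (past j)" "\<xi> i \<in> borel_measurable (past j)" by (auto intro: xi_past R_past)
    show "(\<lambda>\<omega>. T.F (R i \<omega> - \<xi> i \<omega>) - \<mu> (R i \<omega>)) \<in> borel_measurable (past j)" by measurable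
  qed
  have V0: "0 \<le> V r" for r using delta_pos by (auto simp: V_def)
  have V: "(\<integral>y. (T.F (r - y) - T.F r)\<^sup>2 \<partial>gauss \<delta>) \<le> V r" for r
  proof (cases "r \<le> 2 * e")
    case True
    have "T.D\<^sup>2 * (2 * \<delta>) \<le> V r" using True by (simp add: V_def distrib_left)
    then show ?thesis using T.F_increment_moments(3)[OF delta_pos, of r] by linarith
  next
    case False
    have "T.D\<^sup>2 * (12 * \<delta>\<^sup>2 / g\<^sup>2) = V r" using False by (simp add: V_def)
    then show ?thesis using T.F_increment_moments(4)[OF delta_pos g, of r] False e by linarith
  qed
  have inner: "(\<integral>\<^sup>+y. ennreal ((\<alpha> + (T.F (r - y) - \<mu> r))\<^sup>2) \<partial>gauss \<delta>) \<le> ennreal (\<alpha>\<^sup>2 + V r)" for \<alpha> r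
  proof -
    define u where "u = (\<lambda>y. T.F (r - y) - T.F r)"
    define m where "m = \<mu> r - T.F r"
    have iu: "integrable (gauss \<delta>) u" "integrable (gauss \<delta>) (\<lambda>y. (u y)\<^sup>2)"
      unfolding u_def using T.F_increment_moments(1,2)[OF delta_pos] by auto
    have mu: "(\<integral>y. u y \<partial>gauss \<delta>) = m"
      unfolding u_def m_def \<mu>_def using T.F_increment_moments(2)[OF delta_pos] by simp
    have eq: "(\<alpha> + (T.F (r - y) - \<mu> r))\<^sup>2 = (\<alpha> - m)\<^sup>2 + 2 * (\<alpha> - m) * u y + (u y)\<^sup>2" for y
      by (simp add: u_def m_def power2_eq_square algebra_simps)
    have i: "integrable (gauss \<delta>) (\<lambda>y. (\<alpha> + (T.F (r - y) - \<mu> r))\<^sup>2)"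
      unfolding eq using iu by auto
    have "(\<integral>y. (\<alpha> + (T.F (r - y) - \<mu> r))\<^sup>2 \<partial>gauss \<delta>) = (\<alpha> - m)\<^sup>2 + 2 * (\<alpha> - m) * m + (\<integral>y. (u y)\<^sup>2 \<partial>gauss \<delta>)"
      unfolding eq using iu mu by simp
    also have "\<dots> = \<alpha>\<^sup>2 - m\<^sup>2 + (\<integral>y. (u y)\<^sup>2 \<partial>gauss \<delta>)"
      by (simp add: power2_eq_square algebra_simps)
    also have "\<dots> \<le> \<alpha>\<^sup>2 + V r" using V[of r] zero_le_power2[of m] unfolding u_def by linarith
    finally show ?thesis using nn_integral_eq_integral[OF i] by (simp add: ennreal_leI)
  qed
  have ind: "k \<le> n \<Longrightarrow> (\<integral>\<^sup>+\<omega>. ennreal ((A k \<omega>)\<^sup>2) \<partial>M) \<le> ennreal (\<Sum>j<k. T.D\<^sup>2 * (2 * \<delta> * P j + 12 * \<delta>\<^sup>2 / g\<^sup>2))" for k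
  proof (induction k)
    case 0
    then show ?case by (simp add: A_def)
  next
    case (Suc k)
    then have k: "k < n" by simp
    have [measurable]: "R k \<in> borel_measurable (past k)" "A k \<in> borel_measurable (past k)" using A_past by auto
    have [measurable]: "R k \<in> borel_measurable M" "A k \<in> borel_measurable M"
      using k by (auto intro!: R_rv measurable_past[OF _ A_past])
    let ?h = "\<lambda>\<omega> y. ennreal ((A k \<omega> + (T.F (R k \<omega> - y) - \<mu> (R k \<omega>)))\<^sup>2)"
    have hm: "(\<lambda>(\<omega>, y). ?h \<omega> y) \<in> borel_measurable (past k \<Otimes>\<^sub>M borel)" by measurable
    have "(\<integral>\<^sup>+\<omega>. ennreal ((A (Suc k) \<omega>)\<^sup>2) \<partial>M) = (\<integral>\<^sup>+\<omega>. \<integral>\<^sup>+y. ?h \<omega> y \<partial>gauss \<delta> \<partial>M)"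
      using nn_integral_step[OF k hm] by (simp add: A_def)
    also have "\<dots> \<le> (\<integral>\<^sup>+\<omega>. ennreal ((A k \<omega>)\<^sup>2) + (ennreal (T.D\<^sup>2 * (2 * \<delta>)) * indicator {\<omega> \<in> space M. R k \<omega> \<le> 2 * e} \<omega> + ennreal (T.D\<^sup>2 * (12 * \<delta>\<^sup>2 / g\<^sup>2))) \<partial>M)"
    proof (rule nn_integral_mono)
      fix \<omega> assume \<omega>: "\<omega> \<in> space M"
      have "(\<integral>\<^sup>+y. ?h \<omega> y \<partial>gauss \<delta>) \<le> ennreal ((A k \<omega>)\<^sup>2 + V (R k \<omega>))" by (rule inner)
      also have "\<dots> = ennreal ((A k \<omega>)\<^sup>2) + (ennreal (T.D\<^sup>2 * (2 * \<delta>)) * indicator {\<omega> \<in> space M. R k \<omega> \<le> 2 * e} \<omega> + ennreal (T.D\<^sup>2 * (12 * \<delta>\<^sup>2 / g\<^sup>2)))"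
        using \<omega> delta_pos by (auto simp: V_def distrib_left split: split_indicator)
      finally show "(\<integral>\<^sup>+y. ?h \<omega> y \<partial>gauss \<delta>) \<le> ennreal ((A k \<omega>)\<^sup>2) + (ennreal (T.D\<^sup>2 * (2 * \<delta>)) * indicator {\<omega> \<in> space M. R k \<omega> \<le> 2 * e} \<omega> + ennreal (T.D\<^sup>2 * (12 * \<delta>\<^sup>2 / g\<^sup>2)))" .
    qed
    also have "\<dots> = (\<integral>\<^sup>+\<omega>. ennreal ((A k \<omega>)\<^sup>2) \<partial>M) + (ennreal (T.D\<^sup>2 * (2 * \<delta>)) * emeasure M {\<omega> \<in> space M. R k \<omega> \<le> 2 * e} + ennreal (T.D\<^sup>2 * (12 * \<delta>\<^sup>2 / g\<^sup>2)))"
      by (simp add: nn_integral_add nn_integral_cmult_indicator emeasure_space_1)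
    also have "\<dots> = (\<integral>\<^sup>+\<omega>. ennreal ((A k \<omega>)\<^sup>2) \<partial>M) + ennreal (T.D\<^sup>2 * (2 * \<delta> * P k + 12 * \<delta>\<^sup>2 / g\<^sup>2))"
      using delta_pos by (simp add: P_def emeasure_eq_measure distrib_left ennreal_plus[symmetric] ennreal_mult'[symmetric] mult_ac del: ennreal_plus)
    also have "\<dots> \<le> ennreal (\<Sum>j<k. T.D\<^sup>2 * (2 * \<delta> * P j + 12 * \<delta>\<^sup>2 / g\<^sup>2)) + ennreal (T.D\<^sup>2 * (2 * \<delta> * P k + 12 * \<delta>\<^sup>2 / g\<^sup>2))"
      using Suc by (intro add_right_mono) auto
    also have "\<dots> = ennreal (\<Sum>j<Suc k. T.D\<^sup>2 * (2 * \<delta> * P j + 12 * \<delta>\<^sup>2 / g\<^sup>2))"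
      using delta_pos by (subst ennreal_plus[symmetric]) (auto simp: P_def intro!: sum_nonneg)
    finally show ?case .
  qed
  have path: "T.D * Smax k \<omega> - \<delta> * (\<Sum>j<k. T.\<psi> (R j \<omega>)) = T.F 0 - T.F (R k \<omega>) + A k \<omega> + (\<Sum>j<k. \<mu> (R j \<omega>) - T.F (R j \<omega>) - \<delta> * T.\<psi> (R j \<omega>))" for k \<omega>
  proof (induction k)
    case 0
    then show ?case by (simp add: A_def)
  next
    case (Suc k)
    have "T.F (R (Suc k) \<omega>) + T.D * max 0 (\<xi> k \<omega> - R k \<omega>) = T.F (R k \<omega> - \<xi> k \<omega>)"
    proof (cases "0 \<le> R k \<omega> - \<xi> k \<omega>")
      case True
      then show ?thesis by (simp add: R_Suc max_def)
    next
      case False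
      then have "T.F (R k \<omega> - \<xi> k \<omega>) = T.F 0 + T.D * (\<xi> k \<omega> - R k \<omega>)"
        using a T.F_linear[of "R k \<omega> - \<xi> k \<omega>"] T.F_linear[of 0] by (simp add: algebra_simps)
      then show ?thesis using False by (simp add: R_Suc max_def)
    qed
    then show ?case using Suc by (simp add: Smax_Suc A_def algebra_simps)
  qed
  have Zle: "Z \<omega> \<le> \<bar>A k \<omega>\<bar> + T.D * d + real k * err" for \<omega>
  proof -
    have d0: "0 \<le> d" using a T.w by linarith
    have "T.F 0 \<le> T.D * d" using T.F_le[of 0] d0 by simp
    moreover have "T.F (R k \<omega>) \<le> T.F 0" by (rule T.F_antimono) (rule R_nonneg)
    moreover have "0 \<le> T.F (R k \<omega>)" by (rule T.F_nonneg)
    moreover have "\<bar>\<Sum>j<k. \<mu> (R j \<omega>) - T.F (R j \<omega>) - \<delta> * T.\<psi> (R j \<omega>)\<bar> \<le> (\<Sum>j<k. err)"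
      by (rule sum_abs[THEN order_trans], rule sum_mono) (use T.F_mean[OF delta_pos] in \<open>simp add: \<mu>_def err_def\<close>)
    ultimately show ?thesis unfolding Z_def path by simp
  qed
  have [measurable]: "Smax k \<in> borel_measurable M" using k by (rule Smax_rv)
  have [measurable]: "(\<lambda>\<omega>. \<Sum>j<k. T.\<psi> (R j \<omega>)) \<in> borel_measurable M"
  proof (rule borel_measurable_sum)
    fix j assume "j \<in> {..<k}"
    then have [measurable]: "R j \<in> borel_measurable M" using k by (intro R_rv) auto
    show "(\<lambda>\<omega>. T.\<psi> (R j \<omega>)) \<in> borel_measurable M" by measurable
  qed
  have [measurable]: "Z \<in> borel_measurable M" unfolding Z_def by measurable
  let ?E = "{\<omega> \<in> space M. x + T.D * d + real k * (5 * (\<delta> * sqrt \<delta>) / w) \<le> Z \<omega>}"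
  show E: "?E \<in> events" by measurable
  have [measurable]: "A k \<in> borel_measurable M" by (rule measurable_past[OF k A_past])
  have B0: "0 \<le> B" unfolding B_def using delta_pos by (auto intro!: sum_nonneg)
  have "ennreal (x\<^sup>2) * emeasure M ?E = (\<integral>\<^sup>+\<omega>. ennreal (x\<^sup>2) * indicator ?E \<omega> \<partial>M)"
    using E by (simp add: nn_integral_cmult_indicator)
  also have "\<dots> \<le> (\<integral>\<^sup>+\<omega>. ennreal ((A k \<omega>)\<^sup>2) \<partial>M)"
  proof (rule nn_integral_mono)
    fix \<omega>
    have "x\<^sup>2 \<le> (A k \<omega>)\<^sup>2" if "\<omega> \<in> ?E"
    proof -
      have "x \<le> \<bar>A k \<omega>\<bar>" using that Zle[of \<omega>] by (simp add: err_def)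
      then have "x\<^sup>2 \<le> \<bar>A k \<omega>\<bar>\<^sup>2" using x by (intro power_mono) auto
      then show ?thesis by simp
    qed
    then show "ennreal (x\<^sup>2) * indicator ?E \<omega> \<le> ennreal ((A k \<omega>)\<^sup>2)"
      by (auto split: split_indicator intro!: ennreal_leI)
  qed
  also have "\<dots> \<le> ennreal B" using ind[OF k] unfolding B_def P_def .
  finally have "x\<^sup>2 * prob ?E \<le> B"
    using B0 by (simp add: emeasure_eq_measure flip: ennreal_mult')
  then show "prob ?E \<le> B / x\<^sup>2" using x by (simp add: field_simps)
qed

end

section \<open>The random walks inside the process\<close>

lemma (in prob_space) indep_sets_reindex:
  assumes inj: "inj_on h I" and ind: "indep_sets F (h ` I)"
  shows "indep_sets (\<lambda>i. F (h i)) I"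
  unfolding indep_sets_def
proof (intro conjI ballI allI impI)
  show "F (h i) \<subseteq> events" if "i \<in> I" for i using ind that by (auto simp: indep_sets_def)
  fix J A assume J: "J \<subseteq> I" "J \<noteq> {}" "finite J" and A: "A \<in> (\<Pi> i\<in>J. F (h i))"
  have injJ: "inj_on h J" using inj J(1) by (rule inj_on_subset)
  define B where "B = (\<lambda>i. A (inv_into J h i))"
  have BA: "B (h j) = A j" if "j \<in> J" for j using injJ that by (simp add: B_def)
  have "B \<in> Pi (h ` J) F" using A BA by auto
  moreover have "h ` J \<subseteq> h ` I" "h ` J \<noteq> {}" "finite (h ` J)" using J by auto
  ultimately have "prob (\<Inter>j\<in>h ` J. B j) = (\<Prod>j\<in>h ` J. prob (B j))"
    using ind unfolding indep_sets_def by blast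
  moreover have "(\<Inter>j\<in>h ` J. B j) = (\<Inter>j\<in>J. A j)" using BA by auto
  moreover have "(\<Prod>j\<in>h ` J. prob (B j)) = (\<Prod>j\<in>J. prob (A j))"
    using BA by (simp add: prod.reindex[OF injJ])
  ultimately show "prob (\<Inter>j\<in>J. A j) = (\<Prod>j\<in>J. prob (A j))" by simp
qed

lemma (in prob_space) indep_vars_reindex_inj:
  assumes inj: "inj_on h I" and ind: "indep_vars N Y (h ` I)"
  shows "indep_vars (\<lambda>i. N (h i)) (\<lambda>i. Y (h i)) I"
proof -
  have 1: "indep_sets (\<lambda>i. {Y i -` A \<inter> space M | A. A \<in> sets (N i)}) (h ` I)"
    and 2: "\<forall>i\<in>h ` I. Y i \<in> M \<rightarrow>\<^sub>M N i"
    using ind unfolding indep_vars_def2 by blast+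
  show ?thesis unfolding indep_vars_def2 using indep_sets_reindex[OF inj 1] 2 by blast
qed

lemma (in prob_space) borel_cantelli_bound:
  assumes A: "\<And>n. A n \<in> events" and le: "\<forall>\<^sub>F n in sequentially. prob (A n) \<le> f n" and f: "summable f"
  shows "AE \<omega> in M. \<forall>\<^sub>F n in sequentially. \<omega> \<notin> A n"
proof -
  have "summable (\<lambda>n. prob (A n))"
    by (rule summable_comparison_test_ev[OF _ f]) (use le in \<open>auto elim: eventually_mono\<close>)
  then have "AE \<omega> in M. \<forall>\<^sub>F n in sequentially. \<omega> \<in> space M - A n"
    by (intro borel_cantelli_AE1 A) (auto simp: emeasure_eq_measure)
  then show ?thesis by (auto elim: eventually_mono)
qed

context stable2_levy_process
begin

lemma X_gauss:
  assumes "0 < t" shows "distr M borel (X t) = gauss t"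
proof (rule laplace_imp_gauss[OF _ _ assms])
  have X: "random_variable borel (X t)" using assms by (intro rv) simp
  show "prob_space (distr M borel (X t))" by (rule prob_space_distr[OF X])
  show "(\<integral>x. exp (- c * x) \<partial>distr M borel (X t)) = exp (t * c\<^sup>2)" if "0 \<le> c" for c
    using laplace[of t c] assms that by (subst integral_distr[OF X]) auto
qed simp

lemma increment_gauss:
  assumes "0 \<le> s" "0 < \<delta>" shows "distr M borel (\<lambda>\<omega>. X (s + \<delta>) \<omega> - X s \<omega>) = gauss \<delta>"
  unfolding stationary_increments[OF assms(1) less_imp_le[OF assms(2)]] by (rule X_gauss[OF assms(2)])

lemma forward_walk:
  assumes s: "0 \<le> s" and \<delta>: "0 < \<delta>"
  shows "gaussian_walk M (\<lambda>i \<omega>. X (s + real (Suc i) * \<delta>) \<omega> - X (s + real i * \<delta>) \<omega>) n \<delta>"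
proof
  let ?t = "\<lambda>i. s + real i * \<delta>"
  have "mono ?t" using \<delta> by (auto simp: mono_def mult_right_mono)
  then show "indep_vars (\<lambda>_. borel) (\<lambda>i \<omega>. X (?t (Suc i)) \<omega> - X (?t i) \<omega>) {..<n}"
    using s by (intro independent_increments[of ?t]) auto
  show "distr M borel (\<lambda>\<omega>. X (?t (Suc i)) \<omega> - X (?t i) \<omega>) = gauss \<delta>" for i
    using increment_gauss[of "?t i" \<delta>] s \<delta> by (simp add: algebra_simps)
qed (rule \<delta>)

text \<open>The time reversal. The increments are those of the forward grid from \<open>t - n \<delta>\<close>, listed backwards, and an
  injective reindexing keeps independence.\<close>

lemma backward_walk:
  assumes n: "real n * \<delta> \<le> t" and \<delta>: "0 < \<delta>"
  shows "gaussian_walk M (\<lambda>i \<omega>. X (t - real i * \<delta>) \<omega> - X (t - real (Suc i) * \<delta>) \<omega>) n \<delta>"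
proof
  let ?u = "\<lambda>i. (t - real n * \<delta>) + real i * \<delta>"
  let ?h = "\<lambda>i. n - Suc i"
  have "mono ?u" using \<delta> by (auto simp: mono_def mult_right_mono)
  then have ind: "indep_vars (\<lambda>_. borel) (\<lambda>i \<omega>. X (?u (Suc i)) \<omega> - X (?u i) \<omega>) {..<n}"
    using n by (intro independent_increments[of ?u]) auto
  have inj: "inj_on ?h {..<n}" by (auto simp: inj_on_def)
  have im: "?h ` {..<n} \<subseteq> {..<n}" by auto
  have "indep_vars (\<lambda>_. borel) (\<lambda>i \<omega>. X (?u (Suc (?h i))) \<omega> - X (?u (?h i)) \<omega>) {..<n}"
    using indep_vars_reindex_inj[OF inj indep_vars_subset[OF ind im]] .
  then show "indep_vars (\<lambda>_. borel) (\<lambda>i \<omega>. X (t - real i * \<delta>) \<omega> - X (t - real (Suc i) * \<delta>) \<omega>) {..<n}"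
  proof (rule indep_vars_cong[THEN iffD1, rotated -1])
    fix i assume "i \<in> {..<n}"
    then have e: "?u (Suc (?h i)) = t - real i * \<delta>" "?u (?h i) = t - real (Suc i) * \<delta>"
      by (auto simp: of_nat_diff algebra_simps Suc_diff_Suc)
    show "(\<lambda>\<omega>. X (?u (Suc (?h i))) \<omega> - X (?u (?h i)) \<omega>) = (\<lambda>\<omega>. X (t - real i * \<delta>) \<omega> - X (t - real (Suc i) * \<delta>) \<omega>)"
      unfolding e ..
  qed auto
  show "distr M borel (\<lambda>\<omega>. X (t - real i * \<delta>) \<omega> - X (t - real (Suc i) * \<delta>) \<omega>) = gauss \<delta>" if "i < n" for i
  proof -
    have "real (Suc i) * \<delta> \<le> real n * \<delta>" using that \<delta> by (intro mult_right_mono) auto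
    then have "0 \<le> t - real (Suc i) * \<delta>" using n by linarith
    from increment_gauss[OF this \<delta>] show ?thesis by (simp add: algebra_simps)
  qed
qed (rule \<delta>)

lemma forward_sum: "(\<Sum>i<k. X (s + real (Suc i) * \<delta>) \<omega> - X (s + real i * \<delta>) \<omega>) = X (s + real k * \<delta>) \<omega> - X s \<omega>"
  using sum_lessThan_telescope[of "\<lambda>i. X (s + real i * \<delta>) \<omega>" k] by simp

lemma backward_sum: "(\<Sum>i<k. X (t - real i * \<delta>) \<omega> - X (t - real (Suc i) * \<delta>) \<omega>) = X t \<omega> - X (t - real k * \<delta>) \<omega>"
  using sum_lessThan_telescope'[of "\<lambda>i. X (t - real i * \<delta>) \<omega>" k] by simp

text \<open>The supremum over an interval is the increasing limit of maxima over dyadic grids, by right continuity;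
  the bound \<open>maximal\<close> for the walk does not depend on the mesh.\<close>

lemma oscillation:
  assumes p: "0 \<le> p" and \<delta>: "0 < \<delta>" and a: "0 \<le> a"
  defines "E \<equiv> {\<omega> \<in> space M. \<exists>s\<in>{p..p + \<delta>}. a < \<bar>X s \<omega> - X p \<omega>\<bar>}"
  shows "E \<in> events" "prob E \<le> 2 * exp (- (a\<^sup>2 / (4 * \<delta>)))"
proof -
  define d where "d = (\<lambda>m::nat. \<delta> / 2 ^ m)"
  define F where "F = (\<lambda>m. {\<omega> \<in> space M. \<exists>j\<le>(2::nat) ^ m. a < \<bar>X (p + real j * d m) \<omega> - X p \<omega>\<bar>})"
  have d0: "0 < d m" "2 ^ m * d m = \<delta>" for m using \<delta> by (auto simp: d_def)
  have X: "X (p + real j * d m) \<in> borel_measurable M" "X p \<in> borel_measurable M" for j m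
    using p d0[of m] by (auto intro!: rv add_nonneg_nonneg mult_nonneg_nonneg)
  have F: "F m \<in> events" for m
  proof -
    have "Measurable.pred M (\<lambda>\<omega>. \<exists>j\<le>(2::nat) ^ m. a < \<bar>X (p + real j * d m) \<omega> - X p \<omega>\<bar>)"
    proof (rule pred_le_intros)
      fix j
      have [measurable]: "X (p + real j * d m) \<in> borel_measurable M" "X p \<in> borel_measurable M" using X by auto
      show "Measurable.pred M (\<lambda>\<omega>. a < \<bar>X (p + real j * d m) \<omega> - X p \<omega>\<bar>)" by measurable
    qed
    then show ?thesis unfolding F_def pred_def .
  qed
  have Fle: "prob (F m) \<le> 2 * exp (- (a\<^sup>2 / (4 * \<delta>)))" for m
  proof -
    interpret W: gaussian_walk M "\<lambda>i \<omega>. X (p + real (Suc i) * d m) \<omega> - X (p + real i * d m) \<omega>" "2 ^ m" "d m"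
      by (rule forward_walk[OF p d0(1)])
    have WS: "W.S k \<omega> = X (p + real k * d m) \<omega> - X p \<omega>" for k \<omega>
      unfolding W.S_def by (rule forward_sum)
    have [measurable]: "W.S j \<in> borel_measurable M" if "j \<le> 2 ^ m" for j using that by (rule W.S_rv)
    have "{\<omega> \<in> space M. \<exists>j\<le>(2::nat) ^ m. a \<le> \<bar>W.S j \<omega>\<bar>} \<in> events"
    proof -
      have "Measurable.pred M (\<lambda>\<omega>. \<exists>j\<le>(2::nat) ^ m. a \<le> \<bar>W.S j \<omega>\<bar>)"
        by (rule pred_le_intros) measurable
      then show ?thesis unfolding pred_def .
    qed
    moreover have "F m \<subseteq> {\<omega> \<in> space M. \<exists>j\<le>(2::nat) ^ m. a \<le> \<bar>W.S j \<omega>\<bar>}"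
      unfolding F_def WS by (blast intro: less_imp_le)
    ultimately have "prob (F m) \<le> prob {\<omega> \<in> space M. \<exists>j\<le>(2::nat) ^ m. a \<le> \<bar>W.S j \<omega>\<bar>}"
      by (rule finite_measure_mono[rotated])
    also have "\<dots> \<le> 2 * exp (- (a\<^sup>2 / (4 * (real (2 ^ m) * d m))))"
      by (rule W.maximal) (use a in auto)
    finally show ?thesis using d0(2)[of m] by simp
  qed
  have EF: "E = (\<Union>m. F m)"
  proof (intro equalityI subsetI)
    fix \<omega> assume "\<omega> \<in> (\<Union>m. F m)"
    then obtain m j where j: "\<omega> \<in> space M" "j \<le> 2 ^ m" "a < \<bar>X (p + real j * d m) \<omega> - X p \<omega>\<bar>" by (auto simp: F_def)
    have "real j \<le> 2 ^ m" using of_nat_mono[OF j(2), where 'a = real] by simp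
    then have "real j * d m \<le> 2 ^ m * d m" using d0[of m] by (intro mult_right_mono) auto
    then have "p + real j * d m \<in> {p..p + \<delta>}" using d0[of m] by auto
    then show "\<omega> \<in> E" using j by (auto simp: E_def)
  next
    fix \<omega> assume "\<omega> \<in> E"
    then obtain s where s: "\<omega> \<in> space M" "p \<le> s" "s \<le> p + \<delta>" "a < \<bar>X s \<omega> - X p \<omega>\<bar>" by (auto simp: E_def)
    have "((\<lambda>t. X t \<omega>) \<longlongrightarrow> X s \<omega>) (at_right s)"
      using paths[OF s(1)] p s(2) by (auto simp: cadlag_def)
    then have "((\<lambda>t. \<bar>X t \<omega> - X p \<omega>\<bar>) \<longlongrightarrow> \<bar>X s \<omega> - X p \<omega>\<bar>) (at_right s)" by (intro tendsto_intros)
    from order_tendstoD(1)[OF this s(4)] obtain b where b: "s < b" "\<And>t. s < t \<Longrightarrow> t < b \<Longrightarrow> a < \<bar>X t \<omega> - X p \<omega>\<bar>"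
      unfolding eventually_at_right[OF less_add_one] by (metis (full_types))
    obtain m where m: "d m < b - s"
    proof -
      obtain m where "\<delta> / (b - s) < 2 ^ m" using real_arch_pow[of 2 "\<delta> / (b - s)"] by auto
      then have "d m < b - s" using b(1) by (simp add: d_def field_simps)
      then show ?thesis by (rule that)
    qed
    define j where "j = nat \<lceil>(s - p) / d m\<rceil>"
    have sp: "0 \<le> (s - p) / d m" using s d0[of m] by auto
    have j1: "(s - p) / d m \<le> real j" "real j < (s - p) / d m + 1"
      using sp ceiling_correct[of "(s - p) / d m"] by (auto simp: j_def)
    have "(s - p) / d m \<le> 2 ^ m" using s d0[of m] by (simp add: field_simps)
    then have "\<lceil>(s - p) / d m\<rceil> \<le> 2 ^ m" by (simp add: ceiling_le_iff)
    then have j2: "j \<le> 2 ^ m" unfolding j_def by (simp add: nat_le_iff)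
    have "s - p \<le> real j * d m" "real j * d m < s - p + d m"
      using j1 d0[of m] by (auto simp: field_simps)
    then have "s \<le> p + real j * d m" "p + real j * d m < b" using m by auto
    then have "a < \<bar>X (p + real j * d m) \<omega> - X p \<omega>\<bar>"
      using b(2)[of "p + real j * d m"] s(4) by (cases "s = p + real j * d m") auto
    then show "\<omega> \<in> (\<Union>m. F m)" using s(1) j2 by (auto simp: F_def)
  qed
  show "E \<in> events" unfolding EF using F by auto
  have inc: "incseq F"
  proof (rule incseq_SucI, rule subsetI)
    fix m \<omega> assume "\<omega> \<in> F m"
    then obtain j where j: "\<omega> \<in> space M" "j \<le> 2 ^ m" "a < \<bar>X (p + real j * d m) \<omega> - X p \<omega>\<bar>" by (auto simp: F_def)
    have "real (2 * j) * d (Suc m) = real j * d m" by (simp add: d_def)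
    then have "a < \<bar>X (p + real (2 * j) * d (Suc m)) \<omega> - X p \<omega>\<bar>" using j(3) by (simp only:)
    moreover have "2 * j \<le> 2 ^ Suc m" using j(2) by simp
    ultimately show "\<omega> \<in> F (Suc m)" using j(1) unfolding F_def by blast
  qed
  have "(\<lambda>m. prob (F m)) \<longlonglongrightarrow> prob (\<Union>m. F m)"
    by (rule finite_Lim_measure_incseq) (use F inc in auto)
  then show "prob E \<le> 2 * exp (- (a\<^sup>2 / (4 * \<delta>)))"
    unfolding EF by (rule LIMSEQ_le_const2) (use Fle in auto)
qed

end

definition modulus :: "nat \<Rightarrow> (real \<Rightarrow> real) \<Rightarrow> bool" where
  "modulus n x \<longleftrightarrow> (\<forall>s\<in>{0..real n}. \<forall>t\<in>{0..real n}. \<bar>s - t\<bar> \<le> 1 / 8 ^ n \<longrightarrow> \<bar>x s - x t\<bar> \<le> 1 / 2 ^ n)"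

lemma modulusD:
  "modulus n x \<Longrightarrow> 0 \<le> s \<Longrightarrow> s \<le> real n \<Longrightarrow> 0 \<le> t \<Longrightarrow> t \<le> real n \<Longrightarrow> \<bar>s - t\<bar> \<le> 1 / 8 ^ n \<Longrightarrow> \<bar>x s - x t\<bar> \<le> 1 / 2 ^ n"
  by (auto simp: modulus_def)

text \<open>Two points at distance at most \<open>8\<^sup>-\<^sup>n\<close> lie in the same cell or in adjacent ones; the left end points of
  these cells link them by steps of a quarter of \<open>2\<^sup>-\<^sup>n\<close>.\<close>

lemma modulus_of_cells:
  assumes cells: "\<And>k s. k < n * 8 ^ n \<Longrightarrow> s \<in> {real k / 8 ^ n..real k / 8 ^ n + 1 / 8 ^ n} \<Longrightarrow> \<bar>x s - x (real k / 8 ^ n)\<bar> \<le> 1 / (4 * 2 ^ n)"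
  shows "modulus n x"
proof (cases "n = 0")
  case True
  then show ?thesis by (auto simp: modulus_def)
next
  case n: False
  have *: "\<bar>x s - x t\<bar> \<le> 1 / 2 ^ n" if st: "0 \<le> s" "s \<le> t" "t \<le> real n" "t - s \<le> 1 / 8 ^ n" for s t
  proof (cases "s = real n")
    case True
    then show ?thesis using st by simp
  next
    case False
    define N where "N = (8::real) ^ n"
    have N: "0 < N" by (simp add: N_def)
    define k where "k = nat \<lfloor>s * N\<rfloor>"
    have k: "real k \<le> s * N" "s * N < real k + 1" using st N by (auto simp: k_def)
    have "s * N < real n * N" using False st N by (intro mult_strict_right_mono) auto
    then have "real k < real n * N" using k by linarith
    then have "real k < real (n * 8 ^ n)" by (simp add: N_def)
    then have kn: "k < n * 8 ^ n" by (simp only: of_nat_less_iff)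
    have sk: "s \<in> {real k / N..real k / N + 1 / N}" using k N by (auto simp: field_simps)
    have xs: "\<bar>x s - x (real k / N)\<bar> \<le> 1 / (4 * 2 ^ n)" using cells[OF kn] sk by (simp add: N_def)
    show ?thesis
    proof (cases "t \<le> real k / N + 1 / N")
      case True
      then have xt: "\<bar>x t - x (real k / N)\<bar> \<le> 1 / (4 * 2 ^ n)" using cells[OF kn, of t] sk st by (simp add: N_def)
      have tri: "\<bar>a - b\<bar> \<le> 4 * r" if "\<bar>a - c\<bar> \<le> r" "\<bar>b - c\<bar> \<le> r" for a b c r :: real
        using that by linarith
      from tri[OF xs xt] show ?thesis by simp
    next
      case False
      have kN: "real k / N + 1 / N = real (Suc k) / N" by (simp add: add_divide_distrib)
      have "t * N \<le> real n * N" using st N by (intro mult_right_mono) auto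
      moreover have "real (Suc k) < t * N" using False N unfolding kN by (simp add: field_simps)
      ultimately have "real (Suc k) < real n * N" by linarith
      then have "real (Suc k) < real (n * 8 ^ n)" by (simp add: N_def)
      then have kn': "Suc k < n * 8 ^ n" by (simp only: of_nat_less_iff)
      have "t \<in> {real (Suc k) / N..real (Suc k) / N + 1 / N}"
      proof -
        have "t \<le> s + 1 / N" using st by (simp add: N_def)
        also have "\<dots> \<le> real (Suc k) / N + 1 / N" using sk kN by auto
        finally show ?thesis using False unfolding kN by auto
      qed
      then have xt: "\<bar>x t - x (real (Suc k) / N)\<bar> \<le> 1 / (4 * 2 ^ n)" using cells[OF kn'] by (simp add: N_def)
      have "real (Suc k) / N \<in> {real k / N..real k / N + 1 / N}" unfolding kN[symmetric] using N by auto
      then have xk: "\<bar>x (real (Suc k) / N) - x (real k / N)\<bar> \<le> 1 / (4 * 2 ^ n)" using cells[OF kn] by (simp add: N_def)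
      have tri: "\<bar>a - b\<bar> \<le> 4 * r" if "\<bar>a - c\<bar> \<le> r" "\<bar>b - d\<bar> \<le> r" "\<bar>d - c\<bar> \<le> r" for a b c d r :: real
        using that by linarith
      from tri[OF xs xt xk] show ?thesis by simp
    qed
  qed
  show ?thesis
    unfolding modulus_def
  proof (intro ballI impI)
    fix s t assume "s \<in> {0..real n}" "t \<in> {0..real n}" "\<bar>s - t\<bar> \<le> 1 / 8 ^ n"
    then show "\<bar>x s - x t\<bar> \<le> 1 / 2 ^ n"
      using *[of s t] *[of t s] by (cases "s \<le> t") (auto simp: abs_minus_commute)
  qed
qed

lemma modulus_continuous:
  assumes "\<forall>\<^sub>F n in sequentially. modulus n x"
  shows "continuous_on {0..} x"
  unfolding continuous_on_iff
proof (intro ballI allI impI)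
  fix s e :: real assume s: "s \<in> {0..}" and e: "0 < e"
  have "\<forall>\<^sub>F n in sequentially. (1 / 2 :: real) ^ n < e"
    using e by (intro order_tendstoD(2)[OF LIMSEQ_power_zero]) auto
  moreover have "\<forall>\<^sub>F n in sequentially. s + 1 \<le> real n" by real_asymp
  ultimately have "\<forall>\<^sub>F n in sequentially. modulus n x \<and> (1 / 2 :: real) ^ n < e \<and> s + 1 \<le> real n"
    using assms by eventually_elim simp
  then obtain n where n: "modulus n x" "(1 / 2 :: real) ^ n < e" "s + 1 \<le> real n"
    by (auto simp: eventually_sequentially)
  show "\<exists>d>0. \<forall>t\<in>{0..}. dist t s < d \<longrightarrow> dist (x t) (x s) < e"
  proof (intro exI[of _ "min 1 (1 / 8 ^ n)"] conjI ballI impI)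
    fix t assume t: "t \<in> {0..}" "dist t s < min 1 (1 / 8 ^ n)"
    from t(2) have "dist t s < 1" by (rule less_le_trans) simp
    then have "\<bar>t - s\<bar> < 1" by (simp only: dist_real_def)
    with t have "\<bar>x t - x s\<bar> \<le> 1 / 2 ^ n" using s n(3) by (intro modulusD[OF n(1)]) (auto simp: dist_real_def)
    then show "dist (x t) (x s) < e" using n(2) by (simp add: dist_real_def power_one_over)
  qed simp
qed

context stable2_levy_process
begin

text \<open>The mesh \<open>8\<^sup>-\<^sup>n\<close> is much smaller than the square of \<open>2\<^sup>-\<^sup>n\<close>, so the failure probability of a cell,
  of order \<open>exp (- 2\<^sup>n / 64)\<close>, is summable even after multiplication by the number \<open>n 8\<^sup>n\<close> of cells.
  With \<open>modulus_continuous\<close> this also makes the paths continuous.\<close>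

lemma AE_modulus: "AE \<omega> in M. \<forall>\<^sub>F n in sequentially. modulus n (\<lambda>t. X t \<omega>)"
proof -
  define E where "E = (\<lambda>n k. {\<omega> \<in> space M. \<exists>s\<in>{real k / 8 ^ n..real k / 8 ^ n + 1 / 8 ^ n}. 1 / (4 * 2 ^ n) < \<bar>X s \<omega> - X (real k / 8 ^ n) \<omega>\<bar>})"
  have E: "E n k \<in> events" "prob (E n k) \<le> 2 * exp (- ((1 / (4 * 2 ^ n))\<^sup>2 / (4 * (1 / 8 ^ n))))" for n k
    unfolding E_def by (rule oscillation; simp)+
  have eq: "(1 / (4 * 2 ^ n))\<^sup>2 / (4 * (1 / 8 ^ n)) = (2 ^ n / 64 :: real)" for n :: nat
  proof -
    have "(8 :: real) ^ n = 2 ^ n * (2 ^ n)\<^sup>2" by (simp add: power2_eq_square flip: power_mult_distrib)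
    then show ?thesis by (simp add: power_divide power_mult_distrib)
  qed
  define f where "f = (\<lambda>n::nat. real n * 8 ^ n * (2 * exp (- (2 ^ n / 64))))"
  have "AE \<omega> in M. \<forall>\<^sub>F n in sequentially. \<omega> \<notin> (\<Union>k<n * 8 ^ n. E n k)"
  proof (rule borel_cantelli_bound)
    show "(\<Union>k<n * 8 ^ n. E n k) \<in> events" for n using E by auto
    have "prob (\<Union>k<n * 8 ^ n. E n k) \<le> f n" for n
    proof -
      have "prob (\<Union>k<n * 8 ^ n. E n k) \<le> (\<Sum>k<n * 8 ^ n. prob (E n k))"
        using E by (intro finite_measure_subadditive_finite) auto
      also have "\<dots> \<le> (\<Sum>k<n * 8 ^ n. 2 * exp (- ((1 / (4 * 2 ^ n))\<^sup>2 / (4 * (1 / 8 ^ n)))))"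
        using E by (intro sum_mono) auto
      finally show ?thesis unfolding f_def eq by simp
    qed
    then show "\<forall>\<^sub>F n in sequentially. prob (\<Union>k<n * 8 ^ n. E n k) \<le> f n" by simp
    show "summable f"
    proof (rule summable_comparison_test_ev)
      have "\<forall>\<^sub>F n in sequentially. f n \<le> (1 / 2) ^ n" unfolding f_def by real_asymp
      then show "\<forall>\<^sub>F n in sequentially. norm (f n) \<le> (1 / 2) ^ n" by (simp add: f_def)
      show "summable (\<lambda>n. (1 / 2 :: real) ^ n)" by (rule summable_geometric) simp
    qed
  qed
  then show ?thesis
    using AE_space
  proof (eventually_elim)
    case (elim \<omega>)
    then have \<omega>: "\<omega> \<in> space M" by simp
    show ?case
      using elim(1)
    proof (eventually_elim)
      case (elim n)
      show ?case
      proof (rule modulus_of_cells)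
        fix k s assume "k < n * 8 ^ n" "s \<in> {real k / 8 ^ n..real k / 8 ^ n + 1 / 8 ^ n}"
        then show "\<bar>X s \<omega> - X (real k / 8 ^ n) \<omega>\<bar> \<le> 1 / (4 * 2 ^ n)"
          using elim \<omega> by (auto simp: E_def not_less)
      qed
    qed
  qed
qed

end

section \<open>Almost sure bounds for visits and flat blocks\<close>

text \<open>The grid times at which the path, followed forwards or backwards from \<open>k / 8\<^sup>n\<close>, is in the strip
  around its starting value, before it leaves the strip through the bottom.\<close>

definition fwd_visits :: "nat \<Rightarrow> nat \<Rightarrow> (real \<Rightarrow> real) \<Rightarrow> nat set" where
  "fwd_visits n k x = {j. k + j \<le> n * 8 ^ n \<and> (\<forall>i\<le>j. - 2 * (1 / 2 ^ n) < x (real (k + i) / 8 ^ n) - x (real k / 8 ^ n)) \<and>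
     x (real (k + j) / 8 ^ n) - x (real k / 8 ^ n) < 3 * (1 / 2 ^ n)}"

definition bwd_visits :: "nat \<Rightarrow> nat \<Rightarrow> (real \<Rightarrow> real) \<Rightarrow> nat set" where
  "bwd_visits n k x = {j. j \<le> k \<and> (\<forall>i\<le>j. - 2 * (1 / 2 ^ n) < x (real (k - i) / 8 ^ n) - x (real k / 8 ^ n)) \<and>
     x (real (k - j) / 8 ^ n) - x (real k / 8 ^ n) < 3 * (1 / 2 ^ n)}"

text \<open>The constant for which the tail of \<open>visits_tail\<close> at \<open>visit_bound \<cdot> n 2\<^sup>n\<close> is \<open>exp (3 - 10 n)\<close>. This
  beats the number \<open>n 8\<^sup>n \<le> n exp (3 n)\<close> of starting points.\<close>

definition visit_bound :: nat where
  "visit_bound = nat \<lceil>10 * (2 * (1 + exp 3)) / exp (- 3) :: real\<rceil>"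

lemma visit_bound: "(10 :: real) \<le> exp (- 3) / (2 * (1 + exp 3)) * real visit_bound"
proof -
  define c :: real where "c = exp (- 3)"
  define d :: real where "d = 2 * (1 + exp 3)"
  have cd: "0 < c" "0 < d" by (auto simp: c_def d_def intro: add_pos_pos)
  have "10 * d / c \<le> real visit_bound" unfolding visit_bound_def c_def d_def by (rule real_nat_ceiling_ge)
  then show ?thesis using cd unfolding c_def[symmetric] d_def[symmetric] by (simp add: field_simps)
qed

context stable2_levy_process
begin

text \<open>With \<open>\<rho> = 2\<^sup>-\<^sup>n\<close> and \<open>\<delta> = 8\<^sup>-\<^sup>n\<close> one has \<open>\<delta> / \<rho>\<^sup>2 = \<rho>\<close>, and \<open>2304 = 48\<^sup>2\<close> is the hypothesis of
  \<open>visits_exp_moment\<close>. The exceptional event is that of the two walk bounds; it is stated existentially so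
  that the two visit counts need not be shown measurable.\<close>

lemma visit_tails:
  assumes n: "2304 \<le> (2::real) ^ n" and k: "k \<le> n * 8 ^ n"
  defines "a \<equiv> visit_bound * (n * 2 ^ n)"
  shows "\<exists>E\<in>events. prob E \<le> 2 * exp (3 - 10 * real n) \<and>
    (\<forall>\<omega>\<in>space M - E. card (fwd_visits n k (\<lambda>t. X t \<omega>)) \<le> a \<and> card (bwd_visits n k (\<lambda>t. X t \<omega>)) \<le> a)"
proof -
  define \<rho> :: real where "\<rho> = 1 / 2 ^ n"
  define \<delta> :: real where "\<delta> = 1 / 8 ^ n"
  have \<rho>: "0 < \<rho>" and \<delta>: "0 < \<delta>" by (auto simp: \<rho>_def \<delta>_def)
  have dr: "\<delta> / \<rho>\<^sup>2 = \<rho>"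
  proof -
    have "(8 :: real) ^ n = 2 ^ n * (2 ^ n)\<^sup>2" by (simp add: power2_eq_square flip: power_mult_distrib)
    then show ?thesis by (simp add: \<delta>_def \<rho>_def power_divide)
  qed
  have small: "sqrt \<delta> / \<rho> \<le> 1 / 48"
  proof -
    have "(sqrt \<delta> / \<rho>)\<^sup>2 = \<rho>" using \<delta> dr by (simp add: power_divide)
    also have "\<dots> \<le> (1 / 48)\<^sup>2" using n by (simp add: \<rho>_def power2_eq_square field_simps)
    finally show ?thesis by (rule power2_le_imp_le) simp
  qed
  define \<eta> where "\<eta> = exp (- 3) * (\<delta> / \<rho>\<^sup>2) / (2 * (1 + exp 3))"
  have \<eta>: "10 * real n \<le> \<eta> * real a"
  proof -
    have "\<eta> * real a = (exp (- 3) / (2 * (1 + exp 3)) * real visit_bound) * (\<rho> * 2 ^ n * real n)"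
      unfolding \<eta>_def dr a_def by simp
    also have "\<rho> * 2 ^ n = 1" by (simp add: \<rho>_def)
    finally show ?thesis using mult_right_mono[OF visit_bound, of "real n"] by simp
  qed
  have grid: "real (k + j) / 8 ^ n = real k / 8 ^ n + real j * \<delta>" for j by (simp add: \<delta>_def add_divide_distrib)
  have grid': "real (k - j) / 8 ^ n = real k / 8 ^ n - real j * \<delta>" if "j \<le> k" for j
    using that by (simp add: \<delta>_def diff_divide_distrib of_nat_diff)
  define N where "N = n * 8 ^ n - k + 1"
  interpret W: gaussian_walk M "\<lambda>i \<omega>. X (real k / 8 ^ n + real (Suc i) * \<delta>) \<omega> - X (real k / 8 ^ n + real i * \<delta>) \<omega>" N \<delta>
    by (rule forward_walk) (use \<delta> in auto)
  have WS: "W.S j \<omega> = X (real (k + j) / 8 ^ n) \<omega> - X (real k / 8 ^ n) \<omega>" for j \<omega>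
    unfolding W.S_def grid by (rule forward_sum)
  have fv: "fwd_visits n k (\<lambda>t. X t \<omega>) = W.visits \<rho> N \<omega>" for \<omega>
    using k unfolding fwd_visits_def W.visits_def WS \<rho>_def N_def by auto
  interpret V': gaussian_walk M "\<lambda>i \<omega>. X (real k / 8 ^ n - real i * \<delta>) \<omega> - X (real k / 8 ^ n - real (Suc i) * \<delta>) \<omega>" k \<delta>
    by (rule backward_walk) (use \<delta> in \<open>auto simp: \<delta>_def\<close>)
  interpret V: gaussian_walk M "\<lambda>i \<omega>. - (X (real k / 8 ^ n - real i * \<delta>) \<omega> - X (real k / 8 ^ n - real (Suc i) * \<delta>) \<omega>)" k \<delta>
    by (rule V'.uminus_walk)
  have VS: "V.S j \<omega> = X (real (k - j) / 8 ^ n) \<omega> - X (real k / 8 ^ n) \<omega>" if "j \<le> k" for j \<omega>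
    unfolding V.S_def grid'[OF that] sum_negf backward_sum by simp
  \<comment> \<open>The walk of \<open>k\<close> steps counts visits at times below \<open>k\<close>, the path also at time \<open>k\<close>.\<close>
  have bv: "bwd_visits n k (\<lambda>t. X t \<omega>) \<subseteq> insert k (V.visits \<rho> k \<omega>)" for \<omega>
  proof
    fix j assume j: "j \<in> bwd_visits n k (\<lambda>t. X t \<omega>)"
    then have jk: "j \<le> k" by (simp add: bwd_visits_def)
    have "\<forall>i\<le>j. - 2 * \<rho> < V.S i \<omega>"
    proof (intro allI impI)
      fix i assume ij: "i \<le> j"
      then have ik: "i \<le> k" using jk by simp
      show "- 2 * \<rho> < V.S i \<omega>" unfolding VS[OF ik] \<rho>_def using j ij unfolding bwd_visits_def by blast
    qed
    moreover have "V.S j \<omega> < 3 * \<rho>" using j unfolding VS[OF jk] bwd_visits_def \<rho>_def by blast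
    ultimately show "j \<in> insert k (V.visits \<rho> k \<omega>)" using jk unfolding V.visits_def by (cases "j = k") simp_all
  qed
  have fin: "finite (V.visits \<rho> k \<omega>)" for \<omega> unfolding V.visits_def by simp
  define E1 where "E1 = {\<omega> \<in> space M. real a \<le> real (card (W.visits \<rho> N \<omega>))}"
  define E2 where "E2 = {\<omega> \<in> space M. real a \<le> real (card (V.visits \<rho> k \<omega>))}"
  have E1: "E1 \<in> events" "prob E1 \<le> exp (3 - \<eta> * real a)"
    unfolding E1_def \<eta>_def by (rule W.visits_tail[OF \<rho> small order_refl])+
  have E2: "E2 \<in> events" "prob E2 \<le> exp (3 - \<eta> * real a)"
    unfolding E2_def \<eta>_def by (rule V.visits_tail[OF \<rho> small order_refl])+
  have le: "exp (3 - \<eta> * real a) \<le> exp (3 - 10 * real n)" using \<eta> by simp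
  show ?thesis
  proof (intro bexI[of _ "E1 \<union> E2"] conjI ballI)
    show "E1 \<union> E2 \<in> events" using E1 E2 by auto
    show "prob (E1 \<union> E2) \<le> 2 * exp (3 - 10 * real n)"
      using measure_Un_le[OF E1(1) E2(1)] E1(2) E2(2) le by linarith
    fix \<omega> assume \<omega>: "\<omega> \<in> space M - (E1 \<union> E2)"
    then show "card (fwd_visits n k (\<lambda>t. X t \<omega>)) \<le> a" unfolding fv by (auto simp: E1_def)
    have "card (V.visits \<rho> k \<omega>) < a" using \<omega> by (auto simp: E2_def)
    moreover have "card (bwd_visits n k (\<lambda>t. X t \<omega>)) \<le> card (insert k (V.visits \<rho> k \<omega>))"
      by (rule card_mono[OF _ bv]) (use fin in auto)
    moreover have "card (insert k (V.visits \<rho> k \<omega>)) \<le> Suc (card (V.visits \<rho> k \<omega>))"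
      by (rule card_insert_le_m1) (use fin in auto)
    ultimately show "card (bwd_visits n k (\<lambda>t. X t \<omega>)) \<le> a" by linarith
  qed
qed

lemma AE_visits:
  "AE \<omega> in M. \<forall>\<^sub>F n in sequentially. \<forall>k\<le>n * 8 ^ n.
     card (fwd_visits n k (\<lambda>t. X t \<omega>)) \<le> visit_bound * (n * 2 ^ n) \<and> card (bwd_visits n k (\<lambda>t. X t \<omega>)) \<le> visit_bound * (n * 2 ^ n)"
proof -
  define Q where "Q = (\<lambda>n k E. E \<in> events \<and> prob E \<le> 2 * exp (3 - 10 * real n) \<and>
    (\<forall>\<omega>\<in>space M - E. card (fwd_visits n k (\<lambda>t. X t \<omega>)) \<le> visit_bound * (n * 2 ^ n) \<and> card (bwd_visits n k (\<lambda>t. X t \<omega>)) \<le> visit_bound * (n * 2 ^ n)))"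
  define E where "E = (\<lambda>n k. if \<exists>E. Q n k E then SOME E. Q n k E else {})"
  have EQ: "Q n k (E n k)" if "2304 \<le> (2::real) ^ n" "k \<le> n * 8 ^ n" for n k
  proof -
    have "\<exists>E. Q n k E" using visit_tails[OF that] unfolding Q_def by blast
    then show ?thesis unfolding E_def by (auto intro: someI_ex)
  qed
  have E_ev: "E n k \<in> events" for n k
  proof (cases "\<exists>E. Q n k E")
    case True
    then have "Q n k (E n k)" unfolding E_def by (auto intro: someI_ex)
    then show ?thesis by (simp add: Q_def)
  next
    case False
    then have "E n k = {}" unfolding E_def by (rule if_not_P)
    then show ?thesis by simp
  qed
  have big: "\<forall>\<^sub>F n::nat in sequentially. 2304 \<le> (2::real) ^ n" by real_asymp
  define f where "f = (\<lambda>n::nat. (real n * exp (3 * real n) + 1) * (2 * exp (3 - 10 * real n)))"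
  have "AE \<omega> in M. \<forall>\<^sub>F n in sequentially. \<omega> \<notin> (\<Union>k\<le>n * 8 ^ n. E n k)"
  proof (rule borel_cantelli_bound)
    show "(\<Union>k\<le>n * 8 ^ n. E n k) \<in> events" for n using E_ev by auto
    show "\<forall>\<^sub>F n in sequentially. prob (\<Union>k\<le>n * 8 ^ n. E n k) \<le> f n"
      using big
    proof eventually_elim
      case (elim n)
      have "prob (\<Union>k\<le>n * 8 ^ n. E n k) \<le> (\<Sum>k\<le>n * 8 ^ n. prob (E n k))"
        using E_ev by (intro finite_measure_subadditive_finite) auto
      also have "\<dots> \<le> (\<Sum>k\<le>n * 8 ^ n. 2 * exp (3 - 10 * real n))"
        using EQ[OF elim] by (intro sum_mono) (auto simp: Q_def)
      also have "\<dots> = (real n * 8 ^ n + 1) * (2 * exp (3 - 10 * real n))" by (simp add: algebra_simps)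
      also have "\<dots> \<le> f n"
        unfolding f_def
      proof (intro mult_right_mono add_right_mono mult_left_mono)
        have "(2::real) \<le> exp 1" using exp_ge_add_one_self[of 1] by simp
        then have "(2::real) ^ 3 \<le> exp 1 ^ 3" by (intro power_mono) auto
        then have "(8::real) \<le> exp 3" by (simp flip: exp_of_nat_mult)
        then have "(8::real) ^ n \<le> exp 3 ^ n" by (intro power_mono) auto
        then show "(8::real) ^ n \<le> exp (3 * real n)" by (simp add: mult.commute flip: exp_of_nat_mult)
      qed auto
      finally show ?case .
    qed
    show "summable f"
    proof (rule summable_comparison_test_ev)
      have "\<forall>\<^sub>F n in sequentially. f n \<le> inverse (real n ^ 2)" unfolding f_def by real_asymp
      then show "\<forall>\<^sub>F n in sequentially. norm (f n) \<le> inverse (real n ^ 2)" by (simp add: f_def)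
      show "summable (\<lambda>n. inverse (real n ^ 2))" by (rule inverse_power_summable) simp
    qed
  qed
  then show ?thesis
    using AE_space
  proof eventually_elim
    case (elim \<omega>)
    then have \<omega>: "\<omega> \<in> space M" by simp
    show ?case
      using elim(1) big
    proof eventually_elim
      case (elim n)
      then show ?case using EQ[OF elim(2)] \<omega> unfolding Q_def by blast
    qed
  qed
qed

text \<open>A block of \<open>n 2\<^sup>n\<close> steps lasts \<open>n 4\<^sup>-\<^sup>n\<close>. By \<open>confinement\<close> with \<open>\<rho> = 2 \<cdot> 2\<^sup>-\<^sup>n\<close> it is flat with probability
  about \<open>exp (- n \<pi>\<^sup>2 / 16) \<ge> e\<^sup>-\<^sup>n\<close>, and \<open>3 > e\<close>, so that \<open>3\<^sup>n\<close> independent blocks all fail with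
  summable probability. The total duration \<open>n (3/4)\<^sup>n\<close> of these blocks tends to \<open>0\<close>.\<close>

lemma AE_flat_block:
  "AE \<omega> in M. \<forall>\<^sub>F n in sequentially. \<exists>j<(3::nat) ^ n. \<forall>l\<le>n * 2 ^ n.
     \<bar>X (real i / 2 ^ m + real (j * (n * 2 ^ n) + l) * (1 / 8 ^ n)) \<omega> - X (real i / 2 ^ m + real (j * (n * 2 ^ n)) * (1 / 8 ^ n)) \<omega>\<bar> < 2 * (1 / 2 ^ n)"
proof -
  define s where "s = real i / 2 ^ m"
  have s: "0 \<le> s" by (simp add: s_def)
  define A where "A = (\<lambda>n. {\<omega> \<in> space M. \<forall>j<(3::nat) ^ n. \<exists>l\<le>n * 2 ^ n.
     2 * (1 / 2 ^ n) \<le> \<bar>X (s + real (j * (n * 2 ^ n) + l) * (1 / 8 ^ n)) \<omega> - X (s + real (j * (n * 2 ^ n)) * (1 / 8 ^ n)) \<omega>\<bar>})"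
  \<comment> \<open>\<open>100 / 272\<close> is a rational lower bound for \<open>1 / e\<close>, so \<open>3\<^sup>n\<close> times the success probability is at least
    \<open>(300 / 272)\<^sup>n / 2\<close>.\<close>
  define f where "f = (\<lambda>n::nat. exp (- ((300 / 272) ^ n / 2)) :: real)"
  have A_ev: "A n \<in> events" for n
  proof -
    have X: "X (s + real j * (1 / 8 ^ n)) \<in> borel_measurable M" for j using s by (intro rv) auto
    have "Measurable.pred M (\<lambda>\<omega>. \<forall>j\<in>{..<(3::nat) ^ n}. \<exists>l\<le>n * 2 ^ n.
     2 * (1 / 2 ^ n) \<le> \<bar>X (s + real (j * (n * 2 ^ n) + l) * (1 / 8 ^ n)) \<omega> - X (s + real (j * (n * 2 ^ n)) * (1 / 8 ^ n)) \<omega>\<bar>)"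
    proof (rule pred_intros_finite(3), simp, rule pred_le_intros)
      fix j l
      note [measurable] = X[of "j * (n * 2 ^ n) + l"] X[of "j * (n * 2 ^ n)"]
      show "Measurable.pred M (\<lambda>\<omega>. 2 * (1 / 2 ^ n) \<le> \<bar>X (s + real (j * (n * 2 ^ n) + l) * (1 / 8 ^ n)) \<omega> - X (s + real (j * (n * 2 ^ n)) * (1 / 8 ^ n)) \<omega>\<bar>)"
        by measurable
    qed
    then show ?thesis unfolding A_def pred_def Ball_def lessThan_iff .
  qed
  have "AE \<omega> in M. \<forall>\<^sub>F n in sequentially. \<omega> \<notin> A n"
  proof (rule borel_cantelli_bound[OF A_ev])
    have "\<forall>\<^sub>F n::nat in sequentially. real n * 2 ^ n * (2 * exp (- (4 * 2 ^ n))) \<le> (100 / 272) ^ n / 2" by real_asymp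
    then show "\<forall>\<^sub>F n in sequentially. prob (A n) \<le> f n"
    proof eventually_elim
      case (elim n)
      define L where "L = n * 2 ^ n"
      define \<rho> :: real where "\<rho> = 2 * (1 / 2 ^ n)"
      define \<delta> :: real where "\<delta> = 1 / 8 ^ n"
      have \<rho>: "0 < \<rho>" and \<delta>: "0 < \<delta>" by (auto simp: \<rho>_def \<delta>_def)
      define p where "p = exp (- \<delta> * (pi / (2 * \<rho>))\<^sup>2) ^ L - real L * (2 * exp (- (\<rho>\<^sup>2 / \<delta>)))"
      interpret W: gaussian_walk M "\<lambda>i \<omega>. X (s + real (Suc i) * \<delta>) \<omega> - X (s + real i * \<delta>) \<omega>" "3 ^ n * L" \<delta>
        by (rule forward_walk[OF s \<delta>])
      have WS: "W.S j \<omega> = X (s + real j * \<delta>) \<omega> - X s \<omega>" for j \<omega>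
        unfolding W.S_def by (rule forward_sum)
      have "A n = {\<omega> \<in> space M. \<forall>j<3 ^ n. \<exists>m\<le>L. \<rho> \<le> \<bar>W.S (j * L + m) \<omega> - W.S (j * L) \<omega>\<bar>}"
        unfolding WS unfolding A_def L_def \<rho>_def \<delta>_def by simp
      then have "prob (A n) \<le> (1 - p) ^ (3 ^ n)"
        unfolding p_def using W.no_confined_block[of "3 ^ n" L \<rho>] \<rho> by simp
      also have "\<dots> \<le> exp (- p) ^ (3 ^ n)"
      proof (rule power_mono)
        show "1 - p \<le> exp (- p)" using exp_ge_add_one_self[of "- p"] by simp
        have "exp (- \<delta> * (pi / (2 * \<rho>))\<^sup>2) ^ L \<le> 1" using \<delta> by (intro power_le_one) auto
        moreover have "0 \<le> real L * (2 * exp (- (\<rho>\<^sup>2 / \<delta>)))" by simp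
        ultimately show "0 \<le> 1 - p" unfolding p_def by linarith
      qed
      also have "\<dots> = exp (- (3 ^ n * p))" by (simp flip: exp_of_nat_mult)
      also have "\<dots> \<le> f n"
      proof -
        have e8: "(8 :: real) ^ n = 2 ^ n * (2 ^ n)\<^sup>2" by (simp add: power2_eq_square flip: power_mult_distrib)
        have "real L * (\<delta> * (pi / (2 * \<rho>))\<^sup>2) = real n * (pi\<^sup>2 / 16)"
          by (simp add: L_def \<delta>_def \<rho>_def e8 power_divide power_mult_distrib)
        also have "\<dots> \<le> real n * 1"
        proof (rule mult_left_mono)
          have "pi\<^sup>2 \<le> 4\<^sup>2" using pi_less_4 by (intro power_mono) auto
          then show "pi\<^sup>2 / 16 \<le> 1" by simp
        qed simp
        finally have "exp (- real n) \<le> exp (- (real L * (\<delta> * (pi / (2 * \<rho>))\<^sup>2)))" by simp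
        also have "\<dots> = exp (- \<delta> * (pi / (2 * \<rho>))\<^sup>2) ^ L" by (simp flip: exp_of_nat_mult)
        finally have p1: "exp (- real n) \<le> exp (- \<delta> * (pi / (2 * \<rho>))\<^sup>2) ^ L" .
        have "100 / 272 \<le> exp (- 1 :: real)" using e_less_272 by (simp add: exp_minus field_simps)
        then have "(100 / 272) ^ n \<le> exp (- 1 :: real) ^ n" by (intro power_mono) auto
        then have p2: "(100 / 272) ^ n \<le> exp (- real n)" by (simp flip: exp_of_nat_mult)
        have "\<rho>\<^sup>2 / \<delta> = 4 * 2 ^ n" by (simp add: \<delta>_def \<rho>_def e8 power_divide power_mult_distrib)
        then have "real L * (2 * exp (- (\<rho>\<^sup>2 / \<delta>))) \<le> (100 / 272) ^ n / 2" using elim by (simp add: L_def)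
        then have "(100 / 272) ^ n / 2 \<le> p" using p1 p2 unfolding p_def by linarith
        then have "3 ^ n * ((100 / 272) ^ n / 2) \<le> 3 ^ n * p" by (intro mult_left_mono) auto
        moreover have "3 ^ n * ((100 / 272 :: real) ^ n / 2) = (300 / 272) ^ n / 2"
          by (simp add: power_mult_distrib[symmetric])
        ultimately have "(300 / 272) ^ n / 2 \<le> 3 ^ n * p" by (simp only:)
        then show ?thesis by (simp only: f_def exp_le_cancel_iff neg_le_iff_le)
      qed
      finally show ?case .
    qed
    show "summable f"
    proof (rule summable_comparison_test_ev)
      have "\<forall>\<^sub>F n in sequentially. f n \<le> inverse (real n ^ 2)" unfolding f_def by real_asymp
      then show "\<forall>\<^sub>F n in sequentially. norm (f n) \<le> inverse (real n ^ 2)" by (simp add: f_def)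
      show "summable (\<lambda>n. inverse (real n ^ 2))" by (rule inverse_power_summable) simp
    qed
  qed
  then show ?thesis
    using AE_space
  proof eventually_elim
    case (elim \<omega>)
    then have \<omega>: "\<omega> \<in> space M" by simp
    show ?case
      using elim(1)
    proof eventually_elim
      case (elim n)
      then show ?case using \<omega> unfolding A_def s_def by (simp only: mem_Collect_eq not_le[symmetric]) blast
    qed
  qed
qed

end

section \<open>Measurability of the height approximation\<close>

lemma cadlag_bounded:
  assumes x: "cadlag x" and a: "0 \<le> a" and ab: "a \<le> b"
  shows "bounded (x ` {a..b})"
proof -
  have "0 \<le> a \<longrightarrow> bounded (x ` {a..b})"
    using ab
  proof (induction rule: Bolzano)
    case (trans a b c)
    have "{a..c} = {a..b} \<union> {b..c}" using trans by auto
    then show ?case using trans by (auto simp: image_Un)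
  next
    case (local r)
    show ?case
    proof (cases "0 \<le> r")
      case False
      show ?thesis
      proof (intro exI[of _ 1] conjI allI impI)
        fix u v assume "u \<le> r \<and> r \<le> v \<and> v - u < 1" "0 \<le> u"
        then show "bounded (x ` {u..v})" using False by auto
      qed simp
    next
      case True
      have "(x \<longlongrightarrow> x r) (at_right r)" using x True by (auto simp: cadlag_def)
      then have "\<forall>\<^sub>F s in at_right r. dist (x s) (x r) < 1" by (rule tendstoD) simp
      then obtain b1 where b1: "r < b1" "\<And>s. r < s \<Longrightarrow> s < b1 \<Longrightarrow> dist (x s) (x r) < 1"
        unfolding eventually_at_right[OF less_add_one] by (metis (full_types))
      obtain l b2 where b2: "b2 < r" "\<And>s. b2 < s \<Longrightarrow> s < r \<Longrightarrow> 0 \<le> s \<Longrightarrow> dist (x s) l < 1"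
      proof (cases "r = 0")
        case True
        show ?thesis by (rule that[of "-1" 0]) (use True in auto)
      next
        case False
        with \<open>0 \<le> r\<close> have "0 < r" by simp
        then obtain l where "(x \<longlongrightarrow> l) (at_left r)" using x unfolding cadlag_def by blast
        then have "\<forall>\<^sub>F s in at_left r. dist (x s) l < 1" by (rule tendstoD) simp
        then obtain b2 where "b2 < r" "\<And>s. b2 < s \<Longrightarrow> s < r \<Longrightarrow> dist (x s) l < 1"
          unfolding eventually_at_left[of "r - 1" r, simplified] by (metis (full_types))
        then show ?thesis by (intro that[of b2 l]) auto
      qed
      show ?thesis
      proof (intro exI[of _ "min (b1 - r) (r - b2)"] conjI allI impI)
        fix u v assume uv: "u \<le> r \<and> r \<le> v \<and> v - u < min (b1 - r) (r - b2)" and u: "0 \<le> u"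
        have "x ` {u..v} \<subseteq> ball (x r) 1 \<union> ball l 1"
        proof safe
          fix s assume s: "s \<in> {u..v}" "x s \<notin> ball l 1"
          show "x s \<in> ball (x r) 1"
          proof (cases "s < r")
            case True
            then have "dist (x s) l < 1" using uv s u by (intro b2(2)) auto
            then show ?thesis using s by (simp add: dist_commute)
          next
            case False
            then show ?thesis using uv s b1(2)[of s] by (cases "s = r") (auto simp: dist_commute)
          qed
        qed
        then show "bounded (x ` {u..v})" by (rule bounded_subset[rotated]) auto
      qed (use b1 b2 in auto)
    qed
  qed
  then show ?thesis using a by simp
qed

lemma cadlag_bdd_below: "cadlag x \<Longrightarrow> 0 \<le> a \<Longrightarrow> a \<le> b \<Longrightarrow> bdd_below (x ` {a..b})"
  by (rule bounded_imp_bdd_below[OF cadlag_bounded])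

text \<open>Right continuity reduces the infimum to rational times; the end point \<open>t\<close> has to be added because
  it cannot be approached from the right.\<close>

lemma inf_from_rat:
  assumes x: "cadlag x" and s: "0 \<le> s" "s \<le> t"
  shows "inf_from x s t = (INF q::rat. if s \<le> of_rat q \<and> of_rat q \<le> t then x (of_rat q) else x t)" (is "_ = (INF q. ?v q)")
    and "bdd_below (range (\<lambda>q::rat. if s \<le> of_rat q \<and> of_rat q \<le> t then x (of_rat q) else x t))"
proof -
  have bx: "bdd_below (x ` {s..t})" using cadlag_bdd_below[OF x s] .
  have v: "inf_from x s t \<le> ?v q" for q
    unfolding inf_from_def using s by (auto intro!: cINF_lower[OF bx])
  show bv: "bdd_below (range ?v)"
  proof (rule bdd_belowI)
    fix y assume "y \<in> range ?v"
    then obtain q where "y = ?v q" by blast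
    then show "inf_from x s t \<le> y" using v[of q] by simp
  qed
  show "inf_from x s t = (INF q. ?v q)"
  proof (rule antisym)
    show "inf_from x s t \<le> (INF q. ?v q)" by (rule cINF_greatest) (use v in auto)
    show "(INF q. ?v q) \<le> inf_from x s t"
      unfolding inf_from_def
    proof (rule cINF_greatest)
      show "{s..t} \<noteq> {}" using s by simp
      fix r assume r: "r \<in> {s..t}"
      show "(INF q. ?v q) \<le> x r"
      proof (cases "r = t")
        case True
        obtain q :: rat where "t < of_rat q" using of_rat_dense[of t "t + 1"] by auto
        then have "?v q = x r" using True by simp
        then show ?thesis using cINF_lower[OF bv, of q] by simp
      next
        case False
        show ?thesis
        proof (rule field_le_epsilon)
          fix e :: real assume e: "0 < e"
          have "(x \<longlongrightarrow> x r) (at_right r)" using x r s by (auto simp: cadlag_def)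
          then have "\<forall>\<^sub>F u in at_right r. x u < x r + e" by (rule order_tendstoD(2)) (use e in simp)
          then obtain b where b: "r < b" "\<And>u. r < u \<Longrightarrow> u < b \<Longrightarrow> x u < x r + e"
            unfolding eventually_at_right[OF less_add_one] by (metis (full_types))
          have "r < min b t" using b False r by auto
          then obtain q :: rat where q: "r < of_rat q" "of_rat q < min b t" using of_rat_dense by blast
          have "(INF q. ?v q) \<le> ?v q" by (rule cINF_lower[OF bv]) simp
          also have "?v q = x (of_rat q)" using q r by simp
          also have "\<dots> < x r + e" using q b(2) by simp
          finally show "(INF q. ?v q) \<le> x r + e" by simp
        qed
      qed
    qed
  qed
qed

definition occ_set :: "(real \<Rightarrow> real) \<Rightarrow> real \<Rightarrow> real \<Rightarrow> real set" where
  "occ_set x \<epsilon> t = {s. 0 \<le> s \<and> s \<le> t \<and> inf_from x s t < x s \<and> x s < inf_from x s t + \<epsilon>}"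

lemma height_approx_occ: "height_approx x \<epsilon> t = (1 / \<epsilon>) * measure lborel (occ_set x \<epsilon> t)"
proof -
  have "(LBINT s:{0..t}. indicat_real {s. inf_from x s t < x s \<and> x s < inf_from x s t + \<epsilon>} s) = (LBINT s. indicat_real (occ_set x \<epsilon> t) s)"
    unfolding set_lebesgue_integral_def by (rule Bochner_Integration.integral_cong) (auto simp: occ_set_def indicator_def)
  then show ?thesis by (simp add: height_approx_def)
qed

context levy_process
begin

text \<open>The process is the limit of its discretizations from the right. Clamping the time to \<open>[0, t]\<close>
  makes the statement meaningful on the whole time axis.\<close>

lemma joint_measurable:
  assumes t: "0 \<le> t"
  shows "(\<lambda>(\<omega>, s). X (max 0 (min s t)) \<omega>) \<in> borel_measurable (M \<Otimes>\<^sub>M lborel)"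
proof -
  define g where "g = (\<lambda>n::nat. \<lambda>s::real. min t ((of_int \<lfloor>max 0 s * 2 ^ n\<rfloor> + 1) / 2 ^ n))"
  have gnn: "0 \<le> g n s" for n s using t by (auto simp: g_def)
  have m: "(\<lambda>p. X (g n (snd p)) (fst p)) \<in> borel_measurable (M \<Otimes>\<^sub>M lborel)" for n
  proof -
    have "(\<lambda>p. (\<lambda>k::int. \<lambda>p. X (max 0 (min t ((of_int k + 1) / 2 ^ n))) (fst p)) \<lfloor>max 0 (snd p) * (2::real) ^ n\<rfloor> p) \<in> borel_measurable (M \<Otimes>\<^sub>M lborel)"
    proof (rule measurable_compose_countable[where f = "\<lambda>k p. X (max 0 (min t ((of_int k + 1) / 2 ^ n))) (fst p)" and g = "\<lambda>p. \<lfloor>max 0 (snd p) * (2::real) ^ n\<rfloor>"])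
      fix k :: int
      have [measurable]: "X (max 0 (min t ((of_int k + 1) / 2 ^ n))) \<in> borel_measurable M" by (rule rv) simp
      show "(\<lambda>p. X (max 0 (min t ((of_int k + 1) / 2 ^ n))) (fst p)) \<in> borel_measurable (M \<Otimes>\<^sub>M lborel)" by measurable
    next
      show "(\<lambda>p. \<lfloor>max 0 (snd p) * (2::real) ^ n\<rfloor>) \<in> M \<Otimes>\<^sub>M lborel \<rightarrow>\<^sub>M count_space UNIV" by measurable
    qed
    moreover have "max 0 (min t ((of_int \<lfloor>max 0 s * 2 ^ n\<rfloor> + 1) / 2 ^ n)) = g n s" for s
      using gnn[of n s] by (simp add: g_def)
    ultimately show ?thesis by simp
  qed
  have lim: "(\<lambda>n. X (g n s) \<omega>) \<longlonglongrightarrow> X (max 0 (min s t)) \<omega>" if \<omega>: "\<omega> \<in> space M" for s \<omega>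
  proof -
    define u where "u = max 0 s"
    have gb: "u < (of_int \<lfloor>u * 2 ^ n\<rfloor> + 1) / 2 ^ n" "(of_int \<lfloor>u * 2 ^ n\<rfloor> + 1) / 2 ^ n \<le> u + (1 / 2) ^ n" for n
    proof -
      define f where "f = real_of_int \<lfloor>u * 2 ^ n\<rfloor>"
      have f: "u * 2 ^ n < f + 1" "f \<le> u * 2 ^ n" unfolding f_def by linarith+
      show "u < (of_int \<lfloor>u * 2 ^ n\<rfloor> + 1) / 2 ^ n" using f(1) unfolding f_def[symmetric] by (simp add: less_divide_eq)
      have "(f + 1) / 2 ^ n \<le> (u * 2 ^ n + 1) / 2 ^ n" using f(2) by (intro divide_right_mono) auto
      also have "\<dots> = u + (1 / 2) ^ n" by (simp add: add_divide_distrib power_one_over)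
      finally show "(of_int \<lfloor>u * 2 ^ n\<rfloor> + 1) / 2 ^ n \<le> u + (1 / 2) ^ n" unfolding f_def .
    qed
    show ?thesis
    proof (cases "t \<le> u")
      case True
      have "g n s = t" for n using gb(1)[of n] True unfolding g_def u_def[symmetric] by (intro min_absorb1) linarith
      moreover have "max 0 (min s t) = t" using True t unfolding u_def by (auto simp: max_def min_def split: if_splits)
      ultimately show ?thesis by simp
    next
      case False
      then have mx: "max 0 (min s t) = u" using t unfolding u_def by linarith
      have "(\<lambda>n. g n s) \<longlonglongrightarrow> u"
      proof (rule tendsto_sandwich)
        show "\<forall>\<^sub>F n in sequentially. u \<le> g n s"
          using gb(1) False unfolding g_def u_def[symmetric] by (intro always_eventually allI) (auto intro: less_imp_le)
        show "\<forall>\<^sub>F n in sequentially. g n s \<le> u + (1 / 2) ^ n"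
          using gb(2) unfolding g_def u_def[symmetric] by (intro always_eventually allI) (auto intro: min.coboundedI2)
        have "(\<lambda>n. u + (1 / 2) ^ n) \<longlonglongrightarrow> u + 0" by (intro tendsto_intros LIMSEQ_power_zero) auto
        then show "(\<lambda>n. u + (1 / 2) ^ n) \<longlonglongrightarrow> u" by simp
      qed simp
      moreover have "u < g n s" for n using gb(1)[of n] False unfolding g_def u_def[symmetric] by simp
      ultimately have "filterlim (\<lambda>n. g n s) (at_right u) sequentially"
        by (auto simp: filterlim_at less_le intro!: always_eventually)
      moreover have "((\<lambda>r. X r \<omega>) \<longlongrightarrow> X u \<omega>) (at_right u)"
        using paths[OF \<omega>] by (auto simp: cadlag_def u_def)
      ultimately show ?thesis unfolding mx by (rule filterlim_compose[rotated])
    qed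
  qed
  have "(\<lambda>p. X (max 0 (min (snd p) t)) (fst p)) \<in> borel_measurable (M \<Otimes>\<^sub>M lborel)"
    by (rule borel_measurable_LIMSEQ_real[OF _ m]) (auto simp: space_pair_measure intro!: lim)
  then show ?thesis by (simp add: case_prod_beta')
qed

lemma occ_pred:
  assumes t: "0 \<le> t"
  shows "{p \<in> space (M \<Otimes>\<^sub>M lborel). snd p \<in> occ_set (\<lambda>r. X r (fst p)) \<epsilon> t} \<in> sets (M \<Otimes>\<^sub>M lborel)"
proof -
  define Y where "Y = (\<lambda>p. X (max 0 (min (snd p) t)) (fst p))"
  define v where "v = (\<lambda>q::rat. \<lambda>p. if max 0 (min (snd p) t) \<le> of_rat q \<and> of_rat q \<le> t then X (max 0 (of_rat q)) (fst p) else X t (fst p))"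
  define J where "J = (\<lambda>p. INF q. v q p)"
  have [measurable]: "Y \<in> borel_measurable (M \<Otimes>\<^sub>M lborel)"
    unfolding Y_def using joint_measurable[OF t] by (simp add: case_prod_beta')
  have vm: "v q \<in> borel_measurable (M \<Otimes>\<^sub>M lborel)" for q
  proof -
    have [measurable]: "X (max 0 (of_rat q)) \<in> borel_measurable M" "X t \<in> borel_measurable M" using t by (auto intro: rv)
    show ?thesis unfolding v_def by measurable
  qed
  have v_eq: "v q (\<omega>, s) = (if max 0 (min s t) \<le> of_rat q \<and> of_rat q \<le> t then X (of_rat q) \<omega> else X t \<omega>)" for q \<omega> s
    by (cases "0 \<le> real_of_rat q") (auto simp: v_def)
  have [measurable]: "J \<in> borel_measurable (M \<Otimes>\<^sub>M lborel)"
    unfolding J_def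
  proof (rule borel_measurable_cINF[OF _ vm])
    fix p :: "'a \<times> real" assume "p \<in> space (M \<Otimes>\<^sub>M lborel)"
    then obtain \<omega> s where p: "p = (\<omega>, s)" "\<omega> \<in> space M" by (auto simp: space_pair_measure)
    show "bdd_below (range (\<lambda>q. v q p))"
      unfolding p(1) v_eq by (rule inf_from_rat(2)[OF paths[OF p(2)]]) (use t in auto)
  qed simp
  have "{p \<in> space (M \<Otimes>\<^sub>M lborel). snd p \<in> occ_set (\<lambda>r. X r (fst p)) \<epsilon> t}
    = {p \<in> space (M \<Otimes>\<^sub>M lborel). 0 \<le> snd p \<and> snd p \<le> t \<and> J p < Y p \<and> Y p < J p + \<epsilon>}"
  proof (intro Collect_cong conj_cong refl)
    fix p :: "'a \<times> real" assume "p \<in> space (M \<Otimes>\<^sub>M lborel)"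
    then obtain \<omega> s where p: "p = (\<omega>, s)" "\<omega> \<in> space M" by (auto simp: space_pair_measure)
    show "snd p \<in> occ_set (\<lambda>r. X r (fst p)) \<epsilon> t \<longleftrightarrow> 0 \<le> snd p \<and> snd p \<le> t \<and> J p < Y p \<and> Y p < J p + \<epsilon>"
    proof (cases "0 \<le> s \<and> s \<le> t")
      case True
      then have mm: "max 0 (min s t) = s" by simp
      have "inf_from (\<lambda>r. X r \<omega>) s t = J p"
        unfolding J_def p(1) v_eq mm by (rule inf_from_rat(1)[OF paths[OF p(2)]]) (use True in auto)
      then show ?thesis using True unfolding occ_set_def Y_def p by (simp add: mm)
    qed (auto simp: occ_set_def p)
  qed
  also have "\<dots> \<in> sets (M \<Otimes>\<^sub>M lborel)" by measurable
  finally show ?thesis .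
qed

lemma occ_set_borel:
  assumes "0 \<le> t" "\<omega> \<in> space M"
  shows "occ_set (\<lambda>r. X r \<omega>) \<epsilon> t \<in> sets borel"
proof -
  have "Pair \<omega> -` {p \<in> space (M \<Otimes>\<^sub>M lborel). snd p \<in> occ_set (\<lambda>r. X r (fst p)) \<epsilon> t} \<in> sets lborel"
    by (rule sets_Pair1[OF occ_pred[OF assms(1)]])
  moreover have "Pair \<omega> -` {p \<in> space (M \<Otimes>\<^sub>M lborel). snd p \<in> occ_set (\<lambda>r. X r (fst p)) \<epsilon> t} = occ_set (\<lambda>r. X r \<omega>) \<epsilon> t"
    using assms(2) by (auto simp: space_pair_measure)
  ultimately show ?thesis by simp
qed

lemma height_approx_measurable:
  assumes t: "0 \<le> t"
  shows "(\<lambda>\<omega>. height_approx (\<lambda>s. X s \<omega>) \<epsilon> t) \<in> borel_measurable M"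
proof -
  let ?A = "{p \<in> space (M \<Otimes>\<^sub>M lborel). snd p \<in> occ_set (\<lambda>r. X r (fst p)) \<epsilon> t}"
  have "(\<lambda>\<omega>. \<integral>s. indicat_real ?A (\<omega>, s) \<partial>lborel) \<in> borel_measurable M"
    by (rule lborel.borel_measurable_lebesgue_integral) (use occ_pred[OF t] in \<open>simp add: case_prod_beta'\<close>)
  then have "(\<lambda>\<omega>. (1 / \<epsilon>) * (\<integral>s. indicat_real ?A (\<omega>, s) \<partial>lborel)) \<in> borel_measurable M" by simp
  moreover have "(1 / \<epsilon>) * (\<integral>s. indicat_real ?A (\<omega>, s) \<partial>lborel) = height_approx (\<lambda>s. X s \<omega>) \<epsilon> t" if "\<omega> \<in> space M" for \<omega>
  proof -
    have "(\<integral>s. indicat_real ?A (\<omega>, s) \<partial>lborel) = (\<integral>s. indicat_real (occ_set (\<lambda>r. X r \<omega>) \<epsilon> t) s \<partial>lborel)"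
      using that by (intro Bochner_Integration.integral_cong) (auto simp: space_pair_measure indicator_def)
    then show ?thesis by (simp add: height_approx_occ)
  qed
  ultimately show ?thesis by (simp cong: measurable_cong)
qed

end

section \<open>The occupation set on a grid\<close>

text \<open>The running maximum of the walk reversed at \<open>t\<close>, and that walk reflected at its maximum.\<close>

definition grid_max :: "(real \<Rightarrow> real) \<Rightarrow> real \<Rightarrow> real \<Rightarrow> nat \<Rightarrow> real" where
  "grid_max x t \<delta> k = Max ((\<lambda>j. x t - x (t - real j * \<delta>)) ` {..k})"

definition grid_refl :: "(real \<Rightarrow> real) \<Rightarrow> real \<Rightarrow> real \<Rightarrow> nat \<Rightarrow> real" where
  "grid_refl x t \<delta> k = grid_max x t \<delta> k - (x t - x (t - real k * \<delta>))"

locale grid_path =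
  fixes x :: "real \<Rightarrow> real" and t \<delta> \<rho> :: real and n :: nat
  assumes \<delta>: "0 < \<delta>" and n\<delta>: "real n * \<delta> = t"
    and bdd: "bdd_below (x ` {0..t})"
    and osc: "\<And>s s'. 0 \<le> s \<Longrightarrow> s \<le> t \<Longrightarrow> 0 \<le> s' \<Longrightarrow> s' \<le> t \<Longrightarrow> \<bar>s - s'\<bar> \<le> \<delta> \<Longrightarrow> \<bar>x s - x s'\<bar> \<le> \<rho>"
    and occ_borel: "\<And>\<epsilon>. occ_set x \<epsilon> t \<in> sets borel"
begin

abbreviation "mx \<equiv> grid_max x t \<delta>"
abbreviation "Rk \<equiv> grid_refl x t \<delta>"

lemma t_nonneg: "0 \<le> t" using \<delta> n\<delta> by (metis mult_nonneg_nonneg of_nat_0_le_iff less_imp_le)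

lemma grid_point: "j \<le> n \<Longrightarrow> 0 \<le> t - real j * \<delta> \<and> t - real j * \<delta> \<le> t"
proof -
  assume "j \<le> n"
  then have "real j * \<delta> \<le> real n * \<delta>" using \<delta> by (intro mult_right_mono) auto
  then show ?thesis using n\<delta> \<delta> by simp
qed

text \<open>Under time reversal at \<open>t\<close> the infimum over \<open>[s, t]\<close> becomes a running maximum; passing to the grid costs one
  oscillation.\<close>

lemma mx_vs_inf:
  assumes k: "k \<le> n" and s: "0 \<le> s" "t - real (Suc k) * \<delta> \<le> s" "s \<le> t - real k * \<delta>"
  shows "mx k \<le> x t - inf_from x s t" "x t - inf_from x s t - \<rho> \<le> mx k"
proof -
  have st: "s \<le> t" using s(3) \<delta> by (smt (verit) mult_nonneg_nonneg of_nat_0_le_iff)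
  have b: "bdd_below (x ` {s..t})" by (rule bdd_below_mono[OF bdd]) (use s(1) in auto)
  show "mx k \<le> x t - inf_from x s t"
    unfolding grid_max_def
  proof (rule Max.boundedI)
    fix a assume "a \<in> (\<lambda>j. x t - x (t - real j * \<delta>)) ` {..k}"
    then obtain j where j: "j \<le> k" "a = x t - x (t - real j * \<delta>)" by auto
    have "real j * \<delta> \<le> real k * \<delta>" using j \<delta> by (intro mult_right_mono) auto
    moreover have "0 \<le> real j * \<delta>" using \<delta> by simp
    ultimately have "s \<le> t - real j * \<delta>" "t - real j * \<delta> \<le> t" using s(3) by linarith+
    then have "t - real j * \<delta> \<in> {s..t}" by simp
    then have "inf_from x s t \<le> x (t - real j * \<delta>)" unfolding inf_from_def by (rule cINF_lower[OF b])
    then show "a \<le> x t - inf_from x s t" using j by simp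
  qed auto
  have "x t - mx k - \<rho> \<le> inf_from x s t"
    unfolding inf_from_def
  proof (rule cINF_greatest)
    show "{s..t} \<noteq> {}" using st by simp
    fix u assume u: "u \<in> {s..t}"
    define j where "j = min k (nat \<lfloor>(t - u) / \<delta>\<rfloor>)"
    have jk: "j \<le> k" by (simp add: j_def)
    have tu: "0 \<le> (t - u) / \<delta>" "(t - u) / \<delta> \<le> real (Suc k)"
      using u s \<delta> by (auto simp: field_simps)
    define f where "f = nat \<lfloor>(t - u) / \<delta>\<rfloor>"
    have f: "real f \<le> (t - u) / \<delta>" "(t - u) / \<delta> < real f + 1"
      using tu(1) unfolding f_def by (auto simp: of_nat_nat)
    have jf: "j = min k f" by (simp add: j_def f_def)
    have "real j \<le> real f" using jf by simp
    then have j1: "real j \<le> (t - u) / \<delta>" using f by linarith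
    have j2: "(t - u) / \<delta> \<le> real j + 1"
    proof (cases "k \<le> f")
      case True
      then have "j = k" using jf by simp
      then show ?thesis using tu(2) by simp
    next
      case False
      then have "j = f" using jf by simp
      then show ?thesis using f(2) by simp
    qed
    have "real j * \<delta> \<le> t - u" "t - u \<le> real j * \<delta> + \<delta>" using j1 j2 \<delta> by (auto simp: field_simps)
    then have "\<bar>(t - real j * \<delta>) - u\<bar> \<le> \<delta>" by auto
    then have "\<bar>x (t - real j * \<delta>) - x u\<bar> \<le> \<rho>"
      using grid_point[of j] jk k u s by (intro osc) auto
    moreover have "x t - x (t - real j * \<delta>) \<le> mx k" unfolding grid_max_def using jk by (intro Max_ge) auto
    ultimately show "x t - mx k - \<rho> \<le> x u" by linarith
  qed
  then show "x t - inf_from x s t - \<rho> \<le> mx k" by linarith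
qed

lemma Rk_vs_reflected:
  assumes k: "k < n" and s: "t - real (Suc k) * \<delta> \<le> s" "s \<le> t - real k * \<delta>"
  shows "Rk k - \<rho> \<le> x s - inf_from x s t" "x s - inf_from x s t \<le> Rk k + 2 * \<rho>"
proof -
  have s0: "0 \<le> s" using grid_point[of "Suc k"] k s by simp
  have st: "s \<le> t" using grid_point[of k] k s by simp
  have "real (Suc k) * \<delta> = real k * \<delta> + \<delta>" by (simp add: algebra_simps)
  then have d: "\<bar>(t - real k * \<delta>) - s\<bar> \<le> \<delta>" using s by linarith
  have gk: "0 \<le> t - real k * \<delta>" "t - real k * \<delta> \<le> t" using grid_point[of k] k by auto
  have "\<bar>x (t - real k * \<delta>) - x s\<bar> \<le> \<rho>" by (rule osc[OF gk s0 st d])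
  then show "Rk k - \<rho> \<le> x s - inf_from x s t" "x s - inf_from x s t \<le> Rk k + 2 * \<rho>"
    using mx_vs_inf[of k s] k s s0 unfolding grid_refl_def by auto
qed

lemma mx_vs_running_inf: "\<bar>mx n - (x t - inf_from x 0 t)\<bar> \<le> \<rho>"
  using mx_vs_inf[of n 0] \<delta> n\<delta> osc[of 0 0] t_nonneg by (simp add: algebra_simps)

text \<open>The trapezoid with corners at \<open>h\<close>, \<open>2 h\<close>, \<open>\<epsilon> - 2 h\<close>, \<open>\<epsilon> - h\<close>, where \<open>h = \<eta> \<epsilon>\<close>, lies between the
  indicators of \<open>[2 h, \<epsilon> - 2 h]\<close> and \<open>(h, \<epsilon> - h)\<close>, and the grid error is less than \<open>h\<close>. Values close to \<open>0\<close>
  have to be cut off because the occupation set excludes the value \<open>0\<close> itself while the reflected walk may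
  sit there; this produces the occupation below \<open>3 h\<close> that is subtracted in the second bound.\<close>

lemma occ_sandwich:
  assumes \<eta>: "0 < \<eta>" "6 * \<eta> < 1" and \<epsilon>: "0 < \<epsilon>" and small: "2 * \<rho> < \<eta> * \<epsilon>"
  defines "\<psi> \<equiv> trapezoid.\<psi> (\<eta> * \<epsilon>) (2 * (\<eta> * \<epsilon>)) (\<epsilon> - 2 * (\<eta> * \<epsilon>)) (\<epsilon> - \<eta> * \<epsilon>) (\<eta> * \<epsilon>)"
  shows "\<delta> * (\<Sum>k<n. \<psi> (Rk k)) \<le> measure lborel (occ_set x \<epsilon> t)"
    and "measure lborel (occ_set x (\<epsilon> - 3 * (\<eta> * \<epsilon>)) t) - measure lborel (occ_set x (3 * (\<eta> * \<epsilon>)) t) \<le> \<delta> * (\<Sum>k<n. \<psi> (Rk k))"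
proof -
  define h where "h = \<eta> * \<epsilon>"
  have h: "0 < h" "6 * h < \<epsilon>" using \<eta> \<epsilon> by (auto simp: h_def)
  have \<rho>0: "0 \<le> \<rho>" using osc[of 0 0] t_nonneg \<delta> by simp
  interpret T: trapezoid h "2 * h" "\<epsilon> - 2 * h" "\<epsilon> - h" h
    by unfold_locales (use h in auto)
  have \<psi>: "\<psi> = T.\<psi>" by (simp add: \<psi>_def h_def)
  define cell where "cell = (\<lambda>k. {t - real (Suc k) * \<delta> <.. t - real k * \<delta>})"
  define ccell where "ccell = (\<lambda>k. {t - real (Suc k) * \<delta> .. t - real k * \<delta>})"
  have mcell: "emeasure lborel (cell k) = ennreal \<delta>" "emeasure lborel (ccell k) = ennreal \<delta>" for k
    using \<delta> by (auto simp: cell_def ccell_def algebra_simps)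
  have occ_fin: "emeasure lborel (occ_set x e t) < \<infinity>" for e
  proof -
    have "emeasure lborel (occ_set x e t) \<le> emeasure lborel {0..t}" by (rule emeasure_mono) (auto simp: occ_set_def)
    also have "\<dots> < \<infinity>" using t_nonneg by simp
    finally show ?thesis .
  qed
  have disj: "disjoint_family_on cell K" for K
    unfolding disjoint_family_on_def
  proof (intro ballI impI)
    have *: "cell i \<inter> cell j = {}" if "i < j" for i j
    proof -
      have "real (Suc i) * \<delta> \<le> real j * \<delta>" using that \<delta> by (intro mult_right_mono) auto
      then show ?thesis by (auto simp: cell_def)
    qed
    fix i j :: nat assume "i \<noteq> j"
    then show "cell i \<inter> cell j = {}" using *[of i j] *[of j i] by (cases "i < j") auto
  qed
  show "\<delta> * (\<Sum>k<n. \<psi> (Rk k)) \<le> measure lborel (occ_set x \<epsilon> t)"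
  proof -
    define K where "K = {k \<in> {..<n}. 0 < T.\<psi> (Rk k)}"
    have fK: "finite K" by (simp add: K_def)
    have sub: "cell k \<subseteq> occ_set x \<epsilon> t" if kK: "k \<in> K" for k
    proof
      fix s assume s: "s \<in> cell k"
      have kn: "k < n" and p: "0 < T.\<psi> (Rk k)" using kK by (auto simp: K_def)
      have R: "h < Rk k" "Rk k < \<epsilon> - h" using p T.psi_eq_0[of "Rk k"] by (auto simp: not_le[symmetric])
      have s': "t - real (Suc k) * \<delta> \<le> s" "s \<le> t - real k * \<delta>" using s by (auto simp: cell_def)
      have "0 \<le> s" "s \<le> t" using grid_point[of "Suc k"] grid_point[of k] kn s' by auto
      then show "s \<in> occ_set x \<epsilon> t" using Rk_vs_reflected[OF kn s'] R small \<rho>0 by (auto simp: occ_set_def h_def)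
    qed
    have "\<delta> * (\<Sum>k<n. T.\<psi> (Rk k)) = \<delta> * (\<Sum>k\<in>K. T.\<psi> (Rk k))"
    proof -
      have "(\<Sum>k<n. T.\<psi> (Rk k)) = (\<Sum>k\<in>K. T.\<psi> (Rk k))"
        by (rule sum.mono_neutral_right) (use T.psi_bounds(1) in \<open>auto simp: K_def not_less intro: antisym\<close>)
      then show ?thesis by simp
    qed
    also have "\<dots> \<le> \<delta> * (\<Sum>k\<in>K. 1)" using \<delta> T.psi_bounds(2) by (intro mult_left_mono sum_mono) auto
    finally have le: "\<delta> * (\<Sum>k<n. T.\<psi> (Rk k)) \<le> real (card K) * \<delta>" by (simp add: mult.commute)
    have "ennreal (real (card K) * \<delta>) = (\<Sum>k\<in>K. emeasure lborel (cell k))"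
      using \<delta> by (simp add: mcell ennreal_mult ennreal_of_nat_eq_real_of_nat)
    also have "\<dots> = emeasure lborel (\<Union>k\<in>K. cell k)"
      by (rule sum_emeasure) (use fK disj in \<open>auto simp: cell_def\<close>)
    also have "\<dots> \<le> emeasure lborel (occ_set x \<epsilon> t)"
      by (rule emeasure_mono) (use sub occ_borel in auto)
    also have "\<dots> = ennreal (measure lborel (occ_set x \<epsilon> t))"
      using occ_fin[of \<epsilon>] by (intro emeasure_eq_ennreal_measure) auto
    finally have "real (card K) * \<delta> \<le> measure lborel (occ_set x \<epsilon> t)" by (simp add: ennreal_le_iff)
    then show ?thesis unfolding \<psi> using le by linarith
  qed
  show "measure lborel (occ_set x (\<epsilon> - 3 * (\<eta> * \<epsilon>)) t) - measure lborel (occ_set x (3 * (\<eta> * \<epsilon>)) t) \<le> \<delta> * (\<Sum>k<n. \<psi> (Rk k))"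
  proof -
    define K where "K = {k \<in> {..<n}. T.\<psi> (Rk k) = 1}"
    have fK: "finite K" by (simp add: K_def)
    have sub: "occ_set x (\<epsilon> - 3 * h) t \<subseteq> occ_set x (3 * h) t \<union> (\<Union>k\<in>K. ccell k) \<union> {0, t}"
    proof
      fix s assume s: "s \<in> occ_set x (\<epsilon> - 3 * h) t"
      show "s \<in> occ_set x (3 * h) t \<union> (\<Union>k\<in>K. ccell k) \<union> {0, t}"
      proof (rule ccontr)
        assume neg: "\<not> ?thesis"
        have s0: "0 < s" "s < t" using s neg by (auto simp: occ_set_def)
        have g: "3 * h \<le> x s - inf_from x s t" "x s - inf_from x s t < \<epsilon> - 3 * h" using s neg by (auto simp: occ_set_def)
        define k where "k = nat \<lfloor>(t - s) / \<delta>\<rfloor>"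
        have "0 \<le> (t - s) / \<delta>" using s0 \<delta> by simp
        then have k1: "real k \<le> (t - s) / \<delta>" "(t - s) / \<delta> < real k + 1" by (auto simp: k_def of_nat_nat)
        then have k2: "t - real (Suc k) * \<delta> \<le> s" "s \<le> t - real k * \<delta>" using \<delta> by (auto simp: field_simps)
        have "real k * \<delta> < real n * \<delta>" using k2 s0 n\<delta> by linarith
        then have kn: "k < n" using \<delta> by simp
        have R: "2 * h \<le> Rk k" "Rk k \<le> \<epsilon> - 2 * h"
          using Rk_vs_reflected[OF kn k2] g small \<rho>0 by (auto simp: h_def)
        then have "T.\<psi> (Rk k) = 1" by (rule T.psi_eq_1)
        then show False using neg kn k2 by (auto simp: K_def ccell_def)
      qed
    qed
    have "emeasure lborel (occ_set x (\<epsilon> - 3 * h) t) \<le> emeasure lborel (occ_set x (3 * h) t \<union> (\<Union>k\<in>K. ccell k) \<union> {0, t})"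
      by (rule emeasure_mono[OF sub]) (use occ_borel fK in \<open>auto simp: ccell_def intro!: sets.Un sets.finite_UN\<close>)
    also have "\<dots> \<le> emeasure lborel (occ_set x (3 * h) t \<union> (\<Union>k\<in>K. ccell k)) + emeasure lborel {0, t}"
      by (rule emeasure_subadditive) (use occ_borel fK in \<open>auto simp: ccell_def intro!: sets.Un sets.finite_UN\<close>)
    also have "\<dots> \<le> emeasure lborel (occ_set x (3 * h) t) + emeasure lborel (\<Union>k\<in>K. ccell k) + emeasure lborel {0, t}"
      by (intro add_right_mono emeasure_subadditive) (use occ_borel fK in \<open>auto simp: ccell_def intro!: sets.finite_UN\<close>)
    also have "\<dots> \<le> emeasure lborel (occ_set x (3 * h) t) + (\<Sum>k\<in>K. emeasure lborel (ccell k)) + 0"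
      by (intro add_mono emeasure_subadditive_finite) (use fK in \<open>auto simp: ccell_def emeasure_lborel_countable\<close>)
    also have "\<dots> = ennreal (measure lborel (occ_set x (3 * h) t)) + ennreal (real (card K) * \<delta>)"
      using \<delta> occ_fin[of "3 * h"] by (simp add: mcell ennreal_mult ennreal_of_nat_eq_real_of_nat emeasure_eq_ennreal_measure less_top)
    also have "\<dots> = ennreal (measure lborel (occ_set x (3 * h) t) + real (card K) * \<delta>)"
      using \<delta> by simp
    finally have "emeasure lborel (occ_set x (\<epsilon> - 3 * h) t) \<le> ennreal (measure lborel (occ_set x (3 * h) t) + real (card K) * \<delta>)" .
    moreover have "emeasure lborel (occ_set x (\<epsilon> - 3 * h) t) = ennreal (measure lborel (occ_set x (\<epsilon> - 3 * h) t))"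
      using occ_fin[of "\<epsilon> - 3 * h"] by (intro emeasure_eq_ennreal_measure) auto
    moreover have "0 \<le> measure lborel (occ_set x (3 * h) t) + real (card K) * \<delta>" using \<delta> by simp
    ultimately have "measure lborel (occ_set x (\<epsilon> - 3 * h) t) \<le> measure lborel (occ_set x (3 * h) t) + real (card K) * \<delta>"
      by (simp only: ennreal_le_iff)
    moreover have "real (card K) * \<delta> \<le> \<delta> * (\<Sum>k<n. T.\<psi> (Rk k))"
    proof -
      have "real (card K) = (\<Sum>k\<in>K. T.\<psi> (Rk k))" by (simp add: K_def)
      also have "\<dots> \<le> (\<Sum>k<n. T.\<psi> (Rk k))" by (rule sum_mono2) (use T.psi_bounds(1) in \<open>auto simp: K_def\<close>)
      finally show ?thesis using \<delta> by (simp add: mult.commute mult_left_mono)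
    qed
    ultimately show ?thesis unfolding \<psi> h_def by linarith
  qed
qed

end

section \<open>The height process is the reflected process\<close>

text \<open>A version of passing to an almost surely convergent subsequence that works for several events at once
  and avoids the extraction.\<close>

lemma (in prob_space) AE_frequently_not:
  assumes A: "\<And>n. A n \<in> events" and lim: "(\<lambda>n. prob (A n)) \<longlonglongrightarrow> 0"
  shows "AE \<omega> in M. \<exists>\<^sub>F n in sequentially. \<omega> \<notin> A n"
proof -
  have z: "prob (\<Inter>n\<in>{N..}. A n) = 0" for N
  proof (rule antisym)
    have "prob (\<Inter>n\<in>{N..}. A n) \<le> prob (A n)" if "n \<ge> N" for n
      by (rule finite_measure_mono) (use that A in auto)
    then show "prob (\<Inter>n\<in>{N..}. A n) \<le> 0"
      by (intro LIMSEQ_le_const[OF lim]) blast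
  qed simp
  have "AE \<omega> in M. \<omega> \<notin> (\<Inter>n\<in>{N..}. A n)" for N
  proof (rule AE_not_in)
    have "(\<Inter>n\<in>{N..}. A n) \<in> events" using A by (intro sets.countable_INT) auto
    then show "(\<Inter>n\<in>{N..}. A n) \<in> null_sets M" using z[of N] by (simp add: null_sets_def emeasure_eq_measure)
  qed
  then have "AE \<omega> in M. \<forall>N. \<omega> \<notin> (\<Inter>n\<in>{N..}. A n)" by (simp add: AE_all_countable)
  then show ?thesis by eventually_elim (auto simp: frequently_sequentially)
qed

context stable2_levy_process
begin

text \<open>Choice of scales: \<open>\<epsilon> = 2\<^sup>-\<^sup>m\<close> for the height approximation and mesh \<open>\<delta> = 64\<^sup>-\<^sup>m\<close>. Then the error terms of
  \<open>occupation_vs_maximum\<close> are \<open>o(\<epsilon>)\<close> with geometrically small failure probabilities. Because \<open>t\<close> is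
  dyadic, the grid of mesh \<open>\<delta>\<close> runs exactly from \<open>t\<close> to \<open>0\<close> as soon as \<open>q \<le> 6 m\<close>.\<close>

lemma occupation_deviation:
  assumes t: "t = real i / 2 ^ q" and \<eta>: "0 < \<eta>" "6 * \<eta> < 1" and \<kappa>: "0 < \<kappa>"
  shows "AE \<omega> in M. \<forall>\<^sub>F m in sequentially.
    \<bar>(1 / 2 ^ m - 3 * (\<eta> * (1 / 2 ^ m))) * grid_max (\<lambda>r. X r \<omega>) t (1 / 64 ^ m) (i * 2 ^ (6 * m - q))
     - 1 / 64 ^ m * (\<Sum>k<i * 2 ^ (6 * m - q). trapezoid.\<psi> (\<eta> * (1 / 2 ^ m)) (2 * (\<eta> * (1 / 2 ^ m))) (1 / 2 ^ m - 2 * (\<eta> * (1 / 2 ^ m))) (1 / 2 ^ m - \<eta> * (1 / 2 ^ m)) (\<eta> * (1 / 2 ^ m))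
         (grid_refl (\<lambda>r. X r \<omega>) t (1 / 64 ^ m) k))\<bar> < \<kappa> * (1 / 2 ^ m)"
proof -
  have t0: "0 \<le> t" by (simp add: t)
  define Z where "Z = (\<lambda>m \<omega>. \<bar>(1 / 2 ^ m - 3 * (\<eta> * (1 / 2 ^ m))) * grid_max (\<lambda>r. X r \<omega>) t (1 / 64 ^ m) (i * 2 ^ (6 * m - q))
     - 1 / 64 ^ m * (\<Sum>k<i * 2 ^ (6 * m - q). trapezoid.\<psi> (\<eta> * (1 / 2 ^ m)) (2 * (\<eta> * (1 / 2 ^ m))) (1 / 2 ^ m - 2 * (\<eta> * (1 / 2 ^ m))) (1 / 2 ^ m - \<eta> * (1 / 2 ^ m)) (\<eta> * (1 / 2 ^ m))
         (grid_refl (\<lambda>r. X r \<omega>) t (1 / 64 ^ m) k))\<bar>)"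
  define f where "f = (\<lambda>m::nat. 4 / \<kappa>\<^sup>2 * (2 * (9 * (1 / 4) ^ m + 3 * (1 + 2 * t) * (1 / 2) ^ m + 5 * t * (1 / 4) ^ m) + 12 * t * (1 / 16) ^ m))"
  define good where "good = (\<lambda>m::nat. q \<le> 6 * m \<and> (1 + 5 * t / \<eta>) * (1 / 2) ^ m < \<kappa> / 2)"
  have good: "\<forall>\<^sub>F m in sequentially. good m"
  proof -
    have "(\<lambda>m. (1 + 5 * t / \<eta>) * (1 / 2) ^ m) \<longlonglongrightarrow> (1 + 5 * t / \<eta>) * 0"
      by (intro tendsto_intros LIMSEQ_power_zero) auto
    then have "\<forall>\<^sub>F m in sequentially. (1 + 5 * t / \<eta>) * (1 / 2) ^ m < \<kappa> / 2"
      by (rule order_tendstoD(2)) (use \<kappa> in simp)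
    then show ?thesis unfolding good_def
      using eventually_ge_at_top[of q] by eventually_elim auto
  qed
  have key: "\<exists>E\<in>events. prob E \<le> f m \<and> (\<forall>\<omega>\<in>space M - E. Z m \<omega> < \<kappa> * (1 / 2 ^ m))" if m: "good m" for m
  proof -
    define \<epsilon> :: real where "\<epsilon> = 1 / 2 ^ m"
    define \<delta> :: real where "\<delta> = 1 / 64 ^ m"
    define n where "n = i * 2 ^ (6 * m - q)"
    have \<epsilon>: "0 < \<epsilon>" and \<delta>: "0 < \<delta>" by (auto simp: \<epsilon>_def \<delta>_def)
    have qm: "q \<le> 6 * m" using m by (simp add: good_def)
    have n\<delta>: "real n * \<delta> = t"
    proof -
      have "(64::real) ^ m = 2 ^ (6 * m)" by (simp add: power_mult)
      also have "\<dots> = 2 ^ q * 2 ^ (6 * m - q)" using qm by (simp flip: power_add)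
      finally have "(64::real) ^ m = 2 ^ q * 2 ^ (6 * m - q)" .
      then show ?thesis by (simp add: n_def \<delta>_def t)
    qed
    have s\<delta>: "sqrt \<delta> = (1 / 8) ^ m"
    proof -
      have "\<delta> = ((1 / 8) ^ m)\<^sup>2" by (simp add: \<delta>_def power2_eq_square power_one_over flip: power_mult_distrib)
      then show ?thesis by simp
    qed
    interpret W: gaussian_walk M "\<lambda>i \<omega>. X (t - real i * \<delta>) \<omega> - X (t - real (Suc i) * \<delta>) \<omega>" n \<delta>
      by (rule backward_walk) (use n\<delta> \<delta> in auto)
    have WS: "W.S k \<omega> = X t \<omega> - X (t - real k * \<delta>) \<omega>" for k \<omega>
      unfolding W.S_def by (rule backward_sum)
    have WM: "W.Smax k \<omega> = grid_max (\<lambda>r. X r \<omega>) t \<delta> k" for k \<omega>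
      unfolding W.Smax_def WS grid_max_def ..
    have WR: "W.R k \<omega> = grid_refl (\<lambda>r. X r \<omega>) t \<delta> k" for k \<omega>
      unfolding W.R_def WM WS grid_refl_def ..
    define h where "h = \<eta> * \<epsilon>"
    have h: "0 < h" "6 * h < \<epsilon>" using \<eta> \<epsilon> by (auto simp: h_def)
    have T: "trapezoid h (2 * h) (\<epsilon> - 2 * h) (\<epsilon> - h) h" by unfold_locales (use h in auto)
    interpret T: trapezoid h "2 * h" "\<epsilon> - 2 * h" "\<epsilon> - h" h by (rule T)
    have D: "T.D = \<epsilon> - 3 * h" by (simp add: T.D_def)
    define x where "x = \<kappa> * \<epsilon> / 2"
    have x: "0 < x" using \<kappa> \<epsilon> by (simp add: x_def)
    define thr where "thr = x + T.D * (\<epsilon> - h) + real n * (5 * (\<delta> * sqrt \<delta>) / h)"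
    define E where "E = {\<omega> \<in> space M. thr \<le> \<bar>T.D * W.Smax n \<omega> - \<delta> * (\<Sum>j<n. T.\<psi> (W.R j \<omega>))\<bar>}"
    define B where "B = (\<Sum>j<n. (T.D)\<^sup>2 * (2 * \<delta> * prob {\<omega> \<in> space M. W.R j \<omega> \<le> 2 * \<epsilon>} + 12 * \<delta>\<^sup>2 / \<epsilon>\<^sup>2))"
    have dh: "\<epsilon> - h + \<epsilon> \<le> 2 * \<epsilon>" using h by simp
    have E: "E \<in> events" "prob E \<le> B / x\<^sup>2"
      unfolding E_def thr_def B_def by (rule W.occupation_vs_maximum[OF T less_imp_le[OF h(1)] \<epsilon> dh order_refl x])+
    have thr: "thr \<le> \<kappa> * \<epsilon>"
    proof -
      have "T.D * (\<epsilon> - h) \<le> \<epsilon> * \<epsilon>" using h unfolding D by (intro mult_mono) auto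
      moreover have "real n * (5 * (\<delta> * sqrt \<delta>) / h) = \<epsilon> * (5 * t / \<eta> * (1 / 2) ^ m)"
      proof -
        have "real n * (5 * (\<delta> * sqrt \<delta>) / h) = (real n * \<delta>) * 5 * sqrt \<delta> / h" by simp
        also have "\<dots> = t * 5 * (1 / 8) ^ m / (\<eta> * \<epsilon>)" unfolding n\<delta> s\<delta> h_def ..
        also have "(1 / 8 :: real) ^ m = \<epsilon> * \<epsilon> * (1 / 2) ^ m" by (simp add: \<epsilon>_def power_one_over flip: power_mult_distrib)
        also have "t * 5 * (\<epsilon> * \<epsilon> * (1 / 2) ^ m) / (\<eta> * \<epsilon>) = \<epsilon> * (5 * t / \<eta> * (1 / 2) ^ m)"
          using \<epsilon> \<eta> by (simp add: field_simps)
        finally show ?thesis .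
      qed
      moreover have "\<epsilon> * \<epsilon> + \<epsilon> * (5 * t / \<eta> * (1 / 2) ^ m) = \<epsilon> * ((1 + 5 * t / \<eta>) * (1 / 2) ^ m)"
        by (simp add: \<epsilon>_def power_one_over algebra_simps)
      moreover have "\<epsilon> * ((1 + 5 * t / \<eta>) * (1 / 2) ^ m) \<le> \<epsilon> * (\<kappa> / 2)"
        using m \<epsilon> by (intro mult_left_mono) (auto simp: good_def)
      ultimately show ?thesis unfolding thr_def x_def by (simp add: mult.commute)
    qed
    have Ble: "B / x\<^sup>2 \<le> f m"
    proof -
      have D2: "(T.D)\<^sup>2 \<le> \<epsilon>\<^sup>2" using h unfolding D by (intro power_mono) auto
      have "B \<le> (\<Sum>j<n. \<epsilon>\<^sup>2 * (2 * \<delta> * prob {\<omega> \<in> space M. W.R j \<omega> \<le> 2 * \<epsilon>} + 12 * \<delta>\<^sup>2 / \<epsilon>\<^sup>2))"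
        unfolding B_def using D2 \<delta> by (intro sum_mono mult_right_mono) auto
      also have "\<dots> = \<epsilon>\<^sup>2 * (2 * (\<delta> * (\<Sum>j<n. prob {\<omega> \<in> space M. W.R j \<omega> \<le> 2 * \<epsilon>})) + 12 * (real n * \<delta>) * (\<delta> / \<epsilon>\<^sup>2))"
        by (simp add: sum_distrib_left[symmetric] sum.distrib power2_eq_square algebra_simps)
      also have "\<dots> \<le> \<epsilon>\<^sup>2 * (2 * (9 * \<epsilon>\<^sup>2 + 3 * \<epsilon> * (1 + 2 * (real n * \<delta>)) + real n * (5 * (\<delta> * sqrt \<delta>) / \<epsilon>)) + 12 * (real n * \<delta>) * (\<delta> / \<epsilon>\<^sup>2))"
        by (intro mult_left_mono add_right_mono W.occupation_near_zero \<epsilon>) auto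
      also have "real n * (5 * (\<delta> * sqrt \<delta>) / \<epsilon>) = 5 * (real n * \<delta>) * (sqrt \<delta> / \<epsilon>)" by simp
      also have "sqrt \<delta> / \<epsilon> = (1 / 4) ^ m" unfolding s\<delta> \<epsilon>_def by (simp add: power_one_over field_simps flip: power_mult_distrib)
      also have "\<delta> / \<epsilon>\<^sup>2 = (1 / 16) ^ m" unfolding \<delta>_def \<epsilon>_def by (simp add: power_one_over power2_eq_square field_simps flip: power_mult_distrib)
      finally have "B / x\<^sup>2 \<le> \<epsilon>\<^sup>2 * (2 * (9 * \<epsilon>\<^sup>2 + 3 * \<epsilon> * (1 + 2 * t) + 5 * t * (1 / 4) ^ m) + 12 * t * (1 / 16) ^ m) / x\<^sup>2"
        unfolding n\<delta> by (intro divide_right_mono) auto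
      also have "\<dots> = f m"
      proof -
        have e2: "\<epsilon>\<^sup>2 = (1 / 4) ^ m" "\<epsilon> = (1 / 2) ^ m" by (simp_all add: \<epsilon>_def power_one_over power2_eq_square flip: power_mult_distrib)
        have *: "\<epsilon>\<^sup>2 * y / x\<^sup>2 = 4 / \<kappa>\<^sup>2 * y" for y using \<epsilon> \<kappa> by (simp add: x_def power_divide power_mult_distrib)
        show ?thesis unfolding * by (simp only: f_def e2(1), simp only: e2(2) mult_ac)
      qed
      finally show ?thesis .
    qed
    show ?thesis
    proof (intro bexI[OF _ E(1)] conjI ballI)
      show "prob E \<le> f m" using E(2) Ble by linarith
      fix \<omega> assume \<omega>: "\<omega> \<in> space M - E"
      have "Z m \<omega> = \<bar>T.D * W.Smax n \<omega> - \<delta> * (\<Sum>j<n. T.\<psi> (W.R j \<omega>))\<bar>"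
        unfolding WM WR D unfolding Z_def h_def n_def \<delta>_def \<epsilon>_def ..
      then show "Z m \<omega> < \<kappa> * (1 / 2 ^ m)" using \<omega> thr unfolding E_def \<epsilon>_def by auto
    qed
  qed
  define Q where "Q = (\<lambda>m E. E \<in> events \<and> prob E \<le> f m \<and> (\<forall>\<omega>\<in>space M - E. Z m \<omega> < \<kappa> * (1 / 2 ^ m)))"
  define E where "E = (\<lambda>m. if good m then SOME E. Q m E else {})"
  have EQ: "Q m (E m)" if "good m" for m
  proof -
    have "\<exists>E. Q m E" using key[OF that] unfolding Q_def by blast
    then show ?thesis using that unfolding E_def by (auto intro: someI_ex)
  qed
  have "AE \<omega> in M. \<forall>\<^sub>F m in sequentially. \<omega> \<notin> E m"
  proof (rule borel_cantelli_bound)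
    show "E m \<in> events" for m using EQ[of m] by (cases "good m") (auto simp: Q_def E_def)
    show "\<forall>\<^sub>F m in sequentially. prob (E m) \<le> f m"
      using good by eventually_elim (use EQ in \<open>auto simp: Q_def\<close>)
    show "summable f" unfolding f_def by (intro summable_mult summable_add summable_geometric) auto
  qed
  then have "AE \<omega> in M. \<forall>\<^sub>F m in sequentially. Z m \<omega> < \<kappa> * (1 / 2 ^ m)"
    using AE_space
  proof eventually_elim
    case (elim \<omega>)
    then have \<omega>: "\<omega> \<in> space M" by simp
    show ?case using elim(1) good by eventually_elim (use EQ \<omega> in \<open>auto simp: Q_def\<close>)
  qed
  then show ?thesis unfolding Z_def .
qed

end

context height_process
begin

text \<open>Along the scales \<open>2\<^sup>-\<^sup>m\<close> the height approximations for \<open>\<epsilon>\<close>, \<open>(1 - 3\<eta>) \<epsilon>\<close> and \<open>3\<eta> \<epsilon>\<close> are simultaneously close to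
  \<open>H t\<close> infinitely often, almost surely. For one such \<open>m\<close>, large enough for the eventual statements,
  \<open>occ_sandwich\<close> compares them with the smoothed occupation and \<open>occupation_deviation\<close> compares the
  latter with \<open>X - I\<close>. The second inequality has \<open>1 - 6\<eta> = (1 - 3\<eta>) - 3\<eta>\<close> from the two approximations on
  its left.\<close>

lemma AE_H_sandwich:
  assumes t: "t = real i / 2 ^ q" and \<eta>: "0 < \<eta>" "6 * \<eta> < 1" and \<kappa>: "0 < \<kappa>"
  shows "AE \<omega> in M. (1 - 3 * \<eta>) * (X t \<omega> - inf_from (\<lambda>r. X r \<omega>) 0 t) \<le> H t \<omega> + 3 * \<kappa> \<and>
     (1 - 6 * \<eta>) * H t \<omega> \<le> (1 - 3 * \<eta>) * (X t \<omega> - inf_from (\<lambda>r. X r \<omega>) 0 t) + 3 * \<kappa>"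
proof -
  have t0: "0 \<le> t" by (simp add: t)
  define Z where "Z = (\<lambda>\<epsilon> \<omega>. height_approx (\<lambda>s. X s \<omega>) \<epsilon> t)"
  have [measurable]: "Z \<epsilon> \<in> borel_measurable M" for \<epsilon> unfolding Z_def by (rule height_approx_measurable[OF t0])
  have [measurable]: "H t \<in> borel_measurable M" by (rule H_rv[OF t0])
  have lim: "(\<lambda>m. prob {\<omega> \<in> space M. \<kappa> < \<bar>Z (c * (1 / 2 ^ m)) \<omega> - H t \<omega>\<bar>}) \<longlonglongrightarrow> 0" if c: "0 < c" for c :: real
  proof -
    have "filterlim (\<lambda>m::nat. c * (1 / 2 ^ m)) (at_right 0) sequentially"
      using c by (auto simp: filterlim_at intro!: always_eventually tendsto_eq_intros LIMSEQ_divide_realpow_zero)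
    then show ?thesis using H_limit_in_probability[OF t0 \<kappa>] unfolding Z_def by (rule filterlim_compose[rotated])
  qed
  define c1 c2 where "c1 = 1 - 3 * \<eta>" and "c2 = 3 * \<eta>"
  have c: "0 < c1" "0 < c2" using \<eta> by (auto simp: c1_def c2_def)
  define A where "A = (\<lambda>c m. {\<omega> \<in> space M. \<kappa> < \<bar>Z (c * (1 / 2 ^ m)) \<omega> - H t \<omega>\<bar>})"
  have A [measurable]: "A c m \<in> events" for c m unfolding A_def by measurable
  have "AE \<omega> in M. \<exists>\<^sub>F m in sequentially. \<omega> \<notin> A 1 m \<union> A c1 m \<union> A c2 m"
  proof (rule AE_frequently_not)
    show "(\<lambda>m. prob (A 1 m \<union> A c1 m \<union> A c2 m)) \<longlonglongrightarrow> 0"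
    proof (rule tendsto_sandwich[where f = "\<lambda>_. 0" and h = "\<lambda>m. prob (A 1 m) + prob (A c1 m) + prob (A c2 m)"])
      have le: "prob (A 1 m \<union> A c1 m \<union> A c2 m) \<le> prob (A 1 m) + prob (A c1 m) + prob (A c2 m)" for m
        using measure_Un_le[of "A 1 m \<union> A c1 m" M "A c2 m"] measure_Un_le[of "A 1 m" M "A c1 m"] A by simp
      show "\<forall>\<^sub>F m in sequentially. prob (A 1 m \<union> A c1 m \<union> A c2 m) \<le> prob (A 1 m) + prob (A c1 m) + prob (A c2 m)"
        using le by simp
      have "(\<lambda>m. prob (A 1 m) + prob (A c1 m) + prob (A c2 m)) \<longlonglongrightarrow> 0 + 0 + 0"
        unfolding A_def by (intro tendsto_add lim c) simp
      then show "(\<lambda>m. prob (A 1 m) + prob (A c1 m) + prob (A c2 m)) \<longlonglongrightarrow> 0" by simp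
    qed auto
  qed (use A in auto)
  then show ?thesis
    using occupation_deviation[OF t \<eta> \<kappa>] AE_modulus AE_space
  proof eventually_elim
    case (elim \<omega>)
    let ?x = "\<lambda>r. X r \<omega>"
    note \<omega> = elim(4)
    have e3: "\<forall>\<^sub>F m in sequentially. modulus (2 * m) ?x"
      using elim(3) by (rule eventually_compose_filterlim) (simp add: filterlim_subseq strict_mono_def)
    have e4: "\<forall>\<^sub>F m in sequentially. t \<le> real (2 * m)" by real_asymp
    have e5: "\<forall>\<^sub>F m::nat in sequentially. 2 * (1 / 4 ^ m) < \<eta> * (1 / 2 ^ m)" using \<eta> by real_asymp
    have e6: "\<forall>\<^sub>F m::nat in sequentially. 1 / 4 ^ m < \<kappa>" using \<kappa> by real_asymp
    have e7: "\<forall>\<^sub>F m in sequentially. q \<le> 6 * m" using eventually_ge_at_top[of q] by eventually_elim simp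
    have "\<exists>\<^sub>F m in sequentially. (\<omega> \<notin> A 1 m \<union> A c1 m \<union> A c2 m) \<and>
      (modulus (2 * m) ?x \<and> t \<le> real (2 * m) \<and> 2 * (1 / 4 ^ m) < \<eta> * (1 / 2 ^ m) \<and> 1 / 4 ^ m < \<kappa> \<and> q \<le> 6 * m \<and>
       \<bar>(1 / 2 ^ m - 3 * (\<eta> * (1 / 2 ^ m))) * grid_max ?x t (1 / 64 ^ m) (i * 2 ^ (6 * m - q))
     - 1 / 64 ^ m * (\<Sum>k<i * 2 ^ (6 * m - q). trapezoid.\<psi> (\<eta> * (1 / 2 ^ m)) (2 * (\<eta> * (1 / 2 ^ m))) (1 / 2 ^ m - 2 * (\<eta> * (1 / 2 ^ m))) (1 / 2 ^ m - \<eta> * (1 / 2 ^ m)) (\<eta> * (1 / 2 ^ m))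
         (grid_refl ?x t (1 / 64 ^ m) k))\<bar> < \<kappa> * (1 / 2 ^ m))"
      by (rule frequently_rev_mp[OF elim(1)])
        (use elim(2) e3 e4 e5 e6 e7 in eventually_elim, blast)
    then obtain m where m: "\<omega> \<notin> A 1 m \<union> A c1 m \<union> A c2 m"
      "modulus (2 * m) ?x" "t \<le> real (2 * m)" "2 * (1 / 4 ^ m) < \<eta> * (1 / 2 ^ m)" "1 / 4 ^ m < \<kappa>" "q \<le> 6 * m"
      "\<bar>(1 / 2 ^ m - 3 * (\<eta> * (1 / 2 ^ m))) * grid_max ?x t (1 / 64 ^ m) (i * 2 ^ (6 * m - q))
     - 1 / 64 ^ m * (\<Sum>k<i * 2 ^ (6 * m - q). trapezoid.\<psi> (\<eta> * (1 / 2 ^ m)) (2 * (\<eta> * (1 / 2 ^ m))) (1 / 2 ^ m - 2 * (\<eta> * (1 / 2 ^ m))) (1 / 2 ^ m - \<eta> * (1 / 2 ^ m)) (\<eta> * (1 / 2 ^ m))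
         (grid_refl ?x t (1 / 64 ^ m) k))\<bar> < \<kappa> * (1 / 2 ^ m)"
      using frequently_ex by blast
    define \<epsilon> :: real where "\<epsilon> = 1 / 2 ^ m"
    define \<delta> :: real where "\<delta> = 1 / 64 ^ m"
    define \<rho> :: real where "\<rho> = 1 / 4 ^ m"
    define n where "n = i * 2 ^ (6 * m - q)"
    define Q where "Q = \<delta> * (\<Sum>k<n. trapezoid.\<psi> (\<eta> * \<epsilon>) (2 * (\<eta> * \<epsilon>)) (\<epsilon> - 2 * (\<eta> * \<epsilon>)) (\<epsilon> - \<eta> * \<epsilon>) (\<eta> * \<epsilon>) (grid_refl ?x t \<delta> k))"
    have \<epsilon>: "0 < \<epsilon>" and \<delta>: "0 < \<delta>" by (auto simp: \<epsilon>_def \<delta>_def)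
    have dev: "\<bar>(\<epsilon> - 3 * (\<eta> * \<epsilon>)) * grid_max ?x t \<delta> n - Q\<bar> < \<kappa> * \<epsilon>"
      using m(7) unfolding Q_def \<epsilon>_def \<delta>_def n_def .
    have n\<delta>: "real n * \<delta> = t"
    proof -
      have "(64::real) ^ m = 2 ^ (6 * m)" by (simp add: power_mult)
      also have "\<dots> = 2 ^ q * 2 ^ (6 * m - q)" using m(6) by (simp flip: power_add)
      finally have "(64::real) ^ m = 2 ^ q * 2 ^ (6 * m - q)" .
      then show ?thesis by (simp add: n_def \<delta>_def t)
    qed
    have cad: "cadlag ?x" by (rule paths[OF \<omega>])
    have p: "(8::real) ^ (2 * m) = 64 ^ m" "(2::real) ^ (2 * m) = 4 ^ m" by (simp_all add: power_mult)
    interpret G: grid_path ?x t \<delta> \<rho> n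
    proof
      show "bdd_below (?x ` {0..t})" by (rule cadlag_bdd_below[OF cad]) (use t0 in auto)
      show "occ_set ?x \<epsilon> t \<in> sets borel" for \<epsilon> by (rule occ_set_borel[OF t0 \<omega>])
      fix s s' assume "0 \<le> s" "s \<le> t" "0 \<le> s'" "s' \<le> t" "\<bar>s - s'\<bar> \<le> \<delta>"
      then show "\<bar>?x s - ?x s'\<bar> \<le> \<rho>"
        using modulusD[OF m(2), of s s'] m(3) unfolding \<delta>_def \<rho>_def p by auto
    qed (use \<delta> n\<delta> in auto)
    have small: "2 * \<rho> < \<eta> * \<epsilon>" using m(4) by (simp add: \<rho>_def \<epsilon>_def)
    have s1: "Q \<le> measure lborel (occ_set ?x \<epsilon> t)"
      and s2: "measure lborel (occ_set ?x (\<epsilon> - 3 * (\<eta> * \<epsilon>)) t) - measure lborel (occ_set ?x (3 * (\<eta> * \<epsilon>)) t) \<le> Q"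
      unfolding Q_def by (rule G.occ_sandwich[OF \<eta> \<epsilon> small])+
    have Zm: "measure lborel (occ_set ?x (c * \<epsilon>) t) = c * \<epsilon> * Z (c * \<epsilon>) \<omega>" if "0 < c" for c
      using that \<epsilon> by (simp add: Z_def height_approx_occ)
    have zA: "\<bar>Z (c * \<epsilon>) \<omega> - H t \<omega>\<bar> \<le> \<kappa>" if "\<omega> \<notin> A c m" for c
      using that \<omega> by (auto simp: A_def \<epsilon>_def)
    have z1: "\<bar>Z (1 * \<epsilon>) \<omega> - H t \<omega>\<bar> \<le> \<kappa>" and z2: "\<bar>Z (c1 * \<epsilon>) \<omega> - H t \<omega>\<bar> \<le> \<kappa>" and z3: "\<bar>Z (c2 * \<epsilon>) \<omega> - H t \<omega>\<bar> \<le> \<kappa>"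
      using zA[of 1] zA[of c1] zA[of c2] m(1) by simp_all
    define Y where "Y = X t \<omega> - inf_from ?x 0 t"
    have mxY: "\<bar>grid_max ?x t \<delta> n - Y\<bar> \<le> \<rho>" unfolding Y_def by (rule G.mx_vs_running_inf)
    have \<rho>\<kappa>: "\<rho> < \<kappa>" using m(5) by (simp add: \<rho>_def)
    have ce: "\<epsilon> - 3 * (\<eta> * \<epsilon>) = c1 * \<epsilon>" "3 * (\<eta> * \<epsilon>) = c2 * \<epsilon>" by (auto simp: c1_def c2_def algebra_simps)
    define u where "u = Q / \<epsilon>"
    have Q: "Q = u * \<epsilon>" using \<epsilon> by (simp add: u_def)
    have "\<bar>(c1 * grid_max ?x t \<delta> n - u) * \<epsilon>\<bar> < \<kappa> * \<epsilon>" using dev unfolding ce(1) Q by (simp add: algebra_simps)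
    then have d1: "\<bar>c1 * grid_max ?x t \<delta> n - u\<bar> < \<kappa>" using \<epsilon> by (simp add: abs_mult)
    have "u * \<epsilon> \<le> Z (1 * \<epsilon>) \<omega> * \<epsilon>" using s1 Zm[of 1] unfolding Q by (simp add: mult.commute)
    then have d2: "u \<le> Z (1 * \<epsilon>) \<omega>" using \<epsilon> by (simp only: mult_le_cancel_right_pos)
    have "(c1 * Z (c1 * \<epsilon>) \<omega> - c2 * Z (c2 * \<epsilon>) \<omega>) * \<epsilon> \<le> u * \<epsilon>"
      using s2 unfolding ce(1) unfolding ce(2) Q Zm[OF c(1)] Zm[OF c(2)] by (simp add: algebra_simps)
    then have d3: "c1 * Z (c1 * \<epsilon>) \<omega> - c2 * Z (c2 * \<epsilon>) \<omega> \<le> u" using \<epsilon> by (simp only: mult_le_cancel_right_pos)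
    have c1le: "c1 \<le> 1" using \<eta> by (simp add: c1_def)
    have g1: "c1 * \<bar>grid_max ?x t \<delta> n - Y\<bar> \<le> \<kappa>"
      using mult_mono[OF c1le mxY] c \<rho>\<kappa> by auto
    then have g2: "\<bar>c1 * grid_max ?x t \<delta> n - c1 * Y\<bar> \<le> \<kappa>"
      using c(1) by (simp add: right_diff_distrib[symmetric] abs_mult)
    have "c1 * Y \<le> H t \<omega> + 3 * \<kappa>" using g2 d1 d2 z1 by linarith
    moreover have "(c1 - c2) * H t \<omega> \<le> c1 * Y + 3 * \<kappa>"
    proof -
      have "c1 * (H t \<omega> - \<kappa>) \<le> c1 * Z (c1 * \<epsilon>) \<omega>" using z2 c by (intro mult_left_mono) auto
      moreover have "c2 * Z (c2 * \<epsilon>) \<omega> \<le> c2 * (H t \<omega> + \<kappa>)" using z3 c by (intro mult_left_mono) auto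
      ultimately have "c1 * (H t \<omega> - \<kappa>) - c2 * (H t \<omega> + \<kappa>) \<le> u" using d3 by linarith
      moreover have "c1 * (H t \<omega> - \<kappa>) - c2 * (H t \<omega> + \<kappa>) = (c1 - c2) * H t \<omega> - (c1 + c2) * \<kappa>" by (simp add: algebra_simps)
      moreover have "(c1 + c2) * \<kappa> = \<kappa>" by (simp add: c1_def c2_def)
      ultimately show ?thesis using g2 d1 by linarith
    qed
    moreover have "c1 - c2 = 1 - 6 * \<eta>" by (simp add: c1_def c2_def)
    ultimately show ?case unfolding Y_def c1_def by simp
  qed
qed

lemma AE_H_dyadic:
  assumes t: "t = real i / 2 ^ q"
  shows "AE \<omega> in M. H t \<omega> = X t \<omega> - inf_from (\<lambda>r. X r \<omega>) 0 t"
proof -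
  define \<eta> :: "nat \<Rightarrow> real" where "\<eta> = (\<lambda>j. 1 / (real j + 7))"
  define \<kappa> :: "nat \<Rightarrow> real" where "\<kappa> = (\<lambda>j. 1 / (real j + 1))"
  have \<eta>: "0 < \<eta> j" "6 * \<eta> j < 1" and \<kappa>: "0 < \<kappa> j" for j by (auto simp: \<eta>_def \<kappa>_def field_simps)
  have l: "\<eta> \<longlonglongrightarrow> 0" "\<kappa> \<longlonglongrightarrow> 0" unfolding \<eta>_def \<kappa>_def by real_asymp+
  have "AE \<omega> in M. \<forall>j. (1 - 3 * \<eta> j) * (X t \<omega> - inf_from (\<lambda>r. X r \<omega>) 0 t) \<le> H t \<omega> + 3 * \<kappa> j \<and>
     (1 - 6 * \<eta> j) * H t \<omega> \<le> (1 - 3 * \<eta> j) * (X t \<omega> - inf_from (\<lambda>r. X r \<omega>) 0 t) + 3 * \<kappa> j"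
    using AE_H_sandwich[OF t \<eta> \<kappa>] by (simp add: AE_all_countable)
  then show ?thesis
  proof eventually_elim
    case (elim \<omega>)
    define Y where "Y = X t \<omega> - inf_from (\<lambda>r. X r \<omega>) 0 t"
    have l1: "(\<lambda>j. (1 - 3 * \<eta> j) * Y) \<longlonglongrightarrow> (1 - 3 * 0) * Y" by (intro tendsto_intros l)
    have l2: "(\<lambda>j. H t \<omega> + 3 * \<kappa> j) \<longlonglongrightarrow> H t \<omega> + 3 * 0" by (intro tendsto_intros l)
    have l3: "(\<lambda>j. (1 - 6 * \<eta> j) * H t \<omega>) \<longlonglongrightarrow> (1 - 6 * 0) * H t \<omega>" by (intro tendsto_intros l)
    have l4: "(\<lambda>j. (1 - 3 * \<eta> j) * Y + 3 * \<kappa> j) \<longlonglongrightarrow> (1 - 3 * 0) * Y + 3 * 0" by (intro tendsto_intros l)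
    have "(1 - 3 * 0) * Y \<le> H t \<omega> + 3 * 0" by (rule LIMSEQ_le[OF l1 l2]) (use elim in \<open>auto simp: Y_def\<close>)
    moreover have "(1 - 6 * 0) * H t \<omega> \<le> (1 - 3 * 0) * Y + 3 * 0" by (rule LIMSEQ_le[OF l3 l4]) (use elim in \<open>auto simp: Y_def\<close>)
    ultimately show ?case by (simp add: Y_def)
  qed
qed

end

text \<open>The almost sure properties of \<open>X\<close> from which everything about the excursions is deduced. Flat blocks
  are required after every dyadic time, since each excursion interval contains one.\<close>

definition flat_blocks :: "nat \<Rightarrow> nat \<Rightarrow> nat \<Rightarrow> (real \<Rightarrow> real) \<Rightarrow> bool" where
  "flat_blocks i m n x \<longleftrightarrow> (\<exists>j<(3::nat) ^ n. \<forall>l\<le>n * 2 ^ n.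
     \<bar>x (real i / 2 ^ m + real (j * (n * 2 ^ n) + l) * (1 / 8 ^ n)) - x (real i / 2 ^ m + real (j * (n * 2 ^ n)) * (1 / 8 ^ n))\<bar> < 2 * (1 / 2 ^ n))"

definition few_visits :: "nat \<Rightarrow> (real \<Rightarrow> real) \<Rightarrow> bool" where
  "few_visits n x \<longleftrightarrow> (\<forall>k\<le>n * 8 ^ n. card (fwd_visits n k x) \<le> visit_bound * (n * 2 ^ n) \<and> card (bwd_visits n k x) \<le> visit_bound * (n * 2 ^ n))"

definition regular_path :: "(real \<Rightarrow> real) \<Rightarrow> bool" where
  "regular_path x \<longleftrightarrow> (\<forall>\<^sub>F n in sequentially. modulus n x) \<and> (\<forall>\<^sub>F n in sequentially. few_visits n x) \<and>
     (\<forall>i m. \<forall>\<^sub>F n in sequentially. flat_blocks i m n x)"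

lemma (in stable2_levy_process) AE_regular_path: "AE \<omega> in M. regular_path (\<lambda>t. X t \<omega>)"
proof -
  have "AE \<omega> in M. \<forall>i m. \<forall>\<^sub>F n in sequentially. flat_blocks i m n (\<lambda>t. X t \<omega>)"
    unfolding flat_blocks_def AE_all_countable using AE_flat_block by blast
  then show ?thesis
    using AE_modulus AE_visits unfolding regular_path_def few_visits_def by eventually_elim blast
qed

lemma regular_path_continuous: "regular_path x \<Longrightarrow> continuous_on {0..} x"
  unfolding regular_path_def by (blast intro: modulus_continuous)

lemma inf_from_le: "continuous_on {0..} x \<Longrightarrow> 0 \<le> s \<Longrightarrow> s \<le> u \<Longrightarrow> u \<le> t \<Longrightarrow> inf_from x s t \<le> x u"
  unfolding inf_from_def by (rule cINF_lower[OF bdd_below_path]) auto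

lemma running_inf_right_continuous:
  assumes x: "continuous_on {0..} x" and t: "0 \<le> t"
  shows "((\<lambda>u. inf_from x 0 u) \<longlongrightarrow> inf_from x 0 t) (at_right t)"
proof (rule tendstoI)
  fix e :: real assume e: "0 < e"
  have "t \<in> {0..}" "0 < e / 2" using t e by auto
  then have "\<exists>d>0. \<forall>u\<in>{0..}. dist u t < d \<longrightarrow> dist (x u) (x t) < e / 2"
    using x unfolding continuous_on_iff by blast
  then obtain d where d0: "0 < d" "\<forall>u\<in>{0..}. dist u t < d \<longrightarrow> dist (x u) (x t) < e / 2" by blast
  have d: "0 < d" "\<And>u. 0 \<le> u \<Longrightarrow> \<bar>u - t\<bar> < d \<Longrightarrow> \<bar>x u - x t\<bar> < e / 2"
    using d0 unfolding dist_real_def by auto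
  have "dist (inf_from x 0 u) (inf_from x 0 t) < e" if u: "t < u" "u < t + d" for u
  proof -
    have "inf_from x 0 u \<le> inf_from x 0 t"
      unfolding inf_from_def[of x 0 t] by (rule cINF_greatest) (use t u in \<open>auto intro: inf_from_le[OF x]\<close>)
    moreover have "inf_from x 0 t - e / 2 \<le> inf_from x 0 u"
      unfolding inf_from_def[of x 0 u]
    proof (rule cINF_greatest)
      show "{0..u} \<noteq> {}" using t u by simp
      fix v assume v: "v \<in> {0..u}"
      show "inf_from x 0 t - e / 2 \<le> x v"
      proof (cases "v \<le> t")
        case True
        then show ?thesis using inf_from_le[OF x, of 0 v t] v e by simp
      next
        case False
        then have "\<bar>x v - x t\<bar> < e / 2" using v u by (intro d) auto
        moreover have "inf_from x 0 t \<le> x t" by (rule inf_from_le[OF x]) (use t in auto)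
        ultimately show ?thesis by linarith
      qed
    qed
    ultimately show ?thesis using e by (simp add: dist_real_def)
  qed
  then show "\<forall>\<^sub>F u in at_right t. dist (inf_from x 0 u) (inf_from x 0 t) < e"
    unfolding eventually_at_right[OF less_add_one] using d(1) by (intro exI[of _ "t + d"]) auto
qed

lemma dyadic_from_right:
  fixes t :: real
  assumes "0 \<le> t"
  shows "filterlim (\<lambda>n. real (nat \<lfloor>t * 2 ^ n\<rfloor> + 1) / 2 ^ n) (at_right t) sequentially"
proof -
  let ?g = "\<lambda>n. real (nat \<lfloor>t * 2 ^ n\<rfloor> + 1) / 2 ^ n"
  have g: "t < ?g n" "?g n \<le> t + (1 / 2) ^ n" for n
  proof -
    define f where "f = real (nat \<lfloor>t * 2 ^ n\<rfloor>)"
    have f: "f \<le> t * 2 ^ n" "t * 2 ^ n < f + 1" using assms by (auto simp: f_def of_nat_nat)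
    show "t < ?g n" using f by (simp add: f_def[symmetric] less_divide_eq)
    have "(f + 1) / 2 ^ n \<le> (t * 2 ^ n + 1) / 2 ^ n" using f by (intro divide_right_mono) auto
    also have "\<dots> = t + (1 / 2) ^ n" by (simp add: add_divide_distrib power_one_over)
    finally show "?g n \<le> t + (1 / 2) ^ n" by (simp add: f_def add.commute)
  qed
  have "?g \<longlonglongrightarrow> t"
  proof (rule tendsto_sandwich[where f = "\<lambda>_. t" and h = "\<lambda>n. t + (1 / 2) ^ n"])
    have "(\<lambda>n. t + (1 / 2) ^ n) \<longlonglongrightarrow> t + 0" by (intro tendsto_intros LIMSEQ_power_zero) auto
    then show "(\<lambda>n. t + (1 / 2) ^ n) \<longlonglongrightarrow> t" by simp
  qed (use g in \<open>auto intro!: always_eventually intro: less_imp_le\<close>)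
  moreover have "?g n \<noteq> t" "?g n \<in> {t<..}" for n using g(1)[of n] by auto
  ultimately show ?thesis unfolding filterlim_at by (intro conjI always_eventually allI)
qed

text \<open>Both sides are right continuous and agree at dyadic times.\<close>

lemma (in height_process) AE_H_reflected:
  "AE \<omega> in M. regular_path (\<lambda>t. X t \<omega>) \<and> (\<forall>t\<ge>0. H t \<omega> = X t \<omega> - inf_from (\<lambda>r. X r \<omega>) 0 t)"
proof -
  have "AE \<omega> in M. \<forall>i q. H (real i / 2 ^ q) \<omega> = X (real i / 2 ^ q) \<omega> - inf_from (\<lambda>r. X r \<omega>) 0 (real i / 2 ^ q)"
    using AE_H_dyadic by (simp add: AE_all_countable)
  then show ?thesis
    using AE_regular_path AE_space
  proof eventually_elim
    case (elim \<omega>)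
    have x: "continuous_on {0..} (\<lambda>t. X t \<omega>)" by (rule regular_path_continuous[OF elim(2)])
    have h: "continuous_on {0..} (\<lambda>t. H t \<omega>)" by (rule H_paths[OF elim(3)])
    have right: "(f \<longlongrightarrow> f t) (at_right t)" if "continuous_on {0..} f" "0 \<le> t" for f :: "real \<Rightarrow> real" and t
    proof -
      have "(f \<longlongrightarrow> f t) (at t within {0..})" using that by (auto simp: continuous_on_def)
      then show ?thesis by (rule tendsto_within_subset) (use that in auto)
    qed
    have "H t \<omega> = X t \<omega> - inf_from (\<lambda>r. X r \<omega>) 0 t" if t: "0 \<le> t" for t
    proof (rule LIMSEQ_unique)
      let ?g = "\<lambda>n. real (nat \<lfloor>t * 2 ^ n\<rfloor> + 1) / 2 ^ n"
      show "(\<lambda>n. H (?g n) \<omega>) \<longlonglongrightarrow> H t \<omega>"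
        by (rule filterlim_compose[OF right[OF h t] dyadic_from_right[OF t]])
      have "((\<lambda>u. X u \<omega> - inf_from (\<lambda>r. X r \<omega>) 0 u) \<longlongrightarrow> X t \<omega> - inf_from (\<lambda>r. X r \<omega>) 0 t) (at_right t)"
        by (intro tendsto_diff right[OF x t] running_inf_right_continuous[OF x t])
      from filterlim_compose[OF this dyadic_from_right[OF t]]
      have l: "(\<lambda>n. X (?g n) \<omega> - inf_from (\<lambda>r. X r \<omega>) 0 (?g n)) \<longlonglongrightarrow> X t \<omega> - inf_from (\<lambda>r. X r \<omega>) 0 t" .
      have "H (?g n) \<omega> = X (?g n) \<omega> - inf_from (\<lambda>r. X r \<omega>) 0 (?g n)" for n using elim(1) by blast
      with l show "(\<lambda>n. H (?g n) \<omega>) \<longlonglongrightarrow> X t \<omega> - inf_from (\<lambda>r. X r \<omega>) 0 t" by (simp only:)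
    qed
    then show ?case using elim(2) by blast
  qed
qed

section \<open>Good paths\<close>

text \<open>An enumeration of the nonnegative rational times by a whole type. Quantifiers over \<^typ>\<open>rat\<close> are then
  unbounded countable quantifiers, for which measurability is automatic.\<close>

definition rat_time :: "rat \<Rightarrow> real" where "rat_time q = of_rat \<bar>q\<bar>"

lemma rat_time_nonneg [simp]: "0 \<le> rat_time q" by (simp add: rat_time_def)

lemma rat_time_dense: assumes "0 \<le> a" "a < b" obtains q where "a < rat_time q" "rat_time q < b"
proof -
  obtain q :: rat where "a < of_rat q" "of_rat q < b" using of_rat_dense[OF assms(2)] by blast
  moreover from this have "0 < real_of_rat q" using assms(1) by linarith
  then have "rat_time q = of_rat q" by (simp add: rat_time_def)
  ultimately show ?thesis using that[of q] by simp
qed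

text \<open>For an excursion \<open>w\<close> this says that the time precedes the lifetime.\<close>

definition alive :: "(real \<Rightarrow> real) \<Rightarrow> rat \<Rightarrow> bool" where
  "alive w p \<longleftrightarrow> (\<exists>u. rat_time p < rat_time u \<and> w (rat_time u) \<noteq> 0)"

text \<open>The trace of a flat block in an excursion: an interval of length \<open>n 4\<^sup>-\<^sup>n / 2\<close> inside the lifetime on which
  \<open>w\<close> is nearly constant. The half leaves room for a rational starting point in the block.\<close>

definition heavy_ball :: "nat \<Rightarrow> (real \<Rightarrow> real) \<Rightarrow> bool" where
  "heavy_ball n w \<longleftrightarrow> (\<exists>p. (\<exists>u. rat_time p + real n / 4 ^ n / 2 < rat_time u \<and> w (rat_time u) \<noteq> 0) \<and>
     (\<forall>q. rat_time p \<le> rat_time q \<and> rat_time q \<le> rat_time p + real n / 4 ^ n / 2 \<longrightarrow> \<bar>w (rat_time q) - w (rat_time p)\<bar> \<le> 6 * (1 / 2 ^ n)))"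

text \<open>A necessary condition for a distance less than \<open>2\<^sup>-\<^sup>n / 2\<close> in the tree, without an infimum over
  an uncountable set.\<close>

definition near :: "nat \<Rightarrow> (real \<Rightarrow> real) \<Rightarrow> rat \<Rightarrow> rat \<Rightarrow> bool" where
  "near n w p q \<longleftrightarrow> w (rat_time q) < w (rat_time p) + 1 / 2 ^ Suc n \<and>
     (\<forall>v. (rat_time p \<le> rat_time v \<and> rat_time v \<le> rat_time q) \<or> (rat_time q \<le> rat_time v \<and> rat_time v \<le> rat_time p) \<longrightarrow> w (rat_time p) - 1 / 2 ^ Suc n < w (rat_time v))"

text \<open>The covering of a ball by \<open>O(n 2\<^sup>n)\<close> windows of length \<open>2 \<cdot> 8\<^sup>-\<^sup>n\<close>. The left end points form a list
  of rationals so that their choice is a countable quantifier.\<close>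

definition light_balls :: "nat \<Rightarrow> (real \<Rightarrow> real) \<Rightarrow> bool" where
  "light_balls n w \<longleftrightarrow> (\<forall>p. alive w p \<longrightarrow> (\<exists>C::rat list. length C \<le> 3 * visit_bound * (n * 2 ^ n) \<and>
     (\<forall>q. alive w q \<and> near n w p q \<longrightarrow> (\<exists>c\<in>set C. of_rat c \<le> rat_time q \<and> rat_time q \<le> of_rat c + 2 * (1 / 8 ^ n)))))"

definition good_path :: "(real \<Rightarrow> real) \<Rightarrow> bool" where
  "good_path w \<longleftrightarrow> (\<exists>T::nat. \<forall>q. real T \<le> rat_time q \<longrightarrow> w (rat_time q) = 0) \<and>
     (\<exists>N. \<forall>n\<ge>N. heavy_ball n w \<and> light_balls n w)"

lemma coordinate_measurable: "(\<lambda>w. w (rat_time q)) \<in> borel_measurable path_space"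
  unfolding path_space_def by (rule measurable_restrict_space1) (rule measurable_component_singleton, simp)

lemma good_path_measurable: "Measurable.pred path_space good_path"
proof -
  note [measurable] = coordinate_measurable
  have [measurable]: "Measurable.pred path_space (\<lambda>w. alive w p)" for p
    unfolding alive_def by measurable
  have [measurable]: "Measurable.pred path_space (\<lambda>w. near n w p q)" for n p q
    unfolding near_def by measurable
  have [measurable]: "Measurable.pred path_space (heavy_ball n)" for n
    unfolding heavy_ball_def by measurable
  have [measurable]: "Measurable.pred path_space (light_balls n)" for n
    unfolding light_balls_def by measurable
  show ?thesis
    unfolding good_path_def by measurable
qed

section \<open>Excursions of a regular path are good\<close>

text \<open>The running infimum is attained, and it cannot be attained inside the excursion; so it does not move
  during the excursion, and the excursion is a translate of the path itself.\<close>

lemma excursion_above_start: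
  assumes x: "continuous_on {0..} x" and ab: "(a, b) \<in> excursion_intervals (\<lambda>t. x t - inf_from x 0 t)" and u: "a \<le> u" "u \<le> b"
  shows "x a \<le> x u" "inf_from x 0 u = x a"
proof -
  have a: "0 \<le> a" "a < b" and ga: "inf_from x 0 a = x a" and gp: "\<And>t. a < t \<Longrightarrow> t < b \<Longrightarrow> inf_from x 0 t < x t"
    using ab by (auto simp: excursion_intervals_def)
  have inner: "x a \<le> x v" if v: "a < v" "v < b" for v
  proof (rule ccontr)
    assume neg: "\<not> ?thesis"
    have "continuous_on {a..v} x" by (rule continuous_on_subset[OF x]) (use a in auto)
    then obtain c where c: "c \<in> {a..v}" "\<And>y. y \<in> {a..v} \<Longrightarrow> x c \<le> x y"
      using continuous_attains_inf[of "{a..v}" x] v by auto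
    have cv: "x c \<le> x v" by (rule c(2)) (use v in auto)
    then have ca: "a < c" using neg c(1) by (cases "c = a") auto
    have "x c \<le> inf_from x 0 c"
      unfolding inf_from_def
    proof (rule cINF_greatest)
      show "{0..c} \<noteq> {}" using a ca by simp
      fix y assume y: "y \<in> {0..c}"
      show "x c \<le> x y"
      proof (cases "y \<le> a")
        case True
        then have "x a \<le> x y" using inf_from_le[OF x, of 0 y a] y ga by simp
        then show ?thesis using cv neg by simp
      next
        case False
        then show ?thesis using c(2)[of y] y c(1) by auto
      qed
    qed
    moreover have "inf_from x 0 c < x c" using gp[of c] ca c(1) v by auto
    ultimately show False by simp
  qed
  have xb: "x a \<le> x b"
  proof (rule tendsto_lowerbound)
    have "(x \<longlongrightarrow> x b) (at b within {0..})" using x a by (auto simp: continuous_on_def)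
    then show "(x \<longlongrightarrow> x b) (at b within {a<..<b})" by (rule tendsto_within_subset) (use a in auto)
    show "\<forall>\<^sub>F v in at b within {a<..<b}. x a \<le> x v"
      unfolding eventually_at_filter using inner by (auto intro!: always_eventually)
    show "at b within {a<..<b} \<noteq> bot"
      unfolding trivial_limit_within using a by (simp add: islimpt_greaterThanLessThan2)
  qed
  have ge: "x a \<le> x v" if "a \<le> v" "v \<le> b" for v
    using inner[of v] xb that by (cases "v = a"; cases "v = b") auto
  show "x a \<le> x u" by (rule ge[OF u])
  show "inf_from x 0 u = x a"
  proof (rule antisym)
    show "inf_from x 0 u \<le> x a" by (rule inf_from_le[OF x]) (use a u in auto)
    show "x a \<le> inf_from x 0 u"
      unfolding inf_from_def
    proof (rule cINF_greatest)
      show "{0..u} \<noteq> {}" using a u by simp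
      fix y assume y: "y \<in> {0..u}"
      show "x a \<le> x y"
      proof (cases "y \<le> a")
        case True
        then show ?thesis using inf_from_le[OF x, of 0 y a] y ga by simp
      next
        case False
        then show ?thesis using ge[of y] y u by auto
      qed
    qed
  qed
qed

locale excursion_path =
  fixes x h :: "real \<Rightarrow> real" and a b :: real and w :: "real \<Rightarrow> real"
  assumes reg: "regular_path x"
    and h: "\<And>t. 0 \<le> t \<Longrightarrow> h t = x t - inf_from x 0 t"
    and ab: "(a, b) \<in> excursion_intervals (\<lambda>t. x t - inf_from x 0 t)"
    and w: "w = stopped_excursion h (a, b)"
begin

lemma cont: "continuous_on {0..} x" by (rule regular_path_continuous[OF reg])

lemma a: "0 \<le> a" "a < b" using ab by (auto simp: excursion_intervals_def)

lemma w_in: "0 \<le> s \<Longrightarrow> s \<le> b - a \<Longrightarrow> w s = x (a + s) - x a"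
  using excursion_above_start(2)[OF cont ab, of "a + s"] a h[of "a + s"] by (simp add: w stopped_excursion_def)

lemma w_out: "b - a \<le> s \<Longrightarrow> w s = 0"
proof -
  assume s: "b - a \<le> s"
  have "h b = 0" using h[of b] a ab by (auto simp: excursion_intervals_def)
  then show ?thesis using s a by (simp add: w stopped_excursion_def)
qed

lemma w_pos: "0 < s \<Longrightarrow> s < b - a \<Longrightarrow> 0 < w s"
proof -
  assume s: "0 < s" "s < b - a"
  have "inf_from x 0 (a + s) < x (a + s)" using ab s by (auto simp: excursion_intervals_def)
  then show ?thesis using s a h[of "a + s"] by (simp add: w stopped_excursion_def)
qed

lemma alive_iff: "alive w p \<longleftrightarrow> rat_time p < b - a"
proof
  assume "alive w p"
  then obtain u where "rat_time p < rat_time u" "w (rat_time u) \<noteq> 0" by (auto simp: alive_def)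
  then show "rat_time p < b - a" using w_out[of "rat_time u"] by (cases "b - a \<le> rat_time u") auto
next
  assume "rat_time p < b - a"
  then obtain u where "rat_time p < rat_time u" "rat_time u < b - a" using rat_time_dense[of "rat_time p" "b - a"] by auto
  then show "alive w p" using w_pos[of "rat_time u"] rat_time_nonneg[of p] by (auto simp: alive_def intro!: exI[of _ u])
qed

text \<open>Choose a dyadic time in the excursion interval; the flat blocks after it end before the excursion does when
  \<open>n\<close> is large. Between grid points the modulus of continuity adds one more \<open>2\<^sup>-\<^sup>n\<close>, which makes
  \<open>3 \<cdot> 2\<^sup>-\<^sup>n\<close> around the start of the block and \<open>6 \<cdot> 2\<^sup>-\<^sup>n\<close> between two of its points.\<close>

lemma eventually_heavy: "\<forall>\<^sub>F n in sequentially. heavy_ball n w"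
proof -
  obtain m :: nat where m: "4 / (b - a) < 2 ^ m" using real_arch_pow[of 2 "4 / (b - a)"] by auto
  define i where "i = nat \<lfloor>a * 2 ^ m\<rfloor> + 1"
  have i: "a * 2 ^ m < real i" "real i \<le> a * 2 ^ m + 1" 
  proof -
    have "real i = of_int \<lfloor>a * 2 ^ m\<rfloor> + 1" using a by (simp add: i_def of_nat_nat)
    then show "a * 2 ^ m < real i" "real i \<le> a * 2 ^ m + 1" by linarith+
  qed
  define s0 where "s0 = real i / 2 ^ m"
  have s0: "a < s0" "s0 + 1 / 2 ^ m < b"
  proof -
    show "a < s0" using i by (simp add: s0_def less_divide_eq)
    have "s0 \<le> (a * 2 ^ m + 1) / 2 ^ m" unfolding s0_def using i by (intro divide_right_mono) auto
    then have "s0 + 1 / 2 ^ m \<le> a + 2 / 2 ^ m" by (simp add: add_divide_distrib)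
    also have "2 / 2 ^ m < b - a" using m a by (simp add: field_simps)
    finally show "s0 + 1 / 2 ^ m < b" by simp
  qed
  have e1: "\<forall>\<^sub>F n in sequentially. flat_blocks i m n x" and e2: "\<forall>\<^sub>F n in sequentially. modulus n x"
    using reg by (auto simp: regular_path_def)
  have "real (3 ^ n * (n * 2 ^ n)) * (1 / 8 ^ n) = real n * (3 / 4) ^ n" for n
  proof -
    have "(8::real) ^ n = 4 ^ n * 2 ^ n" by (simp flip: power_mult_distrib)
    then show ?thesis by (simp add: power_divide)
  qed
  moreover have "(\<lambda>n. real n * (3 / 4) ^ n) \<longlonglongrightarrow> 0" by real_asymp
  ultimately have "(\<lambda>n. real (3 ^ n * (n * 2 ^ n)) * (1 / 8 ^ n)) \<longlonglongrightarrow> 0" by simp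
  then have e3: "\<forall>\<^sub>F n in sequentially. real (3 ^ n * (n * 2 ^ n)) * (1 / 8 ^ n) < 1 / 2 ^ m"
    by (rule order_tendstoD(2)) simp
  have e4: "\<forall>\<^sub>F n in sequentially. b \<le> real n" by real_asymp
  show ?thesis
    using e1 e2 e3 e4 eventually_gt_at_top[of 0]
  proof eventually_elim
    case (elim n)
    define \<delta> :: real where "\<delta> = 1 / 8 ^ n"
    define L where "L = n * 2 ^ n"
    define \<rho> :: real where "\<rho> = 1 / 2 ^ n"
    have \<delta>: "0 < \<delta>" by (simp add: \<delta>_def)
    obtain j where j: "j < 3 ^ n" and fl: "\<And>l. l \<le> L \<Longrightarrow> \<bar>x (s0 + real (j * L + l) * \<delta>) - x (s0 + real (j * L) * \<delta>)\<bar> < 2 * \<rho>"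
      using elim(1) unfolding flat_blocks_def L_def \<delta>_def \<rho>_def s0_def by blast
    define u0 where "u0 = s0 + real (j * L) * \<delta>"
    have jL: "j * L + L \<le> 3 ^ n * L" using j mult_le_mono1[of "Suc j" "3 ^ n" L] by simp
    have "real (j * L + L) * \<delta> \<le> real (3 ^ n * L) * \<delta>" using jL \<delta> by (intro mult_right_mono of_nat_mono) auto
    also have "\<dots> < 1 / 2 ^ m" using elim(3) by (simp add: L_def \<delta>_def)
    finally have u0b: "u0 + real L * \<delta> < b" using s0 by (simp add: u0_def algebra_simps)
    have "0 \<le> real (j * L) * \<delta>" using \<delta> by simp
    then have u0a: "a < u0" using s0(1) unfolding u0_def by linarith
    have Ld: "real L * \<delta> = real n / 4 ^ n"
    proof -
      have "(8::real) ^ n = 2 ^ n * 4 ^ n" by (simp flip: power_mult_distrib)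
      then show ?thesis by (simp add: L_def \<delta>_def)
    qed
    have osc: "\<bar>x s - x u0\<bar> \<le> 3 * \<rho>" if s: "u0 \<le> s" "s \<le> u0 + real L * \<delta>" for s
    proof -
      define l where "l = nat \<lfloor>(s - u0) / \<delta>\<rfloor>"
      have "0 \<le> (s - u0) / \<delta>" using s \<delta> by simp
      then have l: "real l \<le> (s - u0) / \<delta>" "(s - u0) / \<delta> < real l + 1" by (auto simp: l_def of_nat_nat)
      have "(s - u0) / \<delta> \<le> real L" using s \<delta> by (simp add: field_simps)
      then have lL: "l \<le> L" using l by simp
      have ls: "real l * \<delta> \<le> s - u0" "s - u0 < real l * \<delta> + \<delta>" using l \<delta> by (auto simp: field_simps)
      have l0: "0 \<le> real l * \<delta>" using \<delta> by simp
      have "\<bar>x s - x (u0 + real l * \<delta>)\<bar> \<le> 1 / 2 ^ n"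
        by (rule modulusD[OF elim(2)]) (use ls l0 u0a u0b a s elim(4) in \<open>auto simp: \<delta>_def[symmetric]\<close>)
      moreover have "u0 + real l * \<delta> = s0 + real (j * L + l) * \<delta>" by (simp add: u0_def algebra_simps)
      then have "\<bar>x (u0 + real l * \<delta>) - x u0\<bar> < 2 * \<rho>" using fl[OF lL] by (simp only: u0_def[symmetric])
      ultimately show ?thesis by (simp add: \<rho>_def)
    qed
    have n0: "0 < real n / 4 ^ n" using elim(5) by simp
    obtain p where p: "u0 - a < rat_time p" "rat_time p < u0 - a + real n / 4 ^ n / 2"
      using rat_time_dense[of "u0 - a" "u0 - a + real n / 4 ^ n / 2"] n0 u0a by auto
    have pe: "a + rat_time p + real n / 4 ^ n / 2 < u0 + real L * \<delta>" unfolding Ld using p by simp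
    have pb: "rat_time p + real n / 4 ^ n / 2 < b - a" using pe u0b by simp
    have p0: "0 \<le> rat_time p + real n / 4 ^ n / 2" using rat_time_nonneg[of p] by simp
    obtain u where u: "rat_time p + real n / 4 ^ n / 2 < rat_time u" "rat_time u < b - a" using rat_time_dense[OF p0 pb] by blast
    have wp: "w (rat_time q) = x (a + rat_time q) - x a" "\<bar>x (a + rat_time q) - x u0\<bar> \<le> 3 * \<rho>" if "rat_time p \<le> rat_time q" "rat_time q \<le> rat_time p + real n / 4 ^ n / 2" for q
    proof -
      show "w (rat_time q) = x (a + rat_time q) - x a" by (rule w_in) (use that pb in auto)
      show "\<bar>x (a + rat_time q) - x u0\<bar> \<le> 3 * \<rho>" by (rule osc) (use that p(1) pe in auto)
    qed
    show ?case
      unfolding heavy_ball_def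
    proof (rule exI[of _ p], intro conjI allI impI)
      show "\<exists>u. rat_time p + real n / 4 ^ n / 2 < rat_time u \<and> w (rat_time u) \<noteq> 0"
      proof -
        have "0 < rat_time u" using u(1) p0 by linarith
        then have "w (rat_time u) \<noteq> 0" using w_pos[of "rat_time u"] u(2) by simp
        then show ?thesis using u(1) by blast
      qed
      fix q assume q: "rat_time p \<le> rat_time q \<and> rat_time q \<le> rat_time p + real n / 4 ^ n / 2"
      have pp: "rat_time p \<le> rat_time p" "rat_time p \<le> rat_time p + real n / 4 ^ n / 2" by auto
      show "\<bar>w (rat_time q) - w (rat_time p)\<bar> \<le> 6 * (1 / 2 ^ n)"
        unfolding \<rho>_def[symmetric] using wp[of q] wp[OF pp] q by (auto simp: abs_le_iff)
    qed
  qed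
qed

text \<open>From rational to real times, by continuity; the strict inequality becomes weak.\<close>

lemma near_real:
  assumes near: "near n w p q" and q: "rat_time q < b - a" and p: "rat_time p < b - a"
    and v: "(rat_time p \<le> v \<and> v \<le> rat_time q) \<or> (rat_time q \<le> v \<and> v \<le> rat_time p)"
  shows "x (a + rat_time p) - 1 / 2 ^ Suc n \<le> x (a + v)"
proof (rule ccontr)
  assume neg: "\<not> ?thesis"
  have v0: "0 \<le> v" "v < b - a" using v rat_time_nonneg[of p] rat_time_nonneg[of q] p q by linarith+
  define c where "c = w (rat_time p) - 1 / 2 ^ Suc n"
  have wp: "w (rat_time p) = x (a + rat_time p) - x a" by (rule w_in) (use p in auto)
  have xv: "x (a + v) - x a < c" using neg by (simp add: c_def wp)
  show False
  proof (cases "v = rat_time p \<or> v = rat_time q")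
    case True
    then show False
    proof
      assume "v = rat_time p"
      then show False using neg by simp
    next
      assume vq: "v = rat_time q"
      have "c < w (rat_time q)" using near v unfolding near_def c_def by (cases "rat_time p \<le> rat_time q") auto
      then show False using xv w_in[of v] v0 vq by simp
    qed
  next
    case False
    then have "v \<in> {min (rat_time p) (rat_time q)<..<max (rat_time p) (rat_time q)}" using v by auto
    then obtain e where e: "0 < e" "ball v e \<subseteq> {min (rat_time p) (rat_time q)<..<max (rat_time p) (rat_time q)}"
      by (rule openE[OF open_greaterThanLessThan])
    have "a + v \<in> {0..}" "0 < c - (x (a + v) - x a)" using a v0 xv by auto
    then obtain d where d: "0 < d" "\<forall>u\<in>{0..}. dist u (a + v) < d \<longrightarrow> dist (x u) (x (a + v)) < c - (x (a + v) - x a)"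
      using cont unfolding continuous_on_iff by blast
    obtain r where r: "v < rat_time r" "rat_time r < v + min e d" using rat_time_dense[of v "v + min e d"] v0 e d by auto
    have "rat_time r \<in> ball v e" using r by (auto simp: dist_real_def)
    then have rin: "rat_time r \<in> {min (rat_time p) (rat_time q)<..<max (rat_time p) (rat_time q)}" using e by blast
    then have "(rat_time p \<le> rat_time r \<and> rat_time r \<le> rat_time q) \<or> (rat_time q \<le> rat_time r \<and> rat_time r \<le> rat_time p)" by auto
    then have "c < w (rat_time r)" using near unfolding near_def c_def by blast
    moreover have "w (rat_time r) = x (a + rat_time r) - x a" by (rule w_in) (use rin p q in auto)
    moreover have "dist (x (a + rat_time r)) (x (a + v)) < c - (x (a + v) - x a)"
      using d(2) r a by (auto simp: dist_real_def)
    ultimately show False by (simp add: dist_real_def abs_less_iff)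
  qed
qed

text \<open>If \<open>q\<close> is near \<open>p\<close>, the path between them stays above its value at \<open>p\<close> minus \<open>\<rho> / 2\<close>, \<open>\<rho> = 2\<^sup>-\<^sup>n\<close>, and ends at
  most \<open>\<rho> / 2\<close> above. Replacing \<open>p\<close> and \<open>q\<close> by neighbouring grid points costs at most \<open>\<rho>\<close> each, hence the strip
  from \<open>- 2\<rho>\<close> to \<open>3\<rho>\<close>: the cell of \<open>q\<close> is found among the forward or backward visits of the cell of \<open>p\<close>.\<close>

lemma eventually_light: "\<forall>\<^sub>F n in sequentially. light_balls n w"
proof -
  have e1: "\<forall>\<^sub>F n in sequentially. few_visits n x" and e2: "\<forall>\<^sub>F n in sequentially. modulus n x"
    using reg by (auto simp: regular_path_def)
  have e4: "\<forall>\<^sub>F n in sequentially. b \<le> real n" by real_asymp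
  have vb: "1 \<le> visit_bound"
  proof (rule ccontr)
    assume "\<not> ?thesis"
    then have "visit_bound = 0" by simp
    then show False using visit_bound by simp
  qed
  show ?thesis
    using e1 e2 e4 eventually_gt_at_top[of 0]
  proof eventually_elim
    case (elim n)
    define N :: real where "N = 8 ^ n"
    define \<rho> :: real where "\<rho> = 1 / 2 ^ n"
    define V where "V = visit_bound * (n * 2 ^ n)"
    have N: "0 < N" by (simp add: N_def)
    have \<rho>2: "1 / 2 ^ Suc n = \<rho> / 2" by (simp add: \<rho>_def)
    have \<rho>: "0 < \<rho>" by (simp add: \<rho>_def)
    have mod: "\<bar>x s - x t\<bar> \<le> \<rho>" if "0 \<le> s" "s \<le> b" "0 \<le> t" "t \<le> b" "\<bar>s - t\<bar> \<le> 1 / N" for s t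
      unfolding \<rho>_def by (rule modulusD[OF elim(2)]) (use that elim(3) in \<open>auto simp: N_def\<close>)
    have V1: "1 \<le> V" using vb elim(4) by (simp add: V_def)
    show ?case
      unfolding light_balls_def
    proof (intro allI impI)
      fix p assume "alive w p"
      then have p: "rat_time p < b - a" by (simp add: alive_iff)
      define P where "P = a + rat_time p"
      have P: "a \<le> P" "P < b" using p by (auto simp: P_def)
      define k where "k = nat \<lfloor>P * N\<rfloor>"
      have "0 \<le> P * N" using P a N by simp
      then have k: "real k \<le> P * N" "P * N < real k + 1" by (auto simp: k_def of_nat_nat)
      have "P * N < real n * N" using P elim(3) N by (intro mult_strict_right_mono) auto
      then have "real k \<le> real n * N" using k by linarith
      then have "real k \<le> real (n * 8 ^ n)" by (simp add: N_def)
      then have kn: "k \<le> n * 8 ^ n" by (simp only: of_nat_le_iff)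
      have kP: "real k / N \<le> P" "P \<le> real k / N + 1 / N" using k N by (auto simp: field_simps)
      have k0: "0 \<le> real k / N" using N by simp
      have xk: "\<bar>x P - x (real k / N)\<bar> \<le> \<rho>" by (rule mod) (use P a kP k0 in auto)
      \<comment> \<open>Cells are named by their left end points. Going backwards from \<open>k\<close> the cell of \<open>q\<close> is first reached
        at its right end point, whence the shift by \<open>1\<close>.\<close>
      define J where "J = {k} \<union> (\<lambda>i. k + i) ` fwd_visits n k x \<union> (\<lambda>i. k - i - 1) ` bwd_visits n k x"
      have fin: "finite (fwd_visits n k x)" "finite (bwd_visits n k x)"
      proof -
        have "fwd_visits n k x \<subseteq> {..n * 8 ^ n}" by (auto simp: fwd_visits_def)
        then show "finite (fwd_visits n k x)" by (rule finite_subset) simp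
        have "bwd_visits n k x \<subseteq> {..k}" by (auto simp: bwd_visits_def)
        then show "finite (bwd_visits n k x)" by (rule finite_subset) simp
      qed
      have fJ: "finite J" using fin by (simp add: J_def)
      have cJ: "card J \<le> 3 * V"
      proof -
        have "card J \<le> card ({k} \<union> (\<lambda>i. k + i) ` fwd_visits n k x) + card ((\<lambda>i. k - i - 1) ` bwd_visits n k x)"
          unfolding J_def by (rule card_Un_le)
        also have "\<dots> \<le> card {k} + card ((\<lambda>i. k + i) ` fwd_visits n k x) + card ((\<lambda>i. k - i - 1) ` bwd_visits n k x)"
          by (intro add_right_mono card_Un_le)
        also have "\<dots> \<le> 1 + card (fwd_visits n k x) + card (bwd_visits n k x)"
          by (intro add_mono card_image_le fin) auto
        also have "\<dots> \<le> 1 + V + V" using elim(1) kn unfolding few_visits_def V_def by (intro add_mono) auto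
        also have "\<dots> \<le> 3 * V" using V1 by simp
        finally show ?thesis .
      qed
      \<comment> \<open>The start \<open>a\<close> of the excursion need not be rational; rounding it down doubles the length of a window.\<close>
      have "\<exists>c::rat. real j / N - a - 1 / N < of_rat c \<and> of_rat c < real j / N - a" for j :: nat
        using of_rat_dense[of "real j / N - a - 1 / N" "real j / N - a"] N by auto
      then obtain c :: "nat \<Rightarrow> rat" where c: "\<And>j. real j / N - a - 1 / N < of_rat (c j)" "\<And>j. of_rat (c j) < real j / N - a"
        by metis
      obtain Js where Js: "set Js = J" "length Js = card J"
        using finite_distinct_list[OF fJ] distinct_card by metis
      have cover: "\<exists>j\<in>J. real j / N \<le> a + rat_time q \<and> a + rat_time q \<le> real j / N + 1 / N" if "alive w q" and nq: "near n w p q" for q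
      proof -
        have q: "rat_time q < b - a" using that by (simp add: alive_iff)
        define Q where "Q = a + rat_time q"
        have Q: "a \<le> Q" "Q < b" using q by (auto simp: Q_def)
        define j where "j = nat \<lfloor>Q * N\<rfloor>"
        have "0 \<le> Q * N" using Q a N by simp
        then have j: "real j \<le> Q * N" "Q * N < real j + 1" by (auto simp: j_def of_nat_nat)
        have jQ: "real j / N \<le> Q" "Q \<le> real j / N + 1 / N" using j N by (auto simp: field_simps)
        have wpq: "w (rat_time p) = x P - x a" "w (rat_time q) = x Q - x a" unfolding P_def Q_def by (rule w_in; use p q in auto)+
        have xQ: "x Q < x P + \<rho> / 2" using nq wpq unfolding near_def \<rho>2 by simp
        have low: "- 2 * \<rho> < x g - x (real k / N)" if g: "(P \<le> g \<and> g \<le> Q) \<or> (Q \<le> g \<and> g \<le> P)" for g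
        proof -
          have "x P - \<rho> / 2 \<le> x (a + (g - a))" unfolding P_def \<rho>2[symmetric]
            by (rule near_real[OF nq q p]) (use g in \<open>auto simp: P_def Q_def\<close>)
          then have "x P - \<rho> / 2 \<le> x g" by simp
          then show ?thesis using xk \<rho> by linarith
        qed
        have "j \<in> J"
        proof (cases j k rule: linorder_cases)
          case equal
          then show ?thesis by (simp add: J_def)
        next
          case greater
          have "Q * N < real n * N" using Q elim(3) N by (intro mult_strict_right_mono) auto
          then have "real j \<le> real n * N" using j by linarith
          then have "real j \<le> real (n * 8 ^ n)" by (simp add: N_def)
          then have jn: "j \<le> n * 8 ^ n" by (simp only: of_nat_le_iff)
          have kj: "real k / N < real j / N" using greater N by (simp add: divide_strict_right_mono)
          have "j - k \<in> fwd_visits n k x"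
            unfolding fwd_visits_def
          proof (intro CollectI conjI allI impI)
            show "k + (j - k) \<le> n * 8 ^ n" using greater jn by simp
            fix i assume i: "i \<le> j - k"
            show "- 2 * (1 / 2 ^ n) < x (real (k + i) / 8 ^ n) - x (real k / 8 ^ n)"
            proof (cases "i = 0")
              case True
              then show ?thesis by simp
            next
              case False
              have "(real k + 1) / N \<le> real (k + i) / N" using False N by (intro divide_right_mono) auto
              then have g1: "P \<le> real (k + i) / N" using kP by (simp add: add_divide_distrib)
              have "k + i \<le> j" using i greater by simp
              then have "real (k + i) / N \<le> real j / N" using N by (intro divide_right_mono) auto
              then have g2: "real (k + i) / N \<le> Q" using jQ by linarith
              show ?thesis using low[of "real (k + i) / N"] g1 g2 unfolding \<rho>_def N_def by blast
            qed
          next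
            have "\<bar>x (real j / N) - x Q\<bar> \<le> \<rho>"
              by (rule mod) (use jQ Q a N in auto)
            then have "x (real j / N) - x (real k / N) < 3 * \<rho>" using xQ xk \<rho> by linarith
            then show "x (real (k + (j - k)) / 8 ^ n) - x (real k / 8 ^ n) < 3 * (1 / 2 ^ n)"
              using greater by (simp add: \<rho>_def N_def)
          qed
          then have "k + (j - k) \<in> J" unfolding J_def by blast
          then show ?thesis using greater by simp
        next
          case less
          define i0 where "i0 = k - (j + 1)"
          have i0: "i0 \<le> k" "k - i0 = j + 1" "k - i0 - 1 = j" using less by (auto simp: i0_def)
          have "i0 \<in> bwd_visits n k x"
            unfolding bwd_visits_def
          proof (intro CollectI conjI allI impI)
            show "i0 \<le> k" by (rule i0)
            fix i assume i: "i \<le> i0"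
            have "j + 1 \<le> k - i" using i less by (simp add: i0_def)
            then have "real (j + 1) / N \<le> real (k - i) / N" using N by (intro divide_right_mono of_nat_mono) auto
            then have g1: "Q \<le> real (k - i) / N" using jQ by (simp add: add_divide_distrib)
            have "real (k - i) / N \<le> real k / N" using N by (intro divide_right_mono of_nat_mono) auto
            then have g2: "real (k - i) / N \<le> P" using kP by linarith
            show "- 2 * (1 / 2 ^ n) < x (real (k - i) / 8 ^ n) - x (real k / 8 ^ n)"
              using low[of "real (k - i) / N"] g1 g2 unfolding \<rho>_def N_def by blast
          next
            have g1: "real (j + 1) / N \<le> real k / N" using less N by (intro divide_right_mono of_nat_mono) auto
            have g2: "real (j + 1) / N = real j / N + 1 / N" by (simp add: add_divide_distrib)
            have "\<bar>x (real (j + 1) / N) - x Q\<bar> \<le> \<rho>"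
              by (rule mod) (use jQ Q a N g1 g2 kP P in auto)
            then have "x (real (j + 1) / N) - x (real k / N) < 3 * \<rho>" using xQ xk \<rho> by linarith
            then show "x (real (k - i0) / 8 ^ n) - x (real k / 8 ^ n) < 3 * (1 / 2 ^ n)"
              unfolding i0(2) \<rho>_def N_def .
          qed
          then have "k - i0 - 1 \<in> J" unfolding J_def by blast
          then show ?thesis unfolding i0(3) .
        qed
        then show ?thesis using jQ unfolding Q_def by blast
      qed
      show "\<exists>C::rat list. length C \<le> 3 * visit_bound * (n * 2 ^ n) \<and>
         (\<forall>q. alive w q \<and> near n w p q \<longrightarrow> (\<exists>c\<in>set C. of_rat c \<le> rat_time q \<and> rat_time q \<le> of_rat c + 2 * (1 / 8 ^ n)))"
      proof (intro exI[of _ "map c Js"] conjI allI impI)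
        show "length (map c Js) \<le> 3 * visit_bound * (n * 2 ^ n)" using cJ Js by (simp add: V_def mult.assoc)
        fix q assume "alive w q \<and> near n w p q"
        then obtain j where j: "j \<in> J" "real j / N \<le> a + rat_time q" "a + rat_time q \<le> real j / N + 1 / N" using cover by blast
        show "\<exists>c\<in>set (map c Js). of_rat c \<le> rat_time q \<and> rat_time q \<le> of_rat c + 2 * (1 / 8 ^ n)"
        proof (rule bexI[of _ "c j"])
          show "c j \<in> set (map c Js)" using j(1) Js by simp
          have "1 / N = 1 / 8 ^ n" by (simp add: N_def)
          then show "of_rat (c j) \<le> rat_time q \<and> rat_time q \<le> of_rat (c j) + 2 * (1 / 8 ^ n)"
            using c[of j] j(2,3) by linarith
        qed
      qed
    qed
  qed
qed

lemma good: "good_path w"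
proof -
  have "\<forall>\<^sub>F n in sequentially. heavy_ball n w \<and> light_balls n w"
    using eventually_heavy eventually_light by eventually_elim simp
  then obtain N where N: "\<forall>n\<ge>N. heavy_ball n w \<and> light_balls n w" unfolding eventually_sequentially by blast
  obtain T :: nat where "b - a \<le> real T" using real_arch_simple by blast
  then have "\<forall>q. real T \<le> rat_time q \<longrightarrow> w (rat_time q) = 0" using w_out by auto
  then show ?thesis unfolding good_path_def using N by blast
qed

end

section \<open>Ball masses in the tree of a good path\<close>

lemma tree_ball_mass:
  assumes w: "continuous_on {0..} w" and s: "s \<in> {0..lifetime w}"
  shows "emeasure (mass_measure w) (tree_ball w (tree_proj w s) r) = emeasure lborel {t \<in> {0..lifetime w}. tree_pdist w s t < r}"
    and "{t \<in> {0..lifetime w}. tree_pdist w s t < r} \<in> sets lborel"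
proof -
  interpret T: Metric_space "tree w" "tree_dist w" by (rule Metric_space_tree[OF w])
  have in_ball: "tree_proj w t \<in> tree_ball w (tree_proj w s) r \<longleftrightarrow> tree_pdist w s t < r" if "t \<in> {0..lifetime w}" for t
    unfolding T.in_mball tree_dist_proj[OF w s that] using s that by (simp add: tree_eq[OF w])
  then have eq: "{t \<in> {0..lifetime w}. tree_proj w t \<in> tree_ball w (tree_proj w s) r} = {t \<in> {0..lifetime w}. tree_pdist w s t < r}"
    by blast
  show "emeasure (mass_measure w) (tree_ball w (tree_proj w s) r) = emeasure lborel {t \<in> {0..lifetime w}. tree_pdist w s t < r}"
    unfolding emeasure_mass_measure[OF w tree_ball_in_sets[OF w]] eq ..
  obtain V where V: "open V" "tree_proj w -` tree_ball w (tree_proj w s) r \<inter> {0..lifetime w} = {0..lifetime w} \<inter> V"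
    using openin_proj_vimage[OF w T.openin_mball] unfolding openin_open by blast
  have "{t \<in> {0..lifetime w}. tree_pdist w s t < r} = {0..lifetime w} \<inter> V"
    unfolding V(2)[symmetric] eq[symmetric] by blast
  then show "{t \<in> {0..lifetime w}. tree_pdist w s t < r} \<in> sets lborel" using V(1) by simp
qed

lemma rational_approx:
  fixes w :: "real \<Rightarrow> real"
  assumes w: "continuous_on {0..} w" and t: "0 \<le> t" "t < b" and e: "0 < e"
  obtains q where "t < rat_time q" "rat_time q < b" "\<bar>w (rat_time q) - w t\<bar> < e"
proof -
  have "t \<in> {0..}" using t by simp
  then obtain d where d: "0 < d" "\<forall>u\<in>{0..}. dist u t < d \<longrightarrow> dist (w u) (w t) < e"
    using w e unfolding continuous_on_iff by blast
  obtain q where q: "t < rat_time q" "rat_time q < min b (t + d)" using rat_time_dense[of t "min b (t + d)"] t d by auto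
  have "dist (w (rat_time q)) (w t) < e" using d(2) q t by (simp add: dist_real_def)
  then show ?thesis using that[of q] q by (simp add: dist_real_def)
qed

lemma dyadic_scale:
  fixes r :: real
  assumes r: "0 < r" "r < 1 / 2 ^ j"
  obtains m :: nat where "j \<le> m" "1 / 2 ^ Suc m < r" "r \<le> 1 / 2 ^ m"
proof -
  define m where "m = (LEAST i. 1 / 2 ^ Suc i < r)"
  have "\<exists>i. 1 / 2 ^ Suc i < r"
  proof -
    obtain i where "1 / r < 2 ^ i" using real_arch_pow[of 2 "1 / r"] by auto
    then have "1 / 2 ^ i < r" using r by (simp add: field_simps)
    moreover have "1 / 2 ^ Suc i \<le> (1 :: real) / 2 ^ i" by (simp add: field_simps)
    ultimately show ?thesis by (intro exI[of _ i]) linarith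
  qed
  then have 1: "1 / 2 ^ Suc m < r" unfolding m_def by (rule LeastI_ex)
  have 2: "r \<le> 1 / 2 ^ i" if "i \<le> m" "0 < i" for i
    using not_less_Least[of "i - 1" "\<lambda>i. 1 / 2 ^ Suc i < r"] that unfolding m_def[symmetric]
    by (cases i) (auto simp: not_less)
  have "(2 :: real) ^ j < 2 ^ Suc m"
  proof -
    have "1 / 2 ^ Suc m < (1 :: real) / 2 ^ j" using 1 r(2) by linarith
    then show ?thesis by (simp add: field_simps)
  qed
  then have jm: "j \<le> m" by (simp add: power_strict_increasing_iff del: power_Suc)
  have "r \<le> 1 / 2 ^ m"
  proof (cases "m = 0")
    case True
    then show ?thesis using r jm by simp
  next
    case False
    then show ?thesis using 2[of m] by simp
  qed
  then show ?thesis using that[of m] jm 1 by simp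
qed

lemma scale_bounds:
  fixes r :: real
  assumes r: "1 / 2 ^ Suc m < r" "r \<le> 1 / 2 ^ m"
  shows "real m / (8 * 4 ^ m) \<le> r\<^sup>2 * ln (1 / r)" "r\<^sup>2 * ln (1 / r) \<le> (real m + 1) / 4 ^ m"
proof -
  have r0: "0 < r" using r(1) by (rule less_trans[rotated]) simp
  have ln2: "1 / 2 \<le> ln (2 :: real)" "ln (2 :: real) \<le> 1" 
    using ln_2_less_1 ln_ge_iff[of "2::real" "1/2"] exp_half_le2 by auto
  have "2 ^ m \<le> 1 / r" using r r0 by (simp add: field_simps)
  then have "ln (2 ^ m) \<le> ln (1 / r)" by (rule ln_mono[rotated 2]) (use r0 in auto)
  then have "real m * ln 2 \<le> ln (1 / r)" by (simp add: ln_realpow)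
  then have l1: "real m / 2 \<le> ln (1 / r)" using mult_left_mono[OF ln2(1), of "real m"] by simp
  have "1 / r \<le> 2 ^ Suc m" using r r0 by (simp add: field_simps)
  then have "ln (1 / r) \<le> ln (2 ^ Suc m)" by (rule ln_mono[rotated 2]) (use r0 in auto)
  then have "ln (1 / r) \<le> real (Suc m) * ln 2" by (simp only: ln_realpow)
  moreover have "real (Suc m) * ln 2 \<le> real (Suc m) * 1" by (rule mult_left_mono[OF ln2(2)]) simp
  ultimately have "ln (1 / r) \<le> real (Suc m) * 1" by (rule order_trans)
  then have l2: "ln (1 / r) \<le> real m + 1" by simp
  have sq: "(1 / 2 ^ i)\<^sup>2 = (1 :: real) / 4 ^ i" for i :: nat
    by (simp add: power_divide flip: power_mult) (simp add: mult.commute[of i] power_mult)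
  have "(1 / 2 ^ Suc m)\<^sup>2 \<le> r\<^sup>2" by (rule power_mono) (use r in auto)
  then have r1: "1 / (4 * 4 ^ m) \<le> r\<^sup>2" unfolding sq by simp
  have "r\<^sup>2 \<le> (1 / 2 ^ m)\<^sup>2" by (rule power_mono) (use r r0 in auto)
  then have r2: "r\<^sup>2 \<le> 1 / 4 ^ m" unfolding sq .
  have "1 / (4 * 4 ^ m) * (real m / 2) \<le> r\<^sup>2 * ln (1 / r)" by (rule mult_mono[OF r1 l1]) auto
  then show "real m / (8 * 4 ^ m) \<le> r\<^sup>2 * ln (1 / r)" by simp
  have "r\<^sup>2 * ln (1 / r) \<le> 1 / 4 ^ m * (real m + 1)" by (rule mult_mono[OF r2 l2]) (use l1 in auto)
  then show "r\<^sup>2 * ln (1 / r) \<le> (real m + 1) / 4 ^ m" by simp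
qed

locale good_tree =
  fixes w :: "real \<Rightarrow> real"
  assumes good: "good_path w" and w: "continuous_on {0..} w"
begin

lemma support_bounded: "bdd_above {t. 0 \<le> t \<and> w t \<noteq> 0}"
proof -
  obtain T :: nat where T: "\<And>q. real T \<le> rat_time q \<Longrightarrow> w (rat_time q) = 0" using good unfolding good_path_def by blast
  have "t \<le> real T" if t: "0 \<le> t" "w t \<noteq> 0" for t
  proof (rule ccontr)
    assume neg: "\<not> t \<le> real T"
    obtain q where "t < rat_time q" "rat_time q < t + 1" "\<bar>w (rat_time q) - w t\<bar> < \<bar>w t\<bar>"
      by (rule rational_approx[OF w t(1), of "t + 1" "\<bar>w t\<bar>"]) (use t in auto)
    then show False using T[of q] neg by auto
  qed
  then show ?thesis by (auto intro!: bdd_aboveI[of _ "real T"])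
qed

lemma le_lifetime: "0 \<le> t \<Longrightarrow> w t \<noteq> 0 \<Longrightarrow> t \<le> lifetime w"
  unfolding lifetime_def by (rule cSup_upper[OF _ support_bounded]) simp

lemma eventually_balls: "\<forall>\<^sub>F n in sequentially. heavy_ball n w \<and> light_balls n w"
  using good unfolding good_path_def eventually_sequentially by blast

lemma lifetime_pos: "0 < lifetime w"
proof -
  obtain n where "heavy_ball n w" using eventually_balls unfolding eventually_sequentially by blast
  then obtain p u where u: "rat_time p + real n / 4 ^ n / 2 < rat_time u" "w (rat_time u) \<noteq> 0" unfolding heavy_ball_def by blast
  have "0 \<le> rat_time p + real n / 4 ^ n / 2" by simp
  then have "0 < rat_time u" using u(1) by linarith
  then show ?thesis using le_lifetime[of "rat_time u"] u(2) by simp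
qed

lemma alive: "rat_time p < lifetime w \<Longrightarrow> alive w p"
proof -
  assume "rat_time p < lifetime w"
  moreover have "{t. 0 \<le> t \<and> w t \<noteq> 0} \<noteq> {}"
  proof -
    obtain n where "heavy_ball n w" using eventually_balls unfolding eventually_sequentially by blast
    then obtain u where "w (rat_time u) \<noteq> 0" unfolding heavy_ball_def by blast
    then show ?thesis using rat_time_nonneg[of u] by blast
  qed
  ultimately obtain t where t: "0 \<le> t" "w t \<noteq> 0" "rat_time p < t"
    unfolding lifetime_def less_cSup_iff[OF \<open>_ \<noteq> {}\<close> support_bounded] by blast
  obtain u where "t < rat_time u" "rat_time u < t + 1" "\<bar>w (rat_time u) - w t\<bar> < \<bar>w t\<bar>"
    by (rule rational_approx[OF w t(1), of "t + 1" "\<bar>w t\<bar>"]) (use t in auto)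
  then show "alive w p" using t unfolding alive_def by (intro exI[of _ u]) auto
qed

lemma pdist_near: "tree_pdist w (rat_time p) (rat_time q) < 1 / 2 ^ Suc n \<Longrightarrow> near n w p q"
proof -
  assume d: "tree_pdist w (rat_time p) (rat_time q) < 1 / 2 ^ Suc n"
  define m where "m = (INF r\<in>{min (rat_time p) (rat_time q)..max (rat_time p) (rat_time q)}. w r)"
  have m: "m \<le> w v" if "min (rat_time p) (rat_time q) \<le> v" "v \<le> max (rat_time p) (rat_time q)" for v
    unfolding m_def by (rule path_Inf_le[OF w]) (use that in auto)
  have d': "w (rat_time p) + w (rat_time q) - 2 * m < 1 / 2 ^ Suc n" using d by (simp add: tree_pdist_def m_def)
  have mp: "m \<le> w (rat_time p)" "m \<le> w (rat_time q)" by (auto intro: m)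
  have "w (rat_time p) - 1 / 2 ^ Suc n < w v" if "(rat_time p \<le> v \<and> v \<le> rat_time q) \<or> (rat_time q \<le> v \<and> v \<le> rat_time p)" for v
    using m[of v] that d' mp by auto
  then show ?thesis unfolding near_def using d' mp by auto
qed

lemma rational_near:
  assumes s: "s \<in> {0..lifetime w}" and e: "0 < e" and d: "0 < d"
  obtains p where "rat_time p < lifetime w" "\<bar>rat_time p - s\<bar> < d" "tree_pdist w s (rat_time p) < e"
proof -
  obtain d' where d': "0 < d'" "\<And>t. 0 \<le> t \<Longrightarrow> \<bar>t - s\<bar> < d' \<Longrightarrow> tree_pdist w s t < e"
    by (rule tree_pdist_small[OF w _ e, of s]) (use s in auto)
  define c where "c = min d d'"
  have "0 \<le> max 0 (s - c)" "max 0 (s - c) < min (s + c) (lifetime w)"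
    using s d d'(1) lifetime_pos by (auto simp: c_def)
  then obtain p where p: "max 0 (s - c) < rat_time p" "rat_time p < min (s + c) (lifetime w)" by (rule rat_time_dense)
  then have "\<bar>rat_time p - s\<bar> < c" by auto
  then show ?thesis using that[of p] d'(2)[of "rat_time p"] p by (simp add: c_def)
qed

text \<open>The windows of \<open>light_balls\<close> cover all rational times of the ball, and their union is closed. The radius
  \<open>2\<^sup>-\<^sup>n / 8\<close> leaves room for replacing both the centre and the point by rational times:
  \<open>3 / 8 < 1 / 2\<close>.\<close>

lemma ball_mass_le:
  assumes light: "light_balls n w" and s: "s \<in> {0..lifetime w}" and r: "r \<le> 1 / 2 ^ (n + 3)"
  shows "emeasure lborel {t \<in> {0..lifetime w}. tree_pdist w s t < r} \<le> ennreal (6 * real visit_bound * (real n / 4 ^ n))"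
proof -
  have e: "(0::real) < 1 / 2 ^ (n + 3)" by simp
  obtain p where p: "rat_time p < lifetime w" "tree_pdist w s (rat_time p) < 1 / 2 ^ (n + 3)"
    by (rule rational_near[OF s e zero_less_one])
  obtain C :: "rat list" where C: "length C \<le> 3 * visit_bound * (n * 2 ^ n)"
    "\<And>q. alive w q \<Longrightarrow> near n w p q \<Longrightarrow> \<exists>c\<in>set C. of_rat c \<le> rat_time q \<and> rat_time q \<le> of_rat c + 2 * (1 / 8 ^ n)"
    using light alive[OF p(1)] unfolding light_balls_def by blast
  define V where "V = (\<Union>c\<in>set C. {real_of_rat c..of_rat c + 2 * (1 / 8 ^ n)})"
  have V: "closed V" unfolding V_def by (intro closed_UN) auto
  have "{t \<in> {0..lifetime w}. tree_pdist w s t < r} \<subseteq> V"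
  proof (rule subsetI, rule ccontr)
    fix t assume t: "t \<in> {t \<in> {0..lifetime w}. tree_pdist w s t < r}" and "t \<notin> V"
    then have "t \<in> - V" "open (- V)" using V by auto
    then obtain d where d: "0 < d" "ball t d \<subseteq> - V" using openE by blast
    have t': "t \<in> {0..lifetime w}" using t by simp
    obtain q where q: "rat_time q < lifetime w" "\<bar>rat_time q - t\<bar> < d" "tree_pdist w t (rat_time q) < 1 / 2 ^ (n + 3)"
      by (rule rational_near[OF t' e d(1)])
    have "tree_pdist w (rat_time p) (rat_time q) \<le> tree_pdist w (rat_time p) s + tree_pdist w s (rat_time q)"
      by (rule tree_pdist_triangle[OF w]) (use s in auto)
    also have "tree_pdist w s (rat_time q) \<le> tree_pdist w s t + tree_pdist w t (rat_time q)"
      by (rule tree_pdist_triangle[OF w]) (use s t in auto)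
    also have "tree_pdist w (rat_time p) s = tree_pdist w s (rat_time p)" by (rule tree_pdist_commute[OF w])
    finally have "tree_pdist w (rat_time p) (rat_time q) < 3 * (1 / 2 ^ (n + 3))" using p(2) q(3) t r by auto
    also have "\<dots> \<le> 1 / 2 ^ Suc n" by (simp add: power_add field_simps)
    finally have "near n w p q" by (rule pdist_near)
    then have "rat_time q \<in> V" using C(2)[OF alive[OF q(1)]] by (auto simp: V_def)
    moreover have "rat_time q \<in> ball t d" using q(2) by (simp add: dist_real_def abs_minus_commute)
    ultimately show False using d(2) by blast
  qed
  then have "emeasure lborel {t \<in> {0..lifetime w}. tree_pdist w s t < r} \<le> emeasure lborel V"
    using V by (intro emeasure_mono) auto
  also have "\<dots> \<le> (\<Sum>c\<in>set C. emeasure lborel {real_of_rat c..of_rat c + 2 * (1 / 8 ^ n)})"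
    unfolding V_def by (rule emeasure_subadditive_finite) auto
  also have "\<dots> = of_nat (card (set C)) * ennreal (2 * (1 / 8 ^ n))" by simp
  also have "\<dots> = ennreal (real (card (set C)) * (2 * (1 / 8 ^ n)))"
    by (simp only: ennreal_of_nat_eq_real_of_nat) (rule ennreal_mult[symmetric], auto)
  also have "\<dots> \<le> ennreal (6 * real visit_bound * (real n / 4 ^ n))"
  proof (rule ennreal_leI)
    have "card (set C) \<le> 3 * visit_bound * (n * 2 ^ n)" using card_length[of C] C(1) by linarith
    then have "real (card (set C)) * (2 * (1 / 8 ^ n)) \<le> real (3 * visit_bound * (n * 2 ^ n)) * (2 * (1 / 8 ^ n))"
      by (intro mult_right_mono of_nat_mono) auto
    also have "(8::real) ^ n = 2 ^ n * 4 ^ n" by (simp flip: power_mult_distrib)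
    then have "real (3 * visit_bound * (n * 2 ^ n)) * (2 * (1 / 8 ^ n)) = 6 * real visit_bound * (real n / 4 ^ n)" by simp
    finally show "real (card (set C)) * (2 * (1 / 8 ^ n)) \<le> 6 * real visit_bound * (real n / 4 ^ n)" .
  qed
  finally show ?thesis .
qed

text \<open>On the interval of \<open>heavy_ball\<close> the path differs from its initial value by at most \<open>6 \<cdot> 2\<^sup>-\<^sup>n\<close>, so
  the tree distance to the initial point is at most \<open>18 \<cdot> 2\<^sup>-\<^sup>n\<close>; \<open>32\<close> is the next power of \<open>2\<close>.\<close>

lemma ball_mass_ge:
  assumes heavy: "heavy_ball n w" and r: "32 / 2 ^ n \<le> r"
  shows "\<exists>s\<in>{0..lifetime w}. ennreal (real n / 4 ^ n / 2) \<le> emeasure lborel {t \<in> {0..lifetime w}. tree_pdist w s t < r}"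
proof -
  define l where "l = real n / 4 ^ n / 2"
  have l0: "0 \<le> l" by (simp add: l_def)
  obtain p u where u: "rat_time p + l < rat_time u" "w (rat_time u) \<noteq> 0"
    and flat: "\<And>q. rat_time p \<le> rat_time q \<Longrightarrow> rat_time q \<le> rat_time p + l \<Longrightarrow> \<bar>w (rat_time q) - w (rat_time p)\<bar> \<le> 6 * (1 / 2 ^ n)"
    using heavy unfolding heavy_ball_def l_def by blast
  have ul: "rat_time u \<le> lifetime w" by (rule le_lifetime) (use u in auto)
  have flat': "\<bar>w t - w (rat_time p)\<bar> \<le> 6 * (1 / 2 ^ n)" if t: "rat_time p \<le> t" "t < rat_time p + l" for t
  proof (rule field_le_epsilon)
    fix e :: real assume e: "0 < e"
    have "0 \<le> t" using t rat_time_nonneg[of p] by linarith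
    then obtain q where q: "t < rat_time q" "rat_time q < rat_time p + l" "\<bar>w (rat_time q) - w t\<bar> < e" 
      using t(2) e by (rule rational_approx[OF w])
    then show "\<bar>w t - w (rat_time p)\<bar> \<le> 6 * (1 / 2 ^ n) + e" using flat[of q] t by auto
  qed
  have sub: "{rat_time p..<rat_time p + l} \<subseteq> {t \<in> {0..lifetime w}. tree_pdist w (rat_time p) t < r}"
  proof
    fix t assume t: "t \<in> {rat_time p..<rat_time p + l}"
    have "w (rat_time p) - 6 * (1 / 2 ^ n) \<le> (INF v\<in>{rat_time p..t}. w v)"
    proof (rule cINF_greatest)
      fix v assume v: "v \<in> {rat_time p..t}"
      have "\<bar>w v - w (rat_time p)\<bar> \<le> 6 * (1 / 2 ^ n)" by (rule flat') (use v t in auto)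
      then show "w (rat_time p) - 6 * (1 / 2 ^ n) \<le> w v" by linarith
    qed (use t in auto)
    moreover have "\<bar>w t - w (rat_time p)\<bar> \<le> 6 * (1 / 2 ^ n)" by (rule flat') (use t in auto)
    moreover have "tree_pdist w (rat_time p) t = w (rat_time p) + w t - 2 * (INF v\<in>{rat_time p..t}. w v)"
      using t by (simp add: tree_pdist_def)
    ultimately have "tree_pdist w (rat_time p) t \<le> 18 * (1 / 2 ^ n)" by linarith
    also have "\<dots> < 32 / 2 ^ n" by (simp add: divide_strict_right_mono)
    also note r
    finally show "t \<in> {t \<in> {0..lifetime w}. tree_pdist w (rat_time p) t < r}"
      using t u ul rat_time_nonneg[of p] by (auto simp del: rat_time_nonneg)
  qed
  have p: "rat_time p \<in> {0..lifetime w}" using u ul l0 by auto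
  have "ennreal l = emeasure lborel {rat_time p..<rat_time p + l}" using l0 by simp
  also have "\<dots> \<le> emeasure lborel {t \<in> {0..lifetime w}. tree_pdist w (rat_time p) t < r}"
    by (rule emeasure_mono[OF sub tree_ball_mass(2)[OF w p]])
  finally show ?thesis using p unfolding l_def by blast
qed

definition largest_ball :: "real \<Rightarrow> ennreal" where
  "largest_ball r = (SUP \<sigma>\<in>tree w. emeasure (mass_measure w) (tree_ball w \<sigma> r))"

lemma largest_ball_eq:
  "largest_ball r = (SUP s\<in>{0..lifetime w}. emeasure lborel {t \<in> {0..lifetime w}. tree_pdist w s t < r})"
  proof -
  have "largest_ball r = (SUP s\<in>{0..lifetime w}. emeasure (mass_measure w) (tree_ball w (tree_proj w s) r))"
    unfolding largest_ball_def by (subst (1) tree_eq[OF w]) (simp only: image_image)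
  also have "\<dots> = (SUP s\<in>{0..lifetime w}. emeasure lborel {t \<in> {0..lifetime w}. tree_pdist w s t < r})"
    by (rule SUP_cong[OF refl tree_ball_mass(1)[OF w]])
  finally show ?thesis .
qed

text \<open>For \<open>2\<^sup>-\<^sup>m\<^sup>-\<^sup>1 < r \<le> 2\<^sup>-\<^sup>m\<close> the lower bound is taken at scale \<open>m + 6\<close>, where \<open>32 \<cdot> 2\<^sup>-\<^sup>m\<^sup>-\<^sup>6 < r\<close>, and the upper bound
  at scale \<open>m - 3\<close>, where \<open>r \<le> 2\<^sup>-\<^sup>m = 2\<^sup>-\<^sup>(\<^sup>m\<^sup>-\<^sup>3\<^sup>) / 8\<close>. The constants are \<open>2 \<cdot> 4\<^sup>6 = 8192\<close> and
  \<open>6 \<cdot> 4\<^sup>3 \<cdot> 8 = 3072\<close>.\<close>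

lemma largest_ball_bounds:
  "\<forall>\<^sub>F r in at_right 0. 0 < r\<^sup>2 * ln (1 / r) \<and> ennreal (1 / 8192 * (r\<^sup>2 * ln (1 / r))) \<le> largest_ball r \<and>
     largest_ball r \<le> ennreal (3072 * real visit_bound * (r\<^sup>2 * ln (1 / r)))"
proof -
  obtain N where N: "\<And>n. N \<le> n \<Longrightarrow> heavy_ball n w \<and> light_balls n w"
    using eventually_balls unfolding eventually_sequentially by blast
  have *: "0 < r\<^sup>2 * ln (1 / r) \<and> ennreal (1 / 8192 * (r\<^sup>2 * ln (1 / r))) \<le> largest_ball r \<and>
     largest_ball r \<le> ennreal (3072 * real visit_bound * (r\<^sup>2 * ln (1 / r)))" if r: "0 < r" "r < 1 / 2 ^ (N + 4)" for r
  proof -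
    obtain m where m: "N + 4 \<le> m" "1 / 2 ^ Suc m < r" "r \<le> 1 / 2 ^ m" by (rule dyadic_scale[OF r])
    define f where "f = r\<^sup>2 * ln (1 / r)"
    have f: "real m / (8 * 4 ^ m) \<le> f" "f \<le> (real m + 1) / 4 ^ m" unfolding f_def by (rule scale_bounds[OF m(2,3)])+
    have "0 < real m / (8 * 4 ^ m)" using m by simp
    then have f0: "0 < f" using f by linarith
    have "ennreal (1 / 8192 * f) \<le> largest_ball r"
    proof -
      have "heavy_ball (m + 6) w" using N m by simp
      moreover have "32 / 2 ^ (m + 6) \<le> r" using m(2) by (simp add: power_add)
      ultimately obtain s where s: "s \<in> {0..lifetime w}" 
        "ennreal (real (m + 6) / 4 ^ (m + 6) / 2) \<le> emeasure lborel {t \<in> {0..lifetime w}. tree_pdist w s t < r}"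
        using ball_mass_ge by blast
      have "1 / 8192 * f \<le> 1 / 8192 * ((real m + 1) / 4 ^ m)" using f(2) by (intro mult_left_mono) auto
      also have "\<dots> \<le> real (m + 6) / 4 ^ (m + 6) / 2" by (simp add: power_add divide_right_mono)
      finally have "ennreal (1 / 8192 * f) \<le> ennreal (real (m + 6) / 4 ^ (m + 6) / 2)" by (rule ennreal_leI)
      also note s(2)
      also have "emeasure lborel {t \<in> {0..lifetime w}. tree_pdist w s t < r} \<le> largest_ball r"
        unfolding largest_ball_eq by (rule SUP_upper[OF s(1)])
      finally show ?thesis .
    qed
    moreover have "largest_ball r \<le> ennreal (3072 * real visit_bound * f)"
      unfolding largest_ball_eq
    proof (rule SUP_least)
      fix s assume s: "s \<in> {0..lifetime w}"
      define n where "n = m - 3"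
      have mn: "m = n + 3" using m(1) by (simp add: n_def)
      have "light_balls n w" using N m by (simp add: n_def)
      then have "emeasure lborel {t \<in> {0..lifetime w}. tree_pdist w s t < r} \<le> ennreal (6 * real visit_bound * (real n / 4 ^ n))"
        by (rule ball_mass_le[OF _ s]) (use m(3) mn in simp)
      also have "\<dots> \<le> ennreal (3072 * real visit_bound * f)"
      proof (rule ennreal_leI)
        have "6 * real visit_bound * (real n / 4 ^ n) \<le> 3072 * real visit_bound * (real m / (8 * 4 ^ m))"
          unfolding mn by (simp add: power_add field_simps)
        also have "\<dots> \<le> 3072 * real visit_bound * f" using f(1) by (rule mult_left_mono) simp
        finally show "6 * real visit_bound * (real n / 4 ^ n) \<le> 3072 * real visit_bound * f" .
      qed
      finally show "emeasure lborel {t \<in> {0..lifetime w}. tree_pdist w s t < r} \<le> ennreal (3072 * real visit_bound * f)" .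
    qed
    ultimately show ?thesis using f0 unfolding f_def by blast
  qed
  show ?thesis
    unfolding eventually_at_right_field by (rule exI[of _ "1 / 2 ^ (N + 4)"]) (use * in auto)
qed

lemma ball_mass_limits:
  defines "S \<equiv> \<lambda>r::real. (1 / ennreal (r\<^sup>2 * ln (1 / r))) * largest_ball r"
  shows "ennreal (1 / 8192) \<le> Liminf (at_right 0) S" "Liminf (at_right 0) S \<le> Limsup (at_right 0) S"
    "Limsup (at_right 0) S \<le> ennreal (3072 * real visit_bound)"
proof -
  have div: "1 / ennreal f * ennreal (c * f) = ennreal c" if "0 < f" "0 \<le> c" for c f
    using that by (simp add: divide_ennreal flip: ennreal_1 ennreal_mult)
  have ev: "\<forall>\<^sub>F r in at_right 0. ennreal (1 / 8192) \<le> S r \<and> S r \<le> ennreal (3072 * real visit_bound)"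
    using largest_ball_bounds
  proof eventually_elim
    case (elim r)
    define f where "f = r\<^sup>2 * ln (1 / r)"
    have f: "0 < f" "ennreal (1 / 8192 * f) \<le> largest_ball r" "largest_ball r \<le> ennreal (3072 * real visit_bound * f)"
      using elim unfolding f_def by blast+
    have S: "S r = 1 / ennreal f * largest_ball r" by (simp add: S_def f_def)
    have "1 / ennreal f * ennreal (1 / 8192 * f) \<le> S r" "S r \<le> 1 / ennreal f * ennreal (3072 * real visit_bound * f)"
      unfolding S by (rule mult_left_mono[OF f(2)], simp, rule mult_left_mono[OF f(3)], simp)
    then show ?case using f(1) by (simp only: div)
  qed
  show "ennreal (1 / 8192) \<le> Liminf (at_right 0) S"
    by (rule Liminf_bounded) (use ev in eventually_elim, blast)
  show "Limsup (at_right 0) S \<le> ennreal (3072 * real visit_bound)"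
    by (rule Limsup_bounded) (use ev in eventually_elim, blast)
  show "Liminf (at_right 0) S \<le> Limsup (at_right 0) S"
    by (rule Liminf_le_Limsup) (rule trivial_limit_at_right_real)
qed

end

section \<open>Passing to the excursion measure\<close>

lemma regular_excursions_good:
  assumes x: "regular_path x" "x 0 = 0" and h: "continuous_on {0..} h" "\<And>t. 0 \<le> t \<Longrightarrow> h t = x t - inf_from x 0 t"
    and N: "sets N = sets path_space" and B: "B \<in> sets N" "\<And>w. w \<in> B \<Longrightarrow> \<not> good_path w"
  shows "emeasure (excursion_point_measure x h N) ({0..} \<times> B) = 0"
proof -
  let ?E = "excursion_intervals (\<lambda>t. x t - inf_from x 0 t)"
  let ?g = "\<lambda>j. (- inf_from x 0 (fst j), stopped_excursion h j)"
  have cont: "continuous_on {0..} x" by (rule regular_path_continuous[OF x(1)])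
  have g: "?g \<in> count_space ?E \<rightarrow>\<^sub>M restrict_space lborel {0..} \<Otimes>\<^sub>M N"
  proof (subst measurable_count_space_eq1, rule Pi_I)
    fix j assume j: "j \<in> ?E"
    obtain a b where ab: "j = (a, b)" by (cases j)
    have a: "0 \<le> a" "a < b" using j by (auto simp: ab excursion_intervals_def)
    have "inf_from x 0 a \<le> x 0" by (rule inf_from_le[OF cont]) (use a in auto)
    moreover have "stopped_excursion h j \<in> space N"
      unfolding sets_eq_imp_space_eq[OF N] ab by (rule stopped_excursion_in_path_space[OF h(1) a])
    ultimately show "?g j \<in> space (restrict_space lborel {0..} \<Otimes>\<^sub>M N)"
      using x(2) by (simp add: space_pair_measure space_restrict_space ab)
  qed
  have "{0..} \<in> sets (restrict_space lborel {0::real..})" by (simp add: sets_restrict_space_iff)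
  then have "{0..} \<times> B \<in> sets (restrict_space lborel {0::real..} \<Otimes>\<^sub>M N)" using B(1) by (rule pair_measureI)
  then have "emeasure (excursion_point_measure x h N) ({0..} \<times> B) = emeasure (count_space ?E) (?g -` ({0..} \<times> B) \<inter> ?E)"
    unfolding excursion_point_measure_def by (subst emeasure_distr[OF g]) simp_all
  also have "?g -` ({0..} \<times> B) \<inter> ?E = {}"
  proof -
    have "good_path (stopped_excursion h (a, b))" if "(a, b) \<in> ?E" for a b
    proof -
      interpret excursion_path x h a b "stopped_excursion h (a, b)"
        by unfold_locales (use x h that in auto)
      show ?thesis by (rule good)
    qed
    then show ?thesis using B(2) by auto
  qed
  finally show ?thesis by simp
qed

text \<open>A set \<open>[0, \<infinity>) \<times> B\<close> with \<open>N B > 0\<close> has infinite intensity, so the point measure almost surely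
  charges it; but almost surely none of its points is bad.\<close>

lemma (in height_excursion_measure) AE_good_path: "AE w in N. good_path w"
proof -
  interpret N: sigma_finite_measure N by (rule sigma_finite_N)
  define B where "B = {w \<in> space N. \<not> good_path w}"
  have "Measurable.pred N good_path"
    using good_path_measurable measurable_cong_sets[OF sets_N refl] by blast
  then have "Measurable.pred N (\<lambda>w. \<not> good_path w)" by (rule pred_intros_logic)
  then have B: "B \<in> sets N" unfolding B_def by (rule predE)
  have "emeasure N B = 0"
  proof (rule ccontr)
    assume pos: "emeasure N B \<noteq> 0"
    let ?\<mu> = "restrict_space lborel {0::real..} \<Otimes>\<^sub>M N"
    have half: "{0..} \<in> sets (restrict_space lborel {0::real..})" by (simp add: sets_restrict_space_iff)
    have "emeasure (restrict_space lborel {0::real..}) {0..} = \<infinity>"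
    proof -
      have "emeasure lborel {0..(real n)} \<le> emeasure lborel {0::real..}" for n by (rule emeasure_mono) auto
      then have "of_nat n \<le> emeasure lborel {0::real..}" for n by (simp add: ennreal_of_nat_eq_real_of_nat)
      then have "emeasure lborel {0::real..} = top"
        using ennreal_Ex_less_of_nat[of "emeasure lborel {0::real..}"] by (auto simp: less_top[symmetric] leD)
      then show ?thesis by (simp add: emeasure_restrict_space)
    qed
    then have "emeasure ?\<mu> ({0..} \<times> B) = \<infinity>"
      using pos by (simp add: N.emeasure_pair_measure_Times[OF half B] ennreal_top_mult)
    then have "AE \<omega> in M. emeasure (excursion_point_measure (\<lambda>t. X t \<omega>) (\<lambda>t. H t \<omega>) N) ({0..} \<times> B) = \<infinity>"
      using poisson_excursions pair_measureI[OF half B] unfolding poisson_point_measure_def by blast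
    moreover have "AE \<omega> in M. emeasure (excursion_point_measure (\<lambda>t. X t \<omega>) (\<lambda>t. H t \<omega>) N) ({0..} \<times> B) = 0"
      using AE_H_reflected AE_space
    proof eventually_elim
      case (elim \<omega>)
      show ?case
        by (rule regular_excursions_good[OF _ _ _ _ sets_N B]) (use elim start H_paths in \<open>auto simp: B_def\<close>)
    qed
    ultimately have "AE \<omega> in M. False" by eventually_elim simp
    then show False by simp
  qed
  then show ?thesis using B by (intro AE_I[of _ _ B]) (auto simp: B_def)
qed

theorem theorem1p4:
  shows "\<exists>k K :: real. 0 < k \<and> 0 < K \<and>
    (\<forall>(M :: 'a measure) X H N. height_excursion_measure M X H N \<longrightarrow>
      (AE w in N.
        let f = (\<lambda>r::real. r\<^sup>2 * ln (1 / r));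
            S = (\<lambda>r::real. (1 / ennreal (f r)) *
                   (SUP \<sigma>\<in>tree w. emeasure (mass_measure w) (tree_ball w \<sigma> r)))
        in ennreal k \<le> Liminf (at_right 0) S \<and>
           Liminf (at_right 0) S \<le> Limsup (at_right 0) S \<and>
           Limsup (at_right 0) S \<le> ennreal K))"
proof (rule exI[of _ "1 / 8192"], rule exI[of _ "3072 * real visit_bound"], intro conjI allI impI)
  show "0 < 3072 * real visit_bound" using visit_bound by (cases "visit_bound = 0") auto
  fix M :: "'a measure" and X H N
  assume "height_excursion_measure M X H N"
  then interpret height_excursion_measure M X H N .
  show "AE w in N.
        let f = (\<lambda>r::real. r\<^sup>2 * ln (1 / r));
            S = (\<lambda>r::real. (1 / ennreal (f r)) *
                   (SUP \<sigma>\<in>tree w. emeasure (mass_measure w) (tree_ball w \<sigma> r)))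
        in ennreal (1 / 8192) \<le> Liminf (at_right 0) S \<and>
           Liminf (at_right 0) S \<le> Limsup (at_right 0) S \<and>
           Limsup (at_right 0) S \<le> ennreal (3072 * real visit_bound)"
    using AE_good_path AE_space
  proof eventually_elim
    case (elim w)
    interpret good_tree w
      by unfold_locales (use elim path_space_D[of w] sets_eq_imp_space_eq[OF sets_N] in auto)
    show ?case unfolding Let_def using ball_mass_limits unfolding largest_ball_def by blast
  qed
qed simp

end
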